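(* Let $a\in C^1([0,\infty))$ with $a>0$, let $b\in C([0,\infty))$, and put $B(x)=\int_0^x\frac{b(y)}{a(y)}\,dy$. Assume that $$\int^\infty\frac{1}{a(x)}e^{-2B(x)}dx=\infty .$$ Let $H_D=-\frac12\frac{d}{dx}a\frac{d}{dx}-b\frac{d}{dx}$ be the self-adjoint diffusion operator on $L^2((0,\infty),e^{2B}dx)$ with the Dirichlet boundary condition at $0$. Let $X(t)$ be the Markov diffusion process on $(0,\infty)$ corresponding to the operator $-H_D=\frac12\frac{d}{dx}a\frac{d}{dx}+b\frac{d}{dx}$, killed at $\tau_0=\inf\{t\ge0:X(t)=0\}$, and let $E_x$ denote expectation for the process started at $x$. Then for every $x>0$, $$\inf\sigma(H_D)=\sup\{\lambda\ge0:\ E_x\exp(\lambda\tau_0)<\infty\}.$$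
   Context: $H_D$ is the non-negative self-adjoint operator on $L^2((0,\infty),e^{2B}dx)$ associated (Friedrichs extension) with the closure of the form $Q_D(f,g)=\frac12\int_0^\infty a f'g'\,e^{2B}dx$, $f,g\in C_0^1((0,\infty))$ ($C^1$ functions with compact support in the open half-line). $\sigma$ denotes spectrum. The diffusion has generator $\frac12 a u''+(\frac12a'+b)u'$; under the integral hypothesis it satisfies $P_x(\tau_0<\infty)=1$ for all $x>0$. *)

theory Defs
  imports "HOL-Probability.Probability"
begin

section \<open>Square-integrable functions, forms and operators\<close>

text \<open>
  Elements of the complex Hilbert space \<open>L\<^sup>2(\<mu>)\<close> are represented by functions; equality in
  \<open>L\<^sup>2(\<mu>)\<close> is equality almost everywhere. An unbounded operator is represented by its graph, a
  set of pairs of functions that is closed under almost-everywhere equality in both components.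
\<close>

definition L2 :: "'x measure \<Rightarrow> ('x \<Rightarrow> complex) set" where
  "L2 \<mu> = {f \<in> borel_measurable \<mu>. integrable \<mu> (\<lambda>x. (cmod (f x))\<^sup>2)}"

definition L2_inner :: "'x measure \<Rightarrow> ('x \<Rightarrow> complex) \<Rightarrow> ('x \<Rightarrow> complex) \<Rightarrow> complex" where
  "L2_inner \<mu> f g = (\<integral>x. f x * cnj (g x) \<partial>\<mu>)"

definition L2_norm :: "'x measure \<Rightarrow> ('x \<Rightarrow> complex) \<Rightarrow> real" where
  "L2_norm \<mu> f = sqrt (\<integral>x. (cmod (f x))\<^sup>2 \<partial>\<mu>)"

text \<open>
  In the following, \<open>Q\<close> is a nonnegative sesquilinear form with domain \<open>D \<subseteq> L\<^sup>2(\<mu>)\<close>.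
  The sequence \<open>fs\<close> approximates \<open>f\<close> if it converges to \<open>f\<close> in \<open>L\<^sup>2(\<mu>)\<close> and is Cauchy for \<open>Q\<close>.
\<close>

definition form_approx ::
  "'x measure \<Rightarrow> ('x \<Rightarrow> complex) set \<Rightarrow> (('x \<Rightarrow> complex) \<Rightarrow> ('x \<Rightarrow> complex) \<Rightarrow> complex)
    \<Rightarrow> (nat \<Rightarrow> 'x \<Rightarrow> complex) \<Rightarrow> ('x \<Rightarrow> complex) \<Rightarrow> bool" where
  "form_approx \<mu> D Q fs f \<longleftrightarrow>
     (\<forall>n. fs n \<in> D) \<and> f \<in> L2 \<mu> \<and>
     (\<lambda>n. L2_norm \<mu> (\<lambda>x. fs n x - f x)) \<longlonglongrightarrow> 0 \<and>
     (\<forall>e>0. \<exists>N. \<forall>m\<ge>N. \<forall>n\<ge>N.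
        cmod (Q (\<lambda>x. fs m x - fs n x) (\<lambda>x. fs m x - fs n x)) < e)"

definition closure_dom ::
  "'x measure \<Rightarrow> ('x \<Rightarrow> complex) set \<Rightarrow> (('x \<Rightarrow> complex) \<Rightarrow> ('x \<Rightarrow> complex) \<Rightarrow> complex)
    \<Rightarrow> ('x \<Rightarrow> complex) set" where
  "closure_dom \<mu> D Q = {f. \<exists>fs. form_approx \<mu> D Q fs f}"

text \<open>For a closable form the limit exists and does not depend on the approximating sequences.\<close>

definition closure_form ::
  "'x measure \<Rightarrow> ('x \<Rightarrow> complex) set \<Rightarrow> (('x \<Rightarrow> complex) \<Rightarrow> ('x \<Rightarrow> complex) \<Rightarrow> complex)
    \<Rightarrow> ('x \<Rightarrow> complex) \<Rightarrow> ('x \<Rightarrow> complex) \<Rightarrow> complex" where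
  "closure_form \<mu> D Q f g =
     (THE c. \<forall>fs gs. form_approx \<mu> D Q fs f \<longrightarrow> form_approx \<mu> D Q gs g \<longrightarrow>
        (\<lambda>n. Q (fs n) (gs n)) \<longlonglongrightarrow> c)"

definition form_operator ::
  "'x measure \<Rightarrow> ('x \<Rightarrow> complex) set \<Rightarrow> (('x \<Rightarrow> complex) \<Rightarrow> ('x \<Rightarrow> complex) \<Rightarrow> complex)
    \<Rightarrow> (('x \<Rightarrow> complex) \<times> ('x \<Rightarrow> complex)) set" where
  "form_operator \<mu> D Q =
     {(f, h). f \<in> closure_dom \<mu> D Q \<and> h \<in> L2 \<mu> \<and>
        (\<forall>g \<in> closure_dom \<mu> D Q. closure_form \<mu> D Q f g = L2_inner \<mu> h g)}"

definition resolvent_set ::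
  "'x measure \<Rightarrow> (('x \<Rightarrow> complex) \<times> ('x \<Rightarrow> complex)) set \<Rightarrow> complex set" where
  "resolvent_set \<mu> H = {z.
     (\<forall>(f, h) \<in> H. (AE x in \<mu>. h x - z * f x = 0) \<longrightarrow> (AE x in \<mu>. f x = 0)) \<and>
     (\<forall>k \<in> L2 \<mu>. \<exists>(f, h) \<in> H. AE x in \<mu>. h x - z * f x = k x) \<and>
     (\<exists>C. \<forall>(f, h) \<in> H. L2_norm \<mu> f \<le> C * L2_norm \<mu> (\<lambda>x. h x - z * f x))}"

definition operator_spectrum ::
  "'x measure \<Rightarrow> (('x \<Rightarrow> complex) \<times> ('x \<Rightarrow> complex)) set \<Rightarrow> complex set" where
  "operator_spectrum \<mu> H = - resolvent_set \<mu> H"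

section \<open>The Dirichlet operator\<close>

definition drift_potential :: "(real \<Rightarrow> real) \<Rightarrow> (real \<Rightarrow> real) \<Rightarrow> real \<Rightarrow> real" where
  "drift_potential a b x = integral {0..x} (\<lambda>y. b y / a y)"

definition speed_measure :: "(real \<Rightarrow> real) \<Rightarrow> (real \<Rightarrow> real) \<Rightarrow> real measure" where
  "speed_measure a b =
     density (restrict_space lborel {0<..}) (\<lambda>x. ennreal (exp (2 * drift_potential a b x)))"

text \<open>Functions on \<open>(0,\<infinity>)\<close> with compact support are extended by \<open>0\<close> to the real line.\<close>

definition compactly_supported_in :: "('x::topological_space \<Rightarrow> 'y::zero) \<Rightarrow> 'x set \<Rightarrow> bool" where
  "compactly_supported_in f S \<longleftrightarrow> (\<exists>K. compact K \<and> K \<subseteq> S \<and> (\<forall>x. x \<notin> K \<longrightarrow> f x = 0))"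

definition C1_0 :: "(real \<Rightarrow> complex) set" where
  "C1_0 = {f. f C1_differentiable_on UNIV \<and> compactly_supported_in f {0<..}}"

definition Q_D ::
  "(real \<Rightarrow> real) \<Rightarrow> (real \<Rightarrow> real) \<Rightarrow> (real \<Rightarrow> complex) \<Rightarrow> (real \<Rightarrow> complex) \<Rightarrow> complex" where
  "Q_D a b f g = 1/2 * (\<integral>x. of_real (a x) * vector_derivative f (at x)
      * cnj (vector_derivative g (at x)) \<partial>speed_measure a b)"

definition H_D ::
  "(real \<Rightarrow> real) \<Rightarrow> (real \<Rightarrow> real) \<Rightarrow> ((real \<Rightarrow> complex) \<times> (real \<Rightarrow> complex)) set" where
  "H_D a b = form_operator (speed_measure a b) C1_0 (Q_D a b)"

section \<open>The diffusion process\<close>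

definition natural_filtration :: "'w measure \<Rightarrow> (real \<Rightarrow> 'w \<Rightarrow> real) \<Rightarrow> real \<Rightarrow> 'w measure" where
  "natural_filtration M X t =
     sigma (space M) {X s -` A \<inter> space M | s A. 0 \<le> s \<and> s \<le> t \<and> A \<in> sets borel}"

definition is_martingale ::
  "'w measure \<Rightarrow> (real \<Rightarrow> 'w measure) \<Rightarrow> (real \<Rightarrow> 'w \<Rightarrow> real) \<Rightarrow> bool" where
  "is_martingale M F Y \<longleftrightarrow>
     (\<forall>t\<ge>0. Y t \<in> borel_measurable (F t) \<and> integrable M (Y t)) \<and>
     (\<forall>s t. 0 \<le> s \<longrightarrow> s \<le> t \<longrightarrow> (AE \<omega> in M. real_cond_exp M (F s) (Y t) \<omega> = Y s \<omega>))"

definition C2_0 :: "(real \<Rightarrow> real) set" where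
  "C2_0 = {f. f C1_differentiable_on UNIV \<and> deriv f C1_differentiable_on UNIV \<and>
              compactly_supported_in f {0<..}}"

definition generator ::
  "(real \<Rightarrow> real) \<Rightarrow> (real \<Rightarrow> real) \<Rightarrow> (real \<Rightarrow> real) \<Rightarrow> real \<Rightarrow> real" where
  "generator a b u x =
     1/2 * a x * deriv (deriv u) x + (1/2 * deriv a x + b x) * deriv u x"

text \<open>
  The Markov diffusion with this generator, killed on reaching \<open>0\<close>: a family of probability
  measures \<open>P x\<close> (\<open>x > 0\<close>) on a common space on which \<open>X\<close> has continuous paths. The point \<open>0\<close>
  serves as the cemetery, where the killed path stays; functions and sets on the state space
  \<open>(0,\<infinity>)\<close> therefore do not see it. That \<open>X\<close> is governed by the generator is expressed by the
  martingale problem on \<open>C\<^sup>2\<close> functions with compact support in \<open>(0,\<infinity>)\<close>. Paths are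
  real-valued for all times, i.e. explosion to \<open>\<infinity>\<close> is excluded; when the scale function is
  infinite at \<open>\<infinity>\<close>, explosion has probability zero.
\<close>

definition killed_diffusion ::
  "(real \<Rightarrow> real) \<Rightarrow> (real \<Rightarrow> real) \<Rightarrow> (real \<Rightarrow> 'w measure) \<Rightarrow> (real \<Rightarrow> 'w \<Rightarrow> real) \<Rightarrow> bool" where
  "killed_diffusion a b P X \<longleftrightarrow>
     (\<forall>x>0. prob_space (P x)) \<and>
     (\<forall>x>0. \<forall>y>0. sets (P x) = sets (P y)) \<and>
     (\<forall>x>0. \<forall>t\<ge>0. X t \<in> borel_measurable (P x)) \<and>
     (\<forall>x>0. \<forall>\<omega> \<in> space (P x).
        continuous_on {0..} (\<lambda>t. X t \<omega>) \<and> (\<forall>t\<ge>0. 0 \<le> X t \<omega>) \<and>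
        (\<forall>s t. 0 \<le> s \<longrightarrow> s \<le> t \<longrightarrow> X s \<omega> = 0 \<longrightarrow> X t \<omega> = 0)) \<and>
     (\<forall>x>0. AE \<omega> in P x. X 0 \<omega> = x) \<and>
     (\<forall>x>0. \<forall>s\<ge>0. \<forall>t\<ge>0. \<forall>A \<in> sets borel. A \<subseteq> {0<..} \<longrightarrow>
        (AE \<omega> in P x.
           real_cond_exp (P x) (natural_filtration (P x) X s)
             (indicator {\<omega>' \<in> space (P x). X (s + t) \<omega>' \<in> A}) \<omega> =
           (if 0 < X s \<omega>
            then measure (P (X s \<omega>)) {\<omega>' \<in> space (P (X s \<omega>)). X t \<omega>' \<in> A}
            else 0))) \<and>
     (\<forall>x>0. \<forall>f \<in> C2_0.
        is_martingale (P x) (natural_filtration (P x) X)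
          (\<lambda>t \<omega>. f (X t \<omega>) - f (X 0 \<omega>) - integral {0..t} (\<lambda>s. generator a b f (X s \<omega>))))"

definition hitting_time_0 :: "(real \<Rightarrow> 'w \<Rightarrow> real) \<Rightarrow> 'w \<Rightarrow> ereal" where
  "hitting_time_0 X \<omega> = Inf (ereal ` {t. 0 \<le> t \<and> X t \<omega> = 0})"

definition exp_ereal :: "ereal \<Rightarrow> ennreal" where
  "exp_ereal r = (case r of ereal y \<Rightarrow> ennreal (exp y) | PInfty \<Rightarrow> top | MInfty \<Rightarrow> 0)"

end

theory Submission
  imports Defs
begin

text \<open>
  Both sides equal the bottom of the Dirichlet form, that is the largest \<open>\<lambda>\<close> with
  \<open>\<lambda> \<parallel>\<phi>\<parallel>\<^sup>2 \<le> Q\<^sub>D(\<phi>, \<phi>)\<close> for all test functions \<open>\<phi>\<close>. For the spectrum this is the general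
  theory of closable forms. For the exponential moments, let \<open>u\<close> be the solution of
  \<open>L u = - \<lambda> u\<close>, \<open>u(0) = 0\<close>, \<open>a u'(0) = 1\<close>, where \<open>L\<close> is the generator.

  If \<open>u\<close> is positive on \<open>(0, \<infinity>)\<close>, then \<open>\<lambda>\<close> is a lower bound of the form, by Jacobi's identity. If
  \<open>u\<close> vanishes at some point, then a smooth truncation of \<open>u\<close> before its first zero is a compactly
  supported \<open>f \<ge> 0\<close> with \<open>L f \<ge> - \<lambda>' f\<close>, for any given \<open>\<lambda>' > \<lambda>\<close>. On the one hand the form at \<open>f\<close> is at
  most \<open>\<lambda>' \<parallel>f\<parallel>\<^sup>2\<close>. On the other hand \<open>e\<^sup>\<lambda>\<^sup>'\<^sup>t E f(X\<^sub>t)\<close> is nondecreasing, so \<open>P(\<tau>\<^sub>0 > t)\<close> decays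
  no faster than \<open>e\<^sup>-\<^sup>\<lambda>\<^sup>'\<^sup>t\<close> and the exponential moment of order \<open>\<lambda>'\<close> is infinite.

  Conversely, below the bottom of the form, a Wronskian comparison of \<open>u\<close> for two values of
  \<open>\<lambda>\<close> produces a solution \<open>v\<close> with \<open>v(0) > 0\<close> that is positive on \<open>[0, \<infinity>)\<close>. As the scale function is infinite
  at \<open>\<infinity>\<close>, \<open>v\<close> is nondecreasing, hence bounded below by \<open>v(0)\<close>, and \<open>P\<^sub>x(\<tau>\<^sub>0 > t) \<le> e\<^sup>-\<^sup>\<lambda>\<^sup>t v(x) / v(0)\<close>.
\<close>

section \<open>Square-integrable functions and semi-inner products\<close>

text \<open>The martingale problem accepts only C^2 functions with compact support in the open
  half-line, so neither solution of the eigenvalue equation can be inserted into it. This shapes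
  both estimates: \<open>u\<close> is truncated to a global subsolution, which costs a gap between
  two spectral parameters, and \<open>v\<close> is cut off outside compact intervals, with the path
  followed only while it stays inside. The gaps are harmless, because the exponential moment has to
  be decided only strictly below and strictly above the bottom. One truncated function serves both
  halves: its Rayleigh quotient bounds the bottom of the form, and its expectation along the process
  bounds the survival probability from below. Expectations are controlled by one-sided differential
  inequalities in time. The spectrum is treated through resolvents: a variational problem solves the
  equation at real points, a contraction extends this to a half-plane, and optimality of the lower
  bound excludes a bounded inverse at the bottom.\<close>

locale psd_form =
  fixes D :: "('x \<Rightarrow> complex) set"
    and Q :: "('x \<Rightarrow> complex) \<Rightarrow> ('x \<Rightarrow> complex) \<Rightarrow> complex"
  assumes add_mem: "f \<in> D \<Longrightarrow> g \<in> D \<Longrightarrow> (\<lambda>x. f x + g x) \<in> D"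
    and scale_mem: "f \<in> D \<Longrightarrow> (\<lambda>x. c * f x) \<in> D"
    and add_left: "f \<in> D \<Longrightarrow> g \<in> D \<Longrightarrow> h \<in> D \<Longrightarrow> Q (\<lambda>x. f x + g x) h = Q f h + Q g h"
    and scale_left: "f \<in> D \<Longrightarrow> h \<in> D \<Longrightarrow> Q (\<lambda>x. c * f x) h = c * Q f h"
    and hermitian: "f \<in> D \<Longrightarrow> g \<in> D \<Longrightarrow> Q g f = cnj (Q f g)"
    and nonneg: "f \<in> D \<Longrightarrow> 0 \<le> Re (Q f f)"
begin

abbreviation nrm :: "('x \<Rightarrow> complex) \<Rightarrow> real" where "nrm f \<equiv> sqrt (Re (Q f f))"

lemma diff_mem: "f \<in> D \<Longrightarrow> g \<in> D \<Longrightarrow> (\<lambda>x. f x - g x) \<in> D"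
  using add_mem[of f "\<lambda>x. (-1) * g x"] scale_mem[of g "-1"] by simp

lemma diff_left:
  "f \<in> D \<Longrightarrow> g \<in> D \<Longrightarrow> h \<in> D \<Longrightarrow> Q (\<lambda>x. f x - g x) h = Q f h - Q g h"
  using add_left[of f "\<lambda>x. (-1) * g x" h] scale_mem[of g "-1"] scale_left[of g h "-1"] by simp

lemma add_right:
  "f \<in> D \<Longrightarrow> g \<in> D \<Longrightarrow> h \<in> D \<Longrightarrow> Q h (\<lambda>x. f x + g x) = Q h f + Q h g"
  using hermitian[of "\<lambda>x. f x + g x" h] add_mem[of f g] add_left[of f g h]
    hermitian[of f h] hermitian[of g h] by simp

lemma scale_right:
  "f \<in> D \<Longrightarrow> h \<in> D \<Longrightarrow> Q h (\<lambda>x. c * f x) = cnj c * Q h f"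
  using hermitian[of "\<lambda>x. c * f x" h] scale_mem[of f c] scale_left[of f h c] hermitian[of f h]
  by simp

lemma diff_right:
  "f \<in> D \<Longrightarrow> g \<in> D \<Longrightarrow> h \<in> D \<Longrightarrow> Q h (\<lambda>x. f x - g x) = Q h f - Q h g"
  using hermitian[of "\<lambda>x. f x - g x" h] diff_mem[of f g] diff_left[of f g h]
    hermitian[of f h] hermitian[of g h] by simp

lemma Im_diag: "f \<in> D \<Longrightarrow> Im (Q f f) = 0"
  using arg_cong[OF hermitian[of f f], of Im] by simp

lemma cmod_diag: "f \<in> D \<Longrightarrow> cmod (Q f f) = Re (Q f f)"
  using Im_diag[of f] nonneg[of f] by (simp add: cmod_def)

lemma expand_add:
  assumes "f \<in> D" "g \<in> D"
  shows "Re (Q (\<lambda>x. f x + c * g x) (\<lambda>x. f x + c * g x)) =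
    Re (Q f f) + 2 * Re (cnj c * Q f g) + (cmod c)\<^sup>2 * Re (Q g g)"
proof -
  have "Q (\<lambda>x. f x + c * g x) (\<lambda>x. f x + c * g x) =
      Q f f + cnj c * Q f g + c * cnj (Q f g) + c * cnj c * Q g g"
    using assms scale_mem[of g c] add_mem[of f "\<lambda>x. c * g x"] hermitian[of f g]
    by (simp add: add_left add_right scale_left scale_right algebra_simps)
  moreover have "c * cnj c = of_real ((cmod c)\<^sup>2)"
    by (rule complex_norm_square[symmetric])
  ultimately show ?thesis by simp
qed

lemma parallelogram:
  assumes "f \<in> D" "g \<in> D"
  shows "Re (Q (\<lambda>x. f x - g x) (\<lambda>x. f x - g x)) + Re (Q (\<lambda>x. f x + g x) (\<lambda>x. f x + g x))
    = 2 * Re (Q f f) + 2 * Re (Q g g)"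
  using expand_add[OF assms, of "-1"] expand_add[OF assms, of 1] by simp

lemma Cauchy_Schwarz_square:
  assumes "f \<in> D" "g \<in> D"
  shows "(cmod (Q f g))\<^sup>2 \<le> Re (Q f f) * Re (Q g g)"
proof -
  let ?r = "(cmod (Q f g))\<^sup>2" and ?F = "Re (Q f f)" and ?G = "Re (Q g g)"
  \<comment> \<open>The direction \<open>c = - t * Q f g\<close> makes the cross term real, so
    nonnegativity becomes a quadratic inequality in the real \<open>t\<close>; for
    \<open>?G > 0\<close> it is read at its minimiser \<open>1 / ?G\<close>.\<close>
  have *: "0 \<le> ?F - 2 * t * ?r + t\<^sup>2 * ?r * ?G" for t :: real
  proof -
    define c where "c = of_real (-t) * Q f g"
    have "(\<lambda>x. f x + c * g x) \<in> D"
      using assms add_mem scale_mem by blast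
    from nonneg[OF this] have "0 \<le> ?F + 2 * Re (cnj c * Q f g) + (cmod c)\<^sup>2 * ?G"
      using expand_add[OF assms, of c] by simp
    moreover have "cnj c * Q f g = of_real (-t) * of_real ?r"
      unfolding c_def complex_norm_square by (simp add: mult_ac)
    then have "Re (cnj c * Q f g) = - t * ?r"
      by (metis Re_complex_of_real of_real_mult)
    moreover have "(cmod c)\<^sup>2 = t\<^sup>2 * ?r"
      by (simp add: c_def norm_mult power_mult_distrib)
    ultimately show ?thesis by simp
  qed
  show ?thesis
  proof (cases "?G = 0")
    case True
    have "?r = 0"
    proof (rule ccontr)
      assume "?r \<noteq> 0"
      then have "?r > 0" by simp
      \<comment> \<open>For a null vector \<open>g\<close> the inequality is affine in
        \<open>t\<close>; at this \<open>t\<close> the right-hand side is -1.\<close>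
      with *[of "(?F + 1) / (2 * ?r)"] True show False by (simp add: field_simps)
    qed
    then show ?thesis by (simp add: True)
  next
    case False
    then have "?G > 0" using nonneg[OF assms(2)] by linarith
    then show ?thesis using *[of "1 / ?G"]
      by (simp add: power2_eq_square field_simps)
  qed
qed

lemma Cauchy_Schwarz:
  assumes "f \<in> D" "g \<in> D"
  shows "cmod (Q f g) \<le> sqrt (Re (Q f f)) * sqrt (Re (Q g g))"
  using real_le_rsqrt[OF Cauchy_Schwarz_square[OF assms]] by (simp add: real_sqrt_mult)

lemma triangle_add:
  assumes "f \<in> D" "g \<in> D"
  shows "sqrt (Re (Q (\<lambda>x. f x + g x) (\<lambda>x. f x + g x))) \<le> sqrt (Re (Q f f)) + sqrt (Re (Q g g))"
proof (rule real_le_lsqrt)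
  have "Re (Q f g) \<le> sqrt (Re (Q f f)) * sqrt (Re (Q g g))"
    using Cauchy_Schwarz[OF assms] complex_Re_le_cmod order_trans by blast
  then show "Re (Q (\<lambda>x. f x + g x) (\<lambda>x. f x + g x)) \<le> (sqrt (Re (Q f f)) + sqrt (Re (Q g g)))\<^sup>2"
    using expand_add[OF assms, of 1] nonneg[OF assms(1)] nonneg[OF assms(2)]
    by (simp add: power2_sum)
qed (use assms nonneg in auto)

lemma norm_commute:
  assumes "f \<in> D" "g \<in> D"
  shows "Re (Q (\<lambda>x. f x - g x) (\<lambda>x. f x - g x)) = Re (Q (\<lambda>x. g x - f x) (\<lambda>x. g x - f x))"
  using expand_add[OF assms, of "-1"] expand_add[OF assms(2,1), of "-1"] hermitian[OF assms] by simp

lemma triangle_diff: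
  assumes "f \<in> D" "g \<in> D" "h \<in> D"
  shows "sqrt (Re (Q (\<lambda>x. f x - h x) (\<lambda>x. f x - h x))) \<le>
     sqrt (Re (Q (\<lambda>x. f x - g x) (\<lambda>x. f x - g x))) + sqrt (Re (Q (\<lambda>x. g x - h x) (\<lambda>x. g x - h x)))"
  using triangle_add[of "\<lambda>x. f x - g x" "\<lambda>x. g x - h x"] assms diff_mem by simp

text \<open>Joint continuity of the form on norm-bounded sets. It yields both the existence of
  limits along approximating sequences and their independence of the sequences.\<close>

lemma Q_diff_bound:
  assumes "f \<in> D" "g \<in> D" "f' \<in> D" "g' \<in> D"
  shows "cmod (Q f g - Q f' g') \<le>
    nrm (\<lambda>x. f x - f' x) * nrm g + nrm f' * nrm (\<lambda>x. g x - g' x)"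
proof -
  have "Q f g - Q f' g' = Q (\<lambda>x. f x - f' x) g + Q f' (\<lambda>x. g x - g' x)"
    using assms by (simp add: diff_left diff_right)
  also have "cmod \<dots> \<le> cmod (Q (\<lambda>x. f x - f' x) g) + cmod (Q f' (\<lambda>x. g x - g' x))"
    by (rule norm_triangle_ineq)
  finally show ?thesis
    using Cauchy_Schwarz[OF diff_mem[OF assms(1,3)] assms(2)]
      Cauchy_Schwarz[OF assms(3) diff_mem[OF assms(2,4)]] by linarith
qed

lemma Cauchy_bounded:
  fixes fs :: "nat \<Rightarrow> 'x \<Rightarrow> complex"
  assumes fs: "\<And>n. fs n \<in> D"
    and Cauchy: "\<And>e. e > 0 \<Longrightarrow> \<exists>N. \<forall>m\<ge>N. \<forall>n\<ge>N. nrm (\<lambda>x. fs m x - fs n x) < e"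
  obtains M where "\<And>n. nrm (fs n) \<le> M"
proof -
  obtain N where N: "\<forall>m\<ge>N. \<forall>n\<ge>N. nrm (\<lambda>x. fs m x - fs n x) < 1" using Cauchy[of 1] by auto
  have "nrm (fs n) \<le> (\<Sum>i\<le>N. nrm (fs i)) + 1" for n
  proof (cases "n \<le> N")
    case True
    then have "nrm (fs n) \<le> (\<Sum>i\<le>N. nrm (fs i))"
      using nonneg[OF fs] by (intro member_le_sum) auto
    then show ?thesis by simp
  next
    case False
    then have "nrm (\<lambda>x. fs n x - fs N x) < 1" using N by simp
    moreover have "nrm (fs n) \<le> nrm (\<lambda>x. fs n x - fs N x) + nrm (fs N)"
      using triangle_add[OF diff_mem[OF fs fs] fs, of n N N] by simp
    moreover have "nrm (fs N) \<le> (\<Sum>i\<le>N. nrm (fs i))"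
      using member_le_sum[of N "{..N}" "\<lambda>i. nrm (fs i)"] nonneg[OF fs] by simp
    ultimately show ?thesis by linarith
  qed
  then show thesis using that by blast
qed

end

section \<open>The space of square-integrable functions and its completeness\<close>

lemma L2_D: "f \<in> L2 \<mu> \<Longrightarrow> f \<in> borel_measurable \<mu>" "f \<in> L2 \<mu> \<Longrightarrow> integrable \<mu> (\<lambda>x. (cmod (f x))\<^sup>2)"
  by (auto simp: L2_def)

lemma borel_measurable_cnj [measurable (raw)]:
  "f \<in> borel_measurable M \<Longrightarrow> (\<lambda>x. cnj (f x)) \<in> borel_measurable M"
  by (rule borel_measurable_continuous_on[where f = cnj]) (intro continuous_intros)

lemma L2_mult_integrable:
  assumes "f \<in> L2 \<mu>" "g \<in> L2 \<mu>"
  shows "integrable \<mu> (\<lambda>x. f x * cnj (g x))"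
proof (rule Bochner_Integration.integrable_bound)
  show "integrable \<mu> (\<lambda>x. (cmod (f x))\<^sup>2 + (cmod (g x))\<^sup>2)"
    using assms by (auto simp: L2_def)
  show "(\<lambda>x. f x * cnj (g x)) \<in> borel_measurable \<mu>"
    using assms by (auto simp: L2_def)
  have "2 * (r * s) \<le> r\<^sup>2 + s\<^sup>2 \<and> 0 \<le> r\<^sup>2 + s\<^sup>2" for r s :: real
    using sum_squares_bound[of r s] by simp
  then have "r * s \<le> r\<^sup>2 + s\<^sup>2" for r s :: real
    by (smt (verit))
  then show "AE x in \<mu>. norm (f x * cnj (g x)) \<le> norm ((cmod (f x))\<^sup>2 + (cmod (g x))\<^sup>2)"
    by (simp add: norm_mult)
qed

lemma L2_add: assumes "f \<in> L2 \<mu>" "g \<in> L2 \<mu>" shows "(\<lambda>x. f x + g x) \<in> L2 \<mu>"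
proof -
  have "integrable \<mu> (\<lambda>x. (cmod (f x + g x))\<^sup>2)"
  proof (rule Bochner_Integration.integrable_bound)
    show "integrable \<mu> (\<lambda>x. 2 * (cmod (f x))\<^sup>2 + 2 * (cmod (g x))\<^sup>2)"
      using assms by (auto simp: L2_def)
    show "(\<lambda>x. (cmod (f x + g x))\<^sup>2) \<in> borel_measurable \<mu>"
      using assms by (auto simp: L2_def)
    have "(cmod (y + z))\<^sup>2 \<le> 2 * (cmod y)\<^sup>2 + 2 * (cmod z)\<^sup>2" for y z
    proof -
      have "(cmod (y + z))\<^sup>2 \<le> (cmod y + cmod z)\<^sup>2"
        by (simp add: norm_triangle_ineq power_mono)
      also have "\<dots> \<le> 2 * (cmod y)\<^sup>2 + 2 * (cmod z)\<^sup>2"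
        using sum_squares_bound[of "cmod y" "cmod z"] by (simp add: power2_sum)
      finally show ?thesis .
    qed
    then show "AE x in \<mu>. norm ((cmod (f x + g x))\<^sup>2) \<le>
        norm (2 * (cmod (f x))\<^sup>2 + 2 * (cmod (g x))\<^sup>2)" by simp
  qed
  then show ?thesis using assms by (auto simp: L2_def)
qed

lemma L2_scale: "f \<in> L2 \<mu> \<Longrightarrow> (\<lambda>x. c * f x) \<in> L2 \<mu>"
  by (auto simp: L2_def norm_mult power_mult_distrib)

lemma L2_inner_self: "L2_inner \<mu> f f = of_real (\<integral>x. (cmod (f x))\<^sup>2 \<partial>\<mu>)"
proof -
  have "L2_inner \<mu> f f = (\<integral>x. complex_of_real ((cmod (f x))\<^sup>2) \<partial>\<mu>)"
    unfolding L2_inner_def by (intro Bochner_Integration.integral_cong) (rule refl complex_norm_square[symmetric])+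
  then show ?thesis by (simp only: integral_complex_of_real)
qed

lemma L2_norm_inner: "L2_norm \<mu> f = sqrt (Re (L2_inner \<mu> f f))"
  by (simp add: L2_inner_self L2_norm_def)

lemma L2_norm_nonneg: "0 \<le> L2_norm \<mu> f"
  by (simp add: L2_norm_def)

lemma L2_norm_square: "(L2_norm \<mu> f)\<^sup>2 = Re (L2_inner \<mu> f f)"
  by (simp add: L2_inner_self L2_norm_def)

text \<open>The inner product is only semidefinite here, because functions that agree almost
  everywhere are not identified. The laws of \<open>psd_form\<close> thus serve the inner product,
  the Dirichlet form and its shifts alike.\<close>

interpretation L2: psd_form "L2 \<mu>" "L2_inner \<mu>" for \<mu>
proof (unfold_locales)
  fix f g h :: "'a \<Rightarrow> complex" and c :: complex
  assume f: "f \<in> L2 \<mu>"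
  show "(\<lambda>x. c * f x) \<in> L2 \<mu>" using f by (rule L2_scale)
  show "0 \<le> Re (L2_inner \<mu> f f)" by (simp add: L2_inner_self)
  { assume h: "h \<in> L2 \<mu>"
    show "L2_inner \<mu> (\<lambda>x. c * f x) h = c * L2_inner \<mu> f h"
      by (simp add: L2_inner_def mult.assoc) }
  assume g: "g \<in> L2 \<mu>"
  show "(\<lambda>x. f x + g x) \<in> L2 \<mu>" using f g by (rule L2_add)
  have "(\<lambda>x. g x * cnj (f x)) = (\<lambda>x. cnj (f x * cnj (g x)))"
    by (simp add: fun_eq_iff)
  then show "L2_inner \<mu> g f = cnj (L2_inner \<mu> f g)"
    unfolding L2_inner_def by (simp only: Bochner_Integration.integral_cnj)
  assume h: "h \<in> L2 \<mu>"
  show "L2_inner \<mu> (\<lambda>x. f x + g x) h = L2_inner \<mu> f h + L2_inner \<mu> g h"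
    using L2_mult_integrable[OF f h] L2_mult_integrable[OF g h]
    by (simp add: L2_inner_def distrib_right)
qed

lemma L2_Cauchy_Schwarz:
  "f \<in> L2 \<mu> \<Longrightarrow> g \<in> L2 \<mu> \<Longrightarrow> cmod (L2_inner \<mu> f g) \<le> L2_norm \<mu> f * L2_norm \<mu> g"
  using L2.Cauchy_Schwarz by (simp add: L2_norm_inner)

lemma L2_triangle:
  "f \<in> L2 \<mu> \<Longrightarrow> g \<in> L2 \<mu> \<Longrightarrow> L2_norm \<mu> (\<lambda>x. f x + g x) \<le> L2_norm \<mu> f + L2_norm \<mu> g"
  using L2.triangle_add by (simp add: L2_norm_inner)

lemma L2_triangle_diff:
  "f \<in> L2 \<mu> \<Longrightarrow> g \<in> L2 \<mu> \<Longrightarrow> h \<in> L2 \<mu> \<Longrightarrow>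
    L2_norm \<mu> (\<lambda>x. f x - h x) \<le> L2_norm \<mu> (\<lambda>x. f x - g x) + L2_norm \<mu> (\<lambda>x. g x - h x)"
  using L2.triangle_diff by (simp add: L2_norm_inner)

lemma L2_norm_scale: "L2_norm \<mu> (\<lambda>x. c * f x) = cmod c * L2_norm \<mu> f"
  by (simp add: L2_norm_def norm_mult power_mult_distrib real_sqrt_mult)

lemma L2_norm_cong_AE:
  assumes "f \<in> borel_measurable \<mu>" "g \<in> borel_measurable \<mu>" "AE x in \<mu>. f x = g x"
  shows "L2_norm \<mu> f = L2_norm \<mu> g"
proof -
  have "(\<integral>x. (cmod (f x))\<^sup>2 \<partial>\<mu>) = (\<integral>x. (cmod (g x))\<^sup>2 \<partial>\<mu>)"
    by (rule integral_cong_AE) (use assms in auto)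
  then show ?thesis by (simp add: L2_norm_def)
qed

lemma L2_norm_eq_0_AE:
  assumes "f \<in> L2 \<mu>" "L2_norm \<mu> f = 0"
  shows "AE x in \<mu>. f x = 0"
proof -
  have "(\<integral>x. (cmod (f x))\<^sup>2 \<partial>\<mu>) = 0" using assms(2) by (simp add: L2_norm_def)
  then have "AE x in \<mu>. (cmod (f x))\<^sup>2 = 0"
    using integral_nonneg_eq_0_iff_AE[OF L2_D(2)[OF assms(1)]] by simp
  then show ?thesis by simp
qed

lemma nn_integral_L2_norm:
  assumes "f \<in> L2 \<mu>"
  shows "(\<integral>\<^sup>+x. ennreal ((cmod (f x))\<^sup>2) \<partial>\<mu>) = ennreal ((L2_norm \<mu> f)\<^sup>2)"
  using nn_integral_eq_integral[OF L2_D(2)[OF assms]] by (simp add: L2_norm_def)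

text \<open>Turns a bound on a nonnegative integral, the form in which Fatou's lemma delivers it,
  into membership in \<open>L2\<close> and a norm bound.\<close>

lemma L2_I_nn_integral:
  assumes "f \<in> borel_measurable \<mu>" "(\<integral>\<^sup>+x. ennreal ((cmod (f x))\<^sup>2) \<partial>\<mu>) \<le> ennreal (C\<^sup>2)" "0 \<le> C"
  shows "f \<in> L2 \<mu>" "L2_norm \<mu> f \<le> C"
proof -
  have "integrable \<mu> (\<lambda>x. (cmod (f x))\<^sup>2)"
  proof (rule integrableI_bounded)
    show "(\<integral>\<^sup>+x. ennreal (norm ((cmod (f x))\<^sup>2)) \<partial>\<mu>) < \<infinity>"
      using assms(2) by (simp add: le_less_trans)
  qed (use assms in auto)
  then show f: "f \<in> L2 \<mu>" using assms by (simp add: L2_def)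
  have "(L2_norm \<mu> f)\<^sup>2 \<le> C\<^sup>2" using assms(2) nn_integral_L2_norm[OF f] by simp
  then show "L2_norm \<mu> f \<le> C" using assms(3) by (rule power2_le_imp_le)
qed

text \<open>Riesz-Fischer: a subsequence with geometrically small increments converges almost
  everywhere, and Fatou's lemma upgrades this to convergence of the whole sequence in norm.\<close>

lemma L2_complete:
  assumes fs: "\<And>n. fs n \<in> L2 \<mu>"
    and Cauchy: "\<And>e. e > 0 \<Longrightarrow> \<exists>N. \<forall>m\<ge>N. \<forall>n\<ge>N. L2_norm \<mu> (\<lambda>x. fs m x - fs n x) < e"
  obtains f where "f \<in> L2 \<mu>" "(\<lambda>n. L2_norm \<mu> (\<lambda>x. fs n x - f x)) \<longlonglongrightarrow> 0"
proof -
  have [measurable]: "fs n \<in> borel_measurable \<mu>" for n using fs by (auto simp: L2_def)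
  have "\<forall>k. \<exists>N. \<forall>m\<ge>N. \<forall>n\<ge>N. L2_norm \<mu> (\<lambda>x. fs m x - fs n x) < (1/2)^k"
    using Cauchy by simp
  then obtain N where N: "\<And>k m n. m \<ge> N k \<Longrightarrow> n \<ge> N k \<Longrightarrow> L2_norm \<mu> (\<lambda>x. fs m x - fs n x) < (1/2)^k"
    by metis
  \<comment> \<open>Summing the thresholds puts \<open>r k\<close> and \<open>r (Suc k)\<close> both
    beyond \<open>N k\<close>, as the increment \<open>d k\<close> requires; the summand
    \<open>k\<close> makes the indices tend to infinity.\<close>
  define r where "r k = (\<Sum>i\<le>k. N i) + k" for k
  have rN: "N k \<le> r k" for k
    unfolding r_def using member_le_sum[of k "{..k}" N] by simp
  have rk: "k \<le> r k" for k by (simp add: r_def)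
  have r_mono: "N k \<le> r (Suc k)" for k
    using rN[of k] by (simp add: r_def)
  \<comment> \<open>The weights \<open>2\<^sup>k\<close> turn the estimate of \<open>\<Sum>k. 2\<^sup>k |d k x|\<^sup>2\<close> into pointwise absolute convergence,
    without the triangle inequality for infinite sums.\<close>
  define d where "d k x = fs (r (Suc k)) x - fs (r k) x" for k x
  have d2: "d k \<in> L2 \<mu>" for k
    unfolding d_def using L2.diff_mem fs by blast
  have [measurable]: "d k \<in> borel_measurable \<mu>" for k using d2 by (auto simp: L2_def)
  have dk: "L2_norm \<mu> (d k) \<le> (1/2)^k" for k
    using N[OF r_mono rN, of k] by (simp add: d_def[abs_def] less_imp_le)
  have "(\<integral>\<^sup>+x. (\<Sum>k. ennreal (2^k * (cmod (d k x))\<^sup>2)) \<partial>\<mu>) = (\<Sum>k. \<integral>\<^sup>+x. ennreal (2^k * (cmod (d k x))\<^sup>2) \<partial>\<mu>)"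
    by (rule nn_integral_suminf) simp
  also have "\<dots> = (\<Sum>k. ennreal (2^k) * ennreal ((L2_norm \<mu> (d k))\<^sup>2))"
    using nn_integral_L2_norm[OF d2] by (simp add: ennreal_mult nn_integral_cmult)
  also have "\<dots> \<le> (\<Sum>k. ennreal ((1/2)^k))"
  proof (rule suminf_le)
    fix k
    have "2^k * (L2_norm \<mu> (d k))\<^sup>2 \<le> 2^k * ((1/2)^k)\<^sup>2"
      using dk[of k] L2_norm_nonneg by (intro mult_left_mono power_mono) auto
    also have "\<dots> = (1/2)^k"
      by (simp add: power2_eq_square power_one_over)
    finally show "ennreal (2^k) * ennreal ((L2_norm \<mu> (d k))\<^sup>2) \<le> ennreal ((1/2)^k)"
      by (simp flip: ennreal_mult)
  qed auto
  also have "\<dots> < \<infinity>"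
  proof -
    have "(\<Sum>k. ennreal ((1/2)^k)) = ennreal (\<Sum>k. (1/2)^k)"
      by (rule suminf_ennreal2) auto
    then show ?thesis by simp
  qed
  finally have fin: "(\<integral>\<^sup>+x. (\<Sum>k. ennreal (2^k * (cmod (d k x))\<^sup>2)) \<partial>\<mu>) \<noteq> \<infinity>" by simp
  have AE_conv: "AE x in \<mu>. convergent (\<lambda>k. fs (r k) x)"
  proof -
    have "AE x in \<mu>. (\<Sum>k. ennreal (2^k * (cmod (d k x))\<^sup>2)) \<noteq> \<infinity>"
      by (rule nn_integral_noteq_infinite) (use fin in auto)
    then show ?thesis
    proof (rule AE_mp, intro AE_I2 impI)
      fix x assume "(\<Sum>k. ennreal (2^k * (cmod (d k x))\<^sup>2)) \<noteq> \<infinity>"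
      then have s: "summable (\<lambda>k. 2^k * (cmod (d k x))\<^sup>2)"
        by (intro summable_suminf_not_top) auto
      have "summable (\<lambda>k. cmod (d k x))"
      proof (rule summable_comparison_test)
        show "summable (\<lambda>k. 2^k * (cmod (d k x))\<^sup>2 + (1/2)^k)"
          using s by (intro summable_add summable_geometric) auto
        show "\<exists>M. \<forall>k\<ge>M. norm (cmod (d k x)) \<le> 2^k * (cmod (d k x))\<^sup>2 + (1/2)^k"
        proof (intro exI allI impI)
          fix k
          have "0 \<le> (2^k * cmod (d k x) - 1)\<^sup>2" by simp
          then have "2 * (2^k * cmod (d k x)) \<le> (2^k)\<^sup>2 * (cmod (d k x))\<^sup>2 + 1"
            by (simp add: power2_diff power_mult_distrib)
          then have "2^k * cmod (d k x) \<le> (2^k)\<^sup>2 * (cmod (d k x))\<^sup>2 + 1"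
            by (smt (verit) norm_ge_zero zero_le_mult_iff zero_le_power)
          then have "2^k * cmod (d k x) \<le> 2^k * (2^k * (cmod (d k x))\<^sup>2 + (1/2)^k)"
            by (simp add: algebra_simps power2_eq_square power_one_over)
          then show "norm (cmod (d k x)) \<le> 2^k * (cmod (d k x))\<^sup>2 + (1/2)^k" by simp
        qed
      qed
      then have "summable (\<lambda>k. d k x)" by (rule summable_norm_cancel)
      then have "convergent (\<lambda>n. \<Sum>k<n. d k x)" by (simp add: summable_iff_convergent)
      moreover have "(\<Sum>k<n. d k x) = fs (r n) x - fs (r 0) x" for n
        unfolding d_def by (rule sum_lessThan_telescope)
      ultimately have "convergent (\<lambda>n. (fs (r n) x - fs (r 0) x) + fs (r 0) x)"
        by (intro convergent_add convergent_const) auto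
      then show "convergent (\<lambda>k. fs (r k) x)" by simp
    qed
  qed
  define f where "f x = lim (\<lambda>k. fs (r k) x)" for x
  have [measurable]: "f \<in> borel_measurable \<mu>"
    unfolding f_def by (rule borel_measurable_lim_metric) simp
  have AE_lim: "AE x in \<mu>. (\<lambda>k. fs (r k) x) \<longlonglongrightarrow> f x"
    using AE_conv by (simp add: f_def convergent_LIMSEQ_iff)
  \<comment> \<open>Fatou's lemma along the subsequence, for a single \<open>n\<close>; the Cauchy
    estimate for that \<open>n\<close> is the only input.\<close>
  have bound: "(\<lambda>x. fs n x - f x) \<in> L2 \<mu> \<and> L2_norm \<mu> (\<lambda>x. fs n x - f x) \<le> e"
    if e: "e > 0" and n: "\<And>m. m \<ge> M \<Longrightarrow> L2_norm \<mu> (\<lambda>x. fs n x - fs m x) < e" for n e M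
  proof -
    have "(\<integral>\<^sup>+x. ennreal ((cmod (fs n x - f x))\<^sup>2) \<partial>\<mu>) =
        (\<integral>\<^sup>+x. liminf (\<lambda>k. ennreal ((cmod (fs n x - fs (r k) x))\<^sup>2)) \<partial>\<mu>)"
    proof (rule nn_integral_cong_AE)
      show "AE x in \<mu>. ennreal ((cmod (fs n x - f x))\<^sup>2) =
          liminf (\<lambda>k. ennreal ((cmod (fs n x - fs (r k) x))\<^sup>2))"
        using AE_lim
      proof (rule AE_mp, intro AE_I2 impI)
        fix x assume "(\<lambda>k. fs (r k) x) \<longlonglongrightarrow> f x"
        then have "(\<lambda>k. ennreal ((cmod (fs n x - fs (r k) x))\<^sup>2)) \<longlonglongrightarrow> ennreal ((cmod (fs n x - f x))\<^sup>2)"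
          by (intro tendsto_ennrealI tendsto_power tendsto_norm tendsto_diff tendsto_const)
        then show "ennreal ((cmod (fs n x - f x))\<^sup>2) = liminf (\<lambda>k. ennreal ((cmod (fs n x - fs (r k) x))\<^sup>2))"
          using lim_imp_Liminf[OF sequentially_bot] by metis
      qed
    qed
    also have "\<dots> \<le> liminf (\<lambda>k. \<integral>\<^sup>+x. ennreal ((cmod (fs n x - fs (r k) x))\<^sup>2) \<partial>\<mu>)"
      by (rule nn_integral_liminf) simp
    also have "\<dots> = liminf (\<lambda>k. ennreal ((L2_norm \<mu> (\<lambda>x. fs n x - fs (r k) x))\<^sup>2))"
      using nn_integral_L2_norm[OF L2.diff_mem[OF fs fs]] by simp
    also have "\<dots> \<le> ennreal (e\<^sup>2)"
    proof -
      have "eventually (\<lambda>k. ennreal ((L2_norm \<mu> (\<lambda>x. fs n x - fs (r k) x))\<^sup>2) \<le> ennreal (e\<^sup>2)) sequentially"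
        using eventually_ge_at_top[of M]
      proof eventually_elim
        case (elim k)
        then have "L2_norm \<mu> (\<lambda>x. fs n x - fs (r k) x) < e" using n[of "r k"] rk[of k] by simp
        then show ?case
          using L2_norm_nonneg by (intro ennreal_leI power_mono) auto
      qed
      then show ?thesis
        by (intro order_trans[OF Liminf_le_Limsup[OF sequentially_bot] Limsup_bounded])
    qed
    finally have "(\<integral>\<^sup>+x. ennreal ((cmod (fs n x - f x))\<^sup>2) \<partial>\<mu>) \<le> ennreal (e\<^sup>2)" .
    from L2_I_nn_integral[OF _ this] e show ?thesis by simp
  qed
  have key: "\<exists>M. \<forall>n\<ge>M. (\<lambda>x. fs n x - f x) \<in> L2 \<mu> \<and> L2_norm \<mu> (\<lambda>x. fs n x - f x) \<le> e" if e: "e > 0" for e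
  proof -
    obtain M where "\<forall>m\<ge>M. \<forall>n\<ge>M. L2_norm \<mu> (\<lambda>x. fs m x - fs n x) < e" using Cauchy[OF e] by blast
    then show ?thesis using bound[OF e, where M = M] by blast
  qed
  show thesis
  proof
    obtain M where "(\<lambda>x. fs M x - f x) \<in> L2 \<mu>" using key[of 1] by auto
    from L2.diff_mem[OF fs[of M] this] show "f \<in> L2 \<mu>" by simp
    show "(\<lambda>n. L2_norm \<mu> (\<lambda>x. fs n x - f x)) \<longlonglongrightarrow> 0"
    proof (rule LIMSEQ_I)
      fix e :: real assume "e > 0"
      then obtain M where "\<forall>n\<ge>M. L2_norm \<mu> (\<lambda>x. fs n x - f x) \<le> e/2" using key[of "e/2"] by auto
      then have "norm (L2_norm \<mu> (\<lambda>x. fs n x - f x) - 0) < e" if "n \<ge> M" for n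
        using \<open>e > 0\<close> L2_norm_nonneg[of \<mu> "\<lambda>x. fs n x - f x"] that by force
      then show "\<exists>M. \<forall>n\<ge>M. norm (L2_norm \<mu> (\<lambda>x. fs n x - f x) - 0) < e" by blast
    qed
  qed
qed

section \<open>The bottom of the spectrum of a form operator\<close>

text \<open>Write \<open>Q (fs n) (fs n)\<close> as \<open>Q (fs n) (fs n - fs N)\<close> plus
  \<open>Q (fs n) (fs N)\<close>. The first is small because the sequence is Cauchy and bounded, the
  second by weak convergence with \<open>N\<close> fixed. Closability is thereby reduced to testing
  against fixed elements of the domain.\<close>

lemma (in psd_form) closable_of_weak_null:
  fixes fs :: "nat \<Rightarrow> 'x \<Rightarrow> complex"
  assumes fs: "\<And>n. fs n \<in> D"
    and Cauchy: "\<And>e. e > 0 \<Longrightarrow> \<exists>N. \<forall>m\<ge>N. \<forall>n\<ge>N. nrm (\<lambda>x. fs m x - fs n x) < e"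
    and weak: "\<And>g. g \<in> D \<Longrightarrow> (\<lambda>n. Q (fs n) g) \<longlonglongrightarrow> 0"
  shows "(\<lambda>n. nrm (fs n)) \<longlonglongrightarrow> 0"
proof (rule LIMSEQ_I)
  fix e :: real assume e: "e > 0"
  obtain M where M: "\<And>n. nrm (fs n) \<le> M" by (rule Cauchy_bounded[OF fs Cauchy]) auto
  have M0: "M \<ge> 0" using M[of 0] nonneg[OF fs, of 0] by (meson order_trans real_sqrt_ge_zero)
  have "e\<^sup>2 / (2 * (M + 1)) > 0" using e M0 by simp
  from Cauchy[OF this] obtain N
    where N: "\<forall>m\<ge>N. \<forall>n\<ge>N. nrm (\<lambda>x. fs m x - fs n x) < e\<^sup>2 / (2 * (M + 1))" by blast
  have "\<exists>K. \<forall>n\<ge>K. norm (Q (fs n) (fs N) - 0) < e\<^sup>2 / 2"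
    using LIMSEQ_D[OF weak[OF fs[of N]], of "e\<^sup>2 / 2"] e by simp
  then obtain K where K: "\<forall>n\<ge>K. norm (Q (fs n) (fs N) - 0) < e\<^sup>2 / 2" by blast
  have "nrm (fs n) < e" if n: "n \<ge> max N K" for n
  proof -
    have nN: "n \<ge> N" "n \<ge> K" using n by auto
    have "Q (fs n) (fs n) = Q (fs n) (\<lambda>x. fs n x - fs N x) + Q (fs n) (fs N)"
      using diff_right[OF fs[of n] fs[of N] fs[of n]] by simp
    then have "Re (Q (fs n) (fs n)) \<le> cmod (Q (fs n) (\<lambda>x. fs n x - fs N x)) + cmod (Q (fs n) (fs N))"
      by (metis complex_Re_le_cmod norm_triangle_ineq order_trans)
    also have "cmod (Q (fs n) (\<lambda>x. fs n x - fs N x)) \<le> nrm (fs n) * nrm (\<lambda>x. fs n x - fs N x)"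
      by (rule Cauchy_Schwarz[OF fs diff_mem[OF fs fs]])
    also have "\<dots> \<le> M * (e\<^sup>2 / (2 * (M + 1)))"
      using M N nN M0 nonneg[OF fs] nonneg[OF diff_mem[OF fs[of n] fs[of N]]]
      by (intro mult_mono) (auto intro: less_imp_le)
    also have "\<dots> \<le> e\<^sup>2 / 2" using M0 e by (simp add: field_simps)
    also have "cmod (Q (fs n) (fs N)) < e\<^sup>2 / 2" using K nN by simp
    finally have "Re (Q (fs n) (fs n)) < e\<^sup>2" by simp
    then show ?thesis using e real_sqrt_less_mono by fastforce
  qed
  then show "\<exists>K. \<forall>n\<ge>K. norm (nrm (fs n) - 0) < e"
    using nonneg[OF fs] by (intro exI[of _ "max N K"]) auto
qed

section \<open>The closure of a closable form and its operator\<close>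

locale closable_form = psd_form D Q
  for D :: "('x \<Rightarrow> complex) set" and Q +
  fixes \<mu> :: "'x measure"
  assumes dom_nonempty: "D \<noteq> {}"
    and dom_L2: "f \<in> D \<Longrightarrow> f \<in> L2 \<mu>"
    and closable: "(\<And>n. fs n \<in> D) \<Longrightarrow> (\<lambda>n. L2_norm \<mu> (fs n)) \<longlonglongrightarrow> 0 \<Longrightarrow>
      (\<And>e. e > 0 \<Longrightarrow> \<exists>N. \<forall>m\<ge>N. \<forall>n\<ge>N. nrm (\<lambda>x. fs m x - fs n x) < e) \<Longrightarrow>
      (\<lambda>n. nrm (fs n)) \<longlonglongrightarrow> 0"
begin

abbreviation "approx \<equiv> form_approx \<mu> D Q"
abbreviation "cdom \<equiv> closure_dom \<mu> D Q"
abbreviation "cform \<equiv> closure_form \<mu> D Q"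
abbreviation "H \<equiv> form_operator \<mu> D Q"

lemma approxD:
  assumes "approx fs f"
  shows "\<And>n. fs n \<in> D" "f \<in> L2 \<mu>" "(\<lambda>n. L2_norm \<mu> (\<lambda>x. fs n x - f x)) \<longlonglongrightarrow> 0"
    and "\<And>e. e > 0 \<Longrightarrow> \<exists>N. \<forall>m\<ge>N. \<forall>n\<ge>N. nrm (\<lambda>x. fs m x - fs n x) < e"
proof -
  show D: "\<And>n. fs n \<in> D" and "f \<in> L2 \<mu>" "(\<lambda>n. L2_norm \<mu> (\<lambda>x. fs n x - f x)) \<longlonglongrightarrow> 0"
    using assms by (auto simp: form_approx_def)
  fix e :: real assume "e > 0"
  then have "\<exists>N. \<forall>m\<ge>N. \<forall>n\<ge>N. cmod (Q (\<lambda>x. fs m x - fs n x) (\<lambda>x. fs m x - fs n x)) < e\<^sup>2"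
    using assms by (simp add: form_approx_def)
  then obtain N where N: "\<forall>m\<ge>N. \<forall>n\<ge>N. Re (Q (\<lambda>x. fs m x - fs n x) (\<lambda>x. fs m x - fs n x)) < e\<^sup>2"
    using cmod_diag[OF diff_mem[OF D D]] by metis
  have "nrm (\<lambda>x. fs m x - fs n x) < e" if "m \<ge> N" "n \<ge> N" for m n
    using N that \<open>e > 0\<close> real_sqrt_less_mono[of _ "e\<^sup>2"] by fastforce
  then show "\<exists>N. \<forall>m\<ge>N. \<forall>n\<ge>N. nrm (\<lambda>x. fs m x - fs n x) < e" by blast
qed

lemma approxI:
  assumes "\<And>n. fs n \<in> D" "f \<in> L2 \<mu>" "(\<lambda>n. L2_norm \<mu> (\<lambda>x. fs n x - f x)) \<longlonglongrightarrow> 0"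
    and Cauchy: "\<And>e. e > 0 \<Longrightarrow> \<exists>N. \<forall>m\<ge>N. \<forall>n\<ge>N. nrm (\<lambda>x. fs m x - fs n x) < e"
  shows "approx fs f"
  unfolding form_approx_def
proof (intro conjI allI impI)
  fix e :: real assume "e > 0"
  then obtain N where N: "\<forall>m\<ge>N. \<forall>n\<ge>N. nrm (\<lambda>x. fs m x - fs n x) < sqrt e"
    using Cauchy[of "sqrt e"] by auto
  then show "\<exists>N. \<forall>m\<ge>N. \<forall>n\<ge>N. cmod (Q (\<lambda>x. fs m x - fs n x) (\<lambda>x. fs m x - fs n x)) < e"
    using cmod_diag[OF diff_mem[OF assms(1,1)]] by (intro exI[of _ N]) simp
qed (use assms in auto)

lemma approx_const: assumes "g \<in> D" shows "approx (\<lambda>_. g) g"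
proof (rule approxI)
  have "Q (\<lambda>x. 0) (\<lambda>x. 0) = 0" using diff_left[of g g "\<lambda>x. 0"] diff_mem[of g g] assms by simp
  then show "\<exists>N. \<forall>m\<ge>N. \<forall>n\<ge>N. nrm (\<lambda>x. g x - g x) < e" if "e > 0" for e using that by simp
qed (use assms dom_L2 in \<open>auto simp: L2_norm_def\<close>)

lemma approx_diff:
  assumes f: "approx fs f" and g: "approx gs g"
  shows "approx (\<lambda>n x. fs n x - gs n x) (\<lambda>x. f x - g x)"
proof (rule approxI)
  note F = approxD[OF f] and G = approxD[OF g]
  show "(\<lambda>x. fs n x - gs n x) \<in> D" for n using F(1) G(1) diff_mem by blast
  show "(\<lambda>x. f x - g x) \<in> L2 \<mu>" using F(2) G(2) L2.diff_mem by blast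
  have le: "L2_norm \<mu> (\<lambda>x. fs n x - gs n x - (f x - g x)) \<le>
      L2_norm \<mu> (\<lambda>x. fs n x - f x) + L2_norm \<mu> (\<lambda>x. gs n x - g x)" for n
  proof -
    have "(\<lambda>x. fs n x - gs n x - (f x - g x)) = (\<lambda>x. (fs n x - f x) + - 1 * (gs n x - g x))"
      by (auto simp: fun_eq_iff)
    moreover have "(\<lambda>x. fs n x - f x) \<in> L2 \<mu>" "(\<lambda>x. gs n x - g x) \<in> L2 \<mu>"
      using F(1,2) G(1,2) dom_L2 L2.diff_mem by blast+
    ultimately show ?thesis
      using L2_triangle[OF _ L2_scale, of "\<lambda>x. fs n x - f x" \<mu> "\<lambda>x. gs n x - g x" "-1"]
        L2_norm_scale[of \<mu> "-1" "\<lambda>x. gs n x - g x"] by simp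
  qed
  show "(\<lambda>n. L2_norm \<mu> (\<lambda>x. fs n x - gs n x - (f x - g x))) \<longlonglongrightarrow> 0"
    by (rule tendsto_sandwich[of "\<lambda>_. 0", OF _ _ tendsto_const tendsto_add_zero[OF F(3) G(3)]])
      (use le in \<open>auto simp: L2_norm_nonneg\<close>)
  fix e :: real assume "e > 0"
  then obtain M N where M: "\<forall>m\<ge>M. \<forall>n\<ge>M. nrm (\<lambda>x. fs m x - fs n x) < e/2"
    and N: "\<forall>m\<ge>N. \<forall>n\<ge>N. nrm (\<lambda>x. gs m x - gs n x) < e/2"
    using F(4)[of "e/2"] G(4)[of "e/2"] by auto
  have "nrm (\<lambda>x. fs m x - gs m x - (fs n x - gs n x)) < e" if "m \<ge> max M N" "n \<ge> max M N" for m n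
  proof -
    have "(\<lambda>x. fs m x - gs m x - (fs n x - gs n x)) = (\<lambda>x. (fs m x - fs n x) + (gs n x - gs m x))"
      by (auto simp: fun_eq_iff)
    then have "nrm (\<lambda>x. fs m x - gs m x - (fs n x - gs n x)) \<le>
        nrm (\<lambda>x. fs m x - fs n x) + nrm (\<lambda>x. gs n x - gs m x)"
      using triangle_add[OF diff_mem[OF F(1) F(1)] diff_mem[OF G(1) G(1)]] by simp
    moreover have "nrm (\<lambda>x. fs m x - fs n x) < e/2" "nrm (\<lambda>x. gs n x - gs m x) < e/2"
      using M N that by auto
    ultimately show ?thesis by linarith
  qed
  then show "\<exists>N. \<forall>m\<ge>N. \<forall>n\<ge>N. nrm (\<lambda>x. fs m x - gs m x - (fs n x - gs n x)) < e" by blast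
qed

lemma approx_zero:
  assumes "approx fs (\<lambda>x. 0)"
  shows "(\<lambda>n. nrm (fs n)) \<longlonglongrightarrow> 0"
  using approxD[OF assms] by (intro closable) auto

lemma Q_convergent:
  assumes f: "approx fs f" and g: "approx gs g"
  shows "convergent (\<lambda>n. Q (fs n) (gs n))"
proof -
  note F = approxD[OF f] and G = approxD[OF g]
  obtain A where A: "\<And>n. nrm (fs n) \<le> A" using Cauchy_bounded[OF F(1,4)] by blast
  obtain B where B: "\<And>n. nrm (gs n) \<le> B" using Cauchy_bounded[OF G(1,4)] by blast
  have A0: "0 \<le> A" using A[of 0] nonneg[OF F(1)[of 0]] by (meson order_trans real_sqrt_ge_zero)
  have B0: "0 \<le> B" using B[of 0] nonneg[OF G(1)[of 0]] by (meson order_trans real_sqrt_ge_zero)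
  have "Cauchy (\<lambda>n. Q (fs n) (gs n))"
  proof (rule metric_CauchyI)
    fix e :: real assume e: "e > 0"
    then have "e / (A + B + 1) > 0" using A0 B0 by simp
    then obtain M N where M: "\<forall>m\<ge>M. \<forall>n\<ge>M. nrm (\<lambda>x. fs m x - fs n x) < e / (A + B + 1)"
      and N: "\<forall>m\<ge>N. \<forall>n\<ge>N. nrm (\<lambda>x. gs m x - gs n x) < e / (A + B + 1)"
      using F(4) G(4) by meson
    have "dist (Q (fs m) (gs m)) (Q (fs n) (gs n)) < e" if "m \<ge> max M N" "n \<ge> max M N" for m n
    proof -
      have "dist (Q (fs m) (gs m)) (Q (fs n) (gs n)) \<le>
          nrm (\<lambda>x. fs m x - fs n x) * nrm (gs m) + nrm (fs n) * nrm (\<lambda>x. gs m x - gs n x)"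
        unfolding dist_norm by (rule Q_diff_bound[OF F(1) G(1) F(1) G(1)])
      also have "\<dots> \<le> e / (A + B + 1) * B + A * (e / (A + B + 1))"
        using M N that A B A0 e B0 nonneg[OF F(1)] nonneg[OF G(1)]
          nonneg[OF diff_mem[OF F(1) F(1)]] nonneg[OF diff_mem[OF G(1) G(1)]]
        by (intro add_mono mult_mono) (auto simp: less_imp_le)
      also have "\<dots> = e * ((A + B) / (A + B + 1))" by (simp add: add_divide_distrib algebra_simps)
      also have "\<dots> < e * 1" using e A0 B0 by (intro mult_strict_left_mono) (auto simp: divide_simps)
      finally show ?thesis by simp
    qed
    then show "\<exists>M. \<forall>m\<ge>M. \<forall>n\<ge>M. dist (Q (fs m) (gs m)) (Q (fs n) (gs n)) < e" by blast
  qed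
  then show ?thesis by (simp add: Cauchy_convergent_iff)
qed

text \<open>The difference of two approximations of the same function approximates 0, so closability
  makes it small in the form norm, and \<open>Q_diff_bound\<close> applies.\<close>

lemma Q_limit_unique:
  assumes f: "approx fs f" and g: "approx gs g" and f': "approx fs' f" and g': "approx gs' g"
  shows "(\<lambda>n. Q (fs n) (gs n) - Q (fs' n) (gs' n)) \<longlonglongrightarrow> 0"
proof -
  note F = approxD[OF f] and G = approxD[OF g] and F' = approxD[OF f'] and G' = approxD[OF g']
  have zf: "(\<lambda>n. nrm (\<lambda>x. fs n x - fs' n x)) \<longlonglongrightarrow> 0"
    using approx_zero approx_diff[OF f f'] by simp
  have zg: "(\<lambda>n. nrm (\<lambda>x. gs n x - gs' n x)) \<longlonglongrightarrow> 0"
    using approx_zero approx_diff[OF g g'] by simp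
  obtain A where A: "\<And>n. nrm (fs' n) \<le> A" using Cauchy_bounded[OF F'(1,4)] by blast
  obtain B where B: "\<And>n. nrm (gs n) \<le> B" using Cauchy_bounded[OF G(1,4)] by blast
  have lim: "(\<lambda>n. nrm (\<lambda>x. fs n x - fs' n x) * B + A * nrm (\<lambda>x. gs n x - gs' n x)) \<longlonglongrightarrow> 0"
    using tendsto_add[OF tendsto_mult_right[OF zf, of B] tendsto_mult_left[OF zg, of A]] by simp
  show ?thesis
  proof (rule Lim_null_comparison[OF _ lim], rule always_eventually, rule allI)
    fix n
    have "norm (Q (fs n) (gs n) - Q (fs' n) (gs' n)) \<le>
        nrm (\<lambda>x. fs n x - fs' n x) * nrm (gs n) + nrm (fs' n) * nrm (\<lambda>x. gs n x - gs' n x)"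
      by (rule Q_diff_bound[OF F(1) G(1) F'(1) G'(1)])
    also have "\<dots> \<le> nrm (\<lambda>x. fs n x - fs' n x) * B + A * nrm (\<lambda>x. gs n x - gs' n x)"
      using A B nonneg[OF diff_mem[OF F(1) F'(1)]] nonneg[OF diff_mem[OF G(1) G'(1)]]
      by (intro add_mono mult_left_mono mult_right_mono) auto
    finally show "norm (Q (fs n) (gs n) - Q (fs' n) (gs' n)) \<le>
      nrm (\<lambda>x. fs n x - fs' n x) * B + A * nrm (\<lambda>x. gs n x - gs' n x)" .
  qed
qed

text \<open>Existence and uniqueness of the limit together make the definite description in
  \<open>closure_form\<close> denote it.\<close>

lemma cform_limit:
  assumes f: "approx fs f" and g: "approx gs g"
  shows "(\<lambda>n. Q (fs n) (gs n)) \<longlonglongrightarrow> cform f g"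
proof -
  obtain c where c: "(\<lambda>n. Q (fs n) (gs n)) \<longlonglongrightarrow> c"
    using Q_convergent[OF f g] by (auto simp: convergent_def)
  have all: "(\<lambda>n. Q (fs' n) (gs' n)) \<longlonglongrightarrow> c" if "approx fs' f" "approx gs' g" for fs' gs'
    using tendsto_diff[OF c Q_limit_unique[OF f g that]] by simp
  have "cform f g = c"
    unfolding closure_form_def
  proof (rule the_equality)
    show "\<forall>fs gs. approx fs f \<longrightarrow> approx gs g \<longrightarrow> (\<lambda>n. Q (fs n) (gs n)) \<longlonglongrightarrow> c"
      using all by blast
    fix c' assume "\<forall>fs gs. approx fs f \<longrightarrow> approx gs g \<longrightarrow> (\<lambda>n. Q (fs n) (gs n)) \<longlonglongrightarrow> c'"
    then show "c' = c" using f g c LIMSEQ_unique by blast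
  qed
  then show ?thesis using c by simp
qed

lemma L2_inner_limit:
  assumes f: "approx fs f" and g: "approx gs g"
  shows "(\<lambda>n. L2_inner \<mu> (fs n) (gs n)) \<longlonglongrightarrow> L2_inner \<mu> f g"
proof -
  note F = approxD[OF f] and G = approxD[OF g]
  have lim: "(\<lambda>n. L2_norm \<mu> (\<lambda>x. fs n x - f x) * (L2_norm \<mu> (\<lambda>x. gs n x - g x) + L2_norm \<mu> g) +
      L2_norm \<mu> f * L2_norm \<mu> (\<lambda>x. gs n x - g x)) \<longlonglongrightarrow> 0 * (0 + L2_norm \<mu> g) + L2_norm \<mu> f * 0"
    using F(3) G(3) by (intro tendsto_intros)
  have "(\<lambda>n. L2_inner \<mu> (fs n) (gs n) - L2_inner \<mu> f g) \<longlonglongrightarrow> 0"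
  proof (rule Lim_null_comparison)
    show "(\<lambda>n. L2_norm \<mu> (\<lambda>x. fs n x - f x) * (L2_norm \<mu> (\<lambda>x. gs n x - g x) + L2_norm \<mu> g) +
      L2_norm \<mu> f * L2_norm \<mu> (\<lambda>x. gs n x - g x)) \<longlonglongrightarrow> 0" using lim by simp
    show "\<forall>\<^sub>F n in sequentially. norm (L2_inner \<mu> (fs n) (gs n) - L2_inner \<mu> f g) \<le>
        L2_norm \<mu> (\<lambda>x. fs n x - f x) * (L2_norm \<mu> (\<lambda>x. gs n x - g x) + L2_norm \<mu> g) +
        L2_norm \<mu> f * L2_norm \<mu> (\<lambda>x. gs n x - g x)"
    proof (rule always_eventually, rule allI)
      fix n
      have "norm (L2_inner \<mu> (fs n) (gs n) - L2_inner \<mu> f g) \<le>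
        L2_norm \<mu> (\<lambda>x. fs n x - f x) * L2_norm \<mu> (gs n) + L2_norm \<mu> f * L2_norm \<mu> (\<lambda>x. gs n x - g x)"
        using L2.Q_diff_bound[of "fs n" \<mu> "gs n" f g] F G dom_L2 by (simp add: L2_norm_inner)
      moreover have "L2_norm \<mu> (gs n) \<le> L2_norm \<mu> (\<lambda>x. gs n x - g x) + L2_norm \<mu> g"
        using L2_triangle[of "\<lambda>x. gs n x - g x" \<mu> g] L2.diff_mem[of "gs n" \<mu> g] dom_L2[OF G(1)] G(2) by simp
      ultimately show "norm (L2_inner \<mu> (fs n) (gs n) - L2_inner \<mu> f g) \<le>
        L2_norm \<mu> (\<lambda>x. fs n x - f x) * (L2_norm \<mu> (\<lambda>x. gs n x - g x) + L2_norm \<mu> g) +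
        L2_norm \<mu> f * L2_norm \<mu> (\<lambda>x. gs n x - g x)"
        by (smt (verit) L2_norm_nonneg mult_left_mono)
    qed
  qed
  then show ?thesis by (simp add: LIM_zero_iff)
qed

text \<open>The defining identity of the form operator, unfolded to approximating sequences. Later
  limits are taken with \<open>Q\<close> on its original domain, and the closure of the form does
  not appear in them.\<close>

definition represents :: "(nat \<Rightarrow> 'x \<Rightarrow> complex) \<Rightarrow> ('x \<Rightarrow> complex) \<Rightarrow> ('x \<Rightarrow> complex) \<Rightarrow> bool" where
  "represents fs f h \<longleftrightarrow> approx fs f \<and> h \<in> L2 \<mu> \<and>
    (\<forall>gs g. approx gs g \<longrightarrow> (\<lambda>n. Q (fs n) (gs n)) \<longlonglongrightarrow> L2_inner \<mu> h g)"

lemma representsD: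
  assumes "represents fs f h"
  shows "approx fs f" "h \<in> L2 \<mu>" "f \<in> L2 \<mu>"
    "approx gs g \<Longrightarrow> (\<lambda>n. Q (fs n) (gs n)) \<longlonglongrightarrow> L2_inner \<mu> h g"
  using assms by (auto simp: represents_def form_approx_def)

lemma form_operatorE:
  assumes "(f, h) \<in> H"
  obtains fs where "represents fs f h"
proof -
  from assms obtain fs where fs: "approx fs f" and h: "h \<in> L2 \<mu>"
    and eq: "\<And>g. g \<in> cdom \<Longrightarrow> cform f g = L2_inner \<mu> h g"
    by (auto simp: form_operator_def closure_dom_def)
  have "(\<lambda>n. Q (fs n) (gs n)) \<longlonglongrightarrow> L2_inner \<mu> h g" if "approx gs g" for gs g
  proof -
    have "g \<in> cdom" using that by (auto simp: closure_dom_def)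
    then show ?thesis using cform_limit[OF fs that] eq by simp
  qed
  then have "represents fs f h" using fs h by (simp add: represents_def)
  then show thesis by (rule that)
qed

lemma form_operatorI:
  assumes "approx fs f" "h \<in> L2 \<mu>"
    and lim: "\<And>gs g. approx gs g \<Longrightarrow> (\<lambda>n. Q (fs n) (gs n)) \<longlonglongrightarrow> L2_inner \<mu> h g"
  shows "(f, h) \<in> H"
proof -
  have "cform f g = L2_inner \<mu> h g" if "approx gs g" for gs g
    using LIMSEQ_unique[OF cform_limit[OF assms(1) that] lim[OF that]] .
  then show ?thesis using assms(1,2) by (auto simp: form_operator_def closure_dom_def)
qed

lemma form_operator_diff:
  assumes "(f, h) \<in> H" "(g, k) \<in> H"
  shows "((\<lambda>x. f x - g x), (\<lambda>x. h x - k x)) \<in> H"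
proof -
  obtain fs where "represents fs f h" by (rule form_operatorE[OF assms(1)])
  note fs = representsD[OF this]
  obtain gs where "represents gs g k" by (rule form_operatorE[OF assms(2)])
  note gs = representsD[OF this]
  show ?thesis
  proof (rule form_operatorI[OF approx_diff[OF fs(1) gs(1)] L2.diff_mem[OF fs(2) gs(2)]])
    fix us u assume u: "approx us u"
    have "(\<lambda>n. Q (fs n) (us n) - Q (gs n) (us n)) \<longlonglongrightarrow> L2_inner \<mu> h u - L2_inner \<mu> k u"
      by (intro tendsto_diff fs(4) gs(4) u)
    then show "(\<lambda>n. Q (\<lambda>x. fs n x - gs n x) (us n)) \<longlonglongrightarrow> L2_inner \<mu> (\<lambda>x. h x - k x) u"
      using approxD[OF fs(1)] approxD[OF gs(1)] approxD[OF u] fs(2) gs(2)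
      by (simp add: diff_left L2.diff_left)
  qed
qed

end

section \<open>Resolvent and spectrum of a form that is bounded below\<close>

locale bounded_below_form = closable_form D Q \<mu>
  for D :: "('x \<Rightarrow> complex) set" and Q \<mu> +
  fixes c0 :: real
  assumes lower: "f \<in> D \<Longrightarrow> c0 * (L2_norm \<mu> f)\<^sup>2 \<le> Re (Q f f)"
begin

definition shifted :: "real \<Rightarrow> ('x \<Rightarrow> complex) \<Rightarrow> ('x \<Rightarrow> complex) \<Rightarrow> complex" where
  "shifted l f g = Q f g - of_real l * L2_inner \<mu> f g"

lemma Re_shifted: "Re (shifted l f f) = Re (Q f f) - l * (L2_norm \<mu> f)\<^sup>2"
  by (simp add: shifted_def L2_norm_square)

lemma shifted_lower: "f \<in> D \<Longrightarrow> (c0 - l) * (L2_norm \<mu> f)\<^sup>2 \<le> Re (shifted l f f)"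
  using lower[of f] by (simp add: Re_shifted algebra_simps)

text \<open>Up to the lower bound \<open>c0\<close> the shifted form remains a semi-inner product,
  so Cauchy-Schwarz and the parallelogram law hold for it.\<close>

lemma psd_shifted:
  assumes "l \<le> c0"
  shows "psd_form D (shifted l)"
proof
  fix f g h :: "'x \<Rightarrow> complex" and c
  assume f: "f \<in> D"
  show "(\<lambda>x. c * f x) \<in> D" using scale_mem f by simp
  show "0 \<le> Re (shifted l f f)"
    using shifted_lower[OF f, of l] assms by (smt (verit) mult_nonneg_nonneg zero_le_power2)
  { assume h: "h \<in> D"
    show "shifted l (\<lambda>x. c * f x) h = c * shifted l f h"
      using f h dom_L2 by (simp add: shifted_def scale_left L2.scale_left algebra_simps) }
  assume g: "g \<in> D"
  show "(\<lambda>x. f x + g x) \<in> D" using add_mem f g by simp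
  show "shifted l g f = cnj (shifted l f g)"
    using hermitian[OF f g] L2.hermitian[OF dom_L2[OF f] dom_L2[OF g]] by (simp add: shifted_def)
  assume h: "h \<in> D"
  show "shifted l (\<lambda>x. f x + g x) h = shifted l f h + shifted l g h"
    using f g h dom_L2 by (simp add: shifted_def add_left L2.add_left algebra_simps)
qed

text \<open>The weak equation is tested with \<open>f\<close> itself: the lower bound passes to the
  limit, and Cauchy-Schwarz finishes. Only \<open>Re z\<close> enters, because the inner product of
  \<open>f\<close> with itself is real.\<close>

lemma form_operator_bound:
  assumes "(f, h) \<in> H"
  shows "(c0 - Re z) * L2_norm \<mu> f \<le> L2_norm \<mu> (\<lambda>x. h x - z * f x)"
proof -
  obtain fs where rep: "represents fs f h" by (rule form_operatorE[OF assms])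
  note fs = representsD(1)[OF rep] and h = representsD(2)[OF rep] and f = representsD(3)[OF rep]
    and lim = representsD(4)[OF rep]
  have "c0 * Re (L2_inner \<mu> f f) \<le> Re (L2_inner \<mu> h f)"
  proof (rule LIMSEQ_le)
    show "(\<lambda>n. c0 * Re (L2_inner \<mu> (fs n) (fs n))) \<longlonglongrightarrow> c0 * Re (L2_inner \<mu> f f)"
      by (intro tendsto_intros L2_inner_limit[OF fs fs])
    show "(\<lambda>n. Re (Q (fs n) (fs n))) \<longlonglongrightarrow> Re (L2_inner \<mu> h f)"
      by (intro tendsto_intros lim[OF fs])
    show "\<exists>N. \<forall>n\<ge>N. c0 * Re (L2_inner \<mu> (fs n) (fs n)) \<le> Re (Q (fs n) (fs n))"
      using lower[OF approxD(1)[OF fs]] by (simp add: L2_norm_square)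
  qed
  moreover have "L2_inner \<mu> (\<lambda>x. h x - z * f x) f = L2_inner \<mu> h f - z * L2_inner \<mu> f f"
    using h f L2.diff_left[OF h L2_scale[OF f] f] L2.scale_left[OF f f] by simp
  ultimately have "(c0 - Re z) * Re (L2_inner \<mu> f f) \<le> Re (L2_inner \<mu> (\<lambda>x. h x - z * f x) f)"
    using L2.Im_diag[OF f] by (simp add: left_diff_distrib)
  also have "\<dots> \<le> L2_norm \<mu> (\<lambda>x. h x - z * f x) * L2_norm \<mu> f"
    using L2_Cauchy_Schwarz[OF L2.diff_mem[OF h L2_scale[OF f]] f] complex_Re_le_cmod order_trans by blast
  finally have "(c0 - Re z) * L2_norm \<mu> f * L2_norm \<mu> f \<le> L2_norm \<mu> (\<lambda>x. h x - z * f x) * L2_norm \<mu> f"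
    by (simp add: power2_eq_square flip: L2_norm_square)
  then show ?thesis
    using L2_norm_nonneg[of \<mu> f] L2_norm_nonneg[of \<mu> "\<lambda>x. h x - z * f x"]
    by (cases "L2_norm \<mu> f = 0") auto
qed

text \<open>
  The solution minimises \<open>J g = Q(g, g) - l \<parallel>g\<parallel>\<^sup>2 - 2 Re \<langle>k, g\<rangle>\<close>; minimising sequences are Cauchy by the
  parallelogram law, and a quantitative form of the Euler-Lagrange equation survives the limit.
\<close>

lemma real_resolvent:
  assumes l: "l < c0" and k: "k \<in> L2 \<mu>"
  shows "\<exists>f. (f, \<lambda>x. of_real l * f x + k x) \<in> H"
proof -
  interpret S: psd_form D "shifted l" by (rule psd_shifted) (use l in simp)
  define c where "c = c0 - l"
  have c: "c > 0" using l by (simp add: c_def)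
  define J where "J g = Re (shifted l g g) - 2 * Re (L2_inner \<mu> k g)" for g
  \<comment> \<open>Completing the square in the norm of \<open>g\<close>; positivity of
    \<open>c\<close> makes \<open>J\<close> bounded below.\<close>
  have J_lower: "- (L2_norm \<mu> k)\<^sup>2 / c \<le> J g" if g: "g \<in> D" for g
  proof -
    have "Re (L2_inner \<mu> k g) \<le> L2_norm \<mu> k * L2_norm \<mu> g"
      using L2_Cauchy_Schwarz[OF k dom_L2[OF g]] complex_Re_le_cmod order_trans by blast
    then have "J g \<ge> c * (L2_norm \<mu> g)\<^sup>2 - 2 * (L2_norm \<mu> k * L2_norm \<mu> g)"
      using shifted_lower[OF g, of l] by (simp add: J_def c_def)
    moreover have "c * (L2_norm \<mu> g)\<^sup>2 - 2 * (L2_norm \<mu> k * L2_norm \<mu> g) + (L2_norm \<mu> k)\<^sup>2 / c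
        = (c * L2_norm \<mu> g - L2_norm \<mu> k)\<^sup>2 / c"
      using c by (simp add: field_simps power2_eq_square)
    moreover have "\<dots> \<ge> 0" using c by simp
    ultimately show ?thesis by linarith
  qed
  define J0 where "J0 = Inf (J ` D)"
  have J0: "J0 \<le> J g" if "g \<in> D" for g
    unfolding J0_def by (rule cInf_lower) (use that J_lower in \<open>auto intro!: bdd_belowI2[where m = "- (L2_norm \<mu> k)\<^sup>2 / c"]\<close>)
  have "\<exists>g\<in>D. J g < J0 + 1 / real (Suc n)" for n
    using cInf_lessD[of "J ` D" "J0 + 1 / real (Suc n)"] dom_nonempty by (auto simp: J0_def)
  then obtain fs where fsD: "\<And>n. fs n \<in> D" and fsJ: "\<And>n. J (fs n) < J0 + 1 / real (Suc n)" by metis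
  note fsL = dom_L2[OF fsD]
  define r where "r n g = shifted l (fs n) g - L2_inner \<mu> k g" for n g
  have EL: "(cmod (r n g))\<^sup>2 \<le> (Re (shifted l g g) + 1) / real (Suc n)" if g: "g \<in> D" for n g
  proof -
    define G where "G = Re (shifted l g g)"
    have G: "G \<ge> 0" unfolding G_def by (rule S.nonneg[OF g])
    \<comment> \<open>This step length keeps the quadratic term \<open>s\<^sup>2 * G\<close> at most
      \<open>s\<close>, half of the linear gain \<open>2 * s\<close>; the summand 1 covers
      \<open>G = 0\<close>.\<close>
    define s where "s = 1 / (G + 1)"
    have s: "s > 0" using G by (simp add: s_def)
    have "s * G \<le> 1" using G by (simp add: s_def)
    then have s2: "s\<^sup>2 * G \<le> s" using s by (simp add: power2_eq_square mult.assoc)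
    define z where "z = of_real (-s) * r n g"
    have memb: "(\<lambda>x. fs n x + z * g x) \<in> D" by (rule add_mem[OF fsD scale_mem[OF g]])
    have "L2_inner \<mu> k (\<lambda>x. fs n x + z * g x) = L2_inner \<mu> k (fs n) + cnj z * L2_inner \<mu> k g"
      using k fsL dom_L2[OF g] L2_scale[OF dom_L2[OF g]] by (simp add: L2.add_right L2.scale_right)
    then have "J (\<lambda>x. fs n x + z * g x) = J (fs n) + 2 * Re (cnj z * r n g) + (cmod z)\<^sup>2 * G"
      unfolding J_def S.expand_add[OF fsD g] r_def G_def by (simp add: algebra_simps)
    moreover have "cnj z * r n g = of_real (-s) * of_real ((cmod (r n g))\<^sup>2)"
      unfolding z_def complex_norm_square by (simp add: mult_ac)
    then have "Re (cnj z * r n g) = - s * (cmod (r n g))\<^sup>2"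
      by (metis Re_complex_of_real of_real_mult)
    moreover have "(cmod z)\<^sup>2 * G = s\<^sup>2 * G * (cmod (r n g))\<^sup>2"
      by (simp add: z_def norm_mult power_mult_distrib)
    moreover have "s\<^sup>2 * G * (cmod (r n g))\<^sup>2 \<le> s * (cmod (r n g))\<^sup>2"
      using s2 by (rule mult_right_mono) simp
    ultimately have "s * (cmod (r n g))\<^sup>2 \<le> 1 / real (Suc n)"
      using J0[OF memb] fsJ[of n] by linarith
    then show ?thesis using G by (simp add: s_def G_def[symmetric] field_simps)
  qed
  have S_Cauchy: "\<exists>N. \<forall>m\<ge>N. \<forall>n\<ge>N. Re (shifted l (\<lambda>x. fs m x - fs n x) (\<lambda>x. fs m x - fs n x)) < e"
    if e: "e > 0" for e
  proof -
    obtain N where "4 / e < real N" using reals_Archimedean2 by blast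
    then have "4 < e * real (Suc N)" using e by (simp add: field_simps)
    then have N: "4 / real (Suc N) < e" by (simp add: field_simps)
    have "Re (shifted l (\<lambda>x. fs m x - fs n x) (\<lambda>x. fs m x - fs n x)) < e" if "m \<ge> N" "n \<ge> N" for m n
    proof -
      define s where "s = (\<lambda>x. fs m x + fs n x)"
      define d where "d = (\<lambda>x. fs m x - fs n x)"
      \<comment> \<open>The midpoint is a competitor, so \<open>J h\<close> is at least
        \<open>J0\<close>; the parallelogram law turns this into a bound on the distance of two
        almost minimisers.\<close>
      define h where "h = (\<lambda>x. (1/2) * s x)"
      have s: "s \<in> D" unfolding s_def by (rule add_mem[OF fsD fsD])
      have h: "h \<in> D" unfolding h_def by (rule scale_mem[OF s])
      have hs: "shifted l h h = of_real (1/4) * shifted l s s"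
        using S.scale_left[OF s h, of "1/2", folded h_def]
          S.scale_right[OF s s, of "1/2", folded h_def] by simp
      have "Re (shifted l h h) = 1/4 * Re (shifted l s s)" by (subst hs) simp
      moreover have ks: "L2_inner \<mu> k h = of_real (1/2) * L2_inner \<mu> k s"
        using L2.scale_right[OF dom_L2[OF s] k, of "1/2", folded h_def] by simp
      have "Re (L2_inner \<mu> k h) = 1/2 * Re (L2_inner \<mu> k s)" by (subst ks) simp
      moreover have "L2_inner \<mu> k s = L2_inner \<mu> k (fs m) + L2_inner \<mu> k (fs n)"
        unfolding s_def by (rule L2.add_right[OF fsL fsL k])
      ultimately have "4 * J h = Re (shifted l s s)
          - 4 * Re (L2_inner \<mu> k (fs m)) - 4 * Re (L2_inner \<mu> k (fs n))"
        by (simp add: J_def)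
      moreover have "Re (shifted l d d) + Re (shifted l s s) =
          2 * Re (shifted l (fs m) (fs m)) + 2 * Re (shifted l (fs n) (fs n))"
        unfolding s_def d_def by (rule S.parallelogram[OF fsD[of m] fsD[of n]])
      ultimately have "Re (shifted l d d) = 2 * J (fs m) + 2 * J (fs n) - 4 * J h"
        by (simp add: J_def)
      also have "\<dots> < 2 / real (Suc m) + 2 / real (Suc n)"
        using fsJ[of m] fsJ[of n] J0[OF h] by simp
      also have "\<dots> \<le> 2 / real (Suc N) + 2 / real (Suc N)"
        using that by (intro add_mono divide_left_mono) auto
      also have "\<dots> < e" using N by simp
      finally show ?thesis unfolding d_def .
    qed
    then show ?thesis by blast
  qed
  have L2_Cauchy: "\<exists>N. \<forall>m\<ge>N. \<forall>n\<ge>N. L2_norm \<mu> (\<lambda>x. fs m x - fs n x) < e" if e: "e > 0" for e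
  proof -
    obtain N where N: "\<forall>m\<ge>N. \<forall>n\<ge>N. Re (shifted l (\<lambda>x. fs m x - fs n x) (\<lambda>x. fs m x - fs n x)) < c * e\<^sup>2"
      using S_Cauchy[of "c * e\<^sup>2"] c e by auto
    have "L2_norm \<mu> (\<lambda>x. fs m x - fs n x) < e" if "m \<ge> N" "n \<ge> N" for m n
    proof -
      have "c * (L2_norm \<mu> (\<lambda>x. fs m x - fs n x))\<^sup>2 < c * e\<^sup>2"
        using shifted_lower[OF diff_mem[OF fsD fsD], of l m n] N that unfolding c_def
        by (meson le_less_trans)
      then have "(L2_norm \<mu> (\<lambda>x. fs m x - fs n x))\<^sup>2 < e\<^sup>2" using c by simp
      then show ?thesis using e power2_less_imp_less[of _ e] by simp
    qed
    then show ?thesis by blast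
  qed
  obtain f where f: "f \<in> L2 \<mu>" "(\<lambda>n. L2_norm \<mu> (\<lambda>x. fs n x - f x)) \<longlonglongrightarrow> 0"
    using L2_complete[OF fsL L2_Cauchy] by blast
  have app: "approx fs f"
  proof (rule approxI[OF fsD f])
    fix e :: real assume e: "e > 0"
    obtain M where M: "\<forall>m\<ge>M. \<forall>n\<ge>M. Re (shifted l (\<lambda>x. fs m x - fs n x) (\<lambda>x. fs m x - fs n x)) < e\<^sup>2 / 2"
      using S_Cauchy[of "e\<^sup>2 / 2"] e by auto
    define w where "w = 2 * (\<bar>l\<bar> + 1)"
    have w: "w > 0" by (simp add: w_def add_nonneg_pos)
    then have "sqrt (e\<^sup>2 / w) > 0" using e by simp
    from L2_Cauchy[OF this] obtain N
      where N: "\<forall>m\<ge>N. \<forall>n\<ge>N. L2_norm \<mu> (\<lambda>x. fs m x - fs n x) < sqrt (e\<^sup>2 / w)" by blast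
    have "nrm (\<lambda>x. fs m x - fs n x) < e" if "m \<ge> max M N" "n \<ge> max M N" for m n
    proof -
      let ?d = "\<lambda>x. fs m x - fs n x"
      have mn: "m \<ge> M" "n \<ge> M" "m \<ge> N" "n \<ge> N" using that by auto
      have "L2_norm \<mu> ?d < sqrt (e\<^sup>2 / w)" using N mn by blast
      then have "(L2_norm \<mu> ?d)\<^sup>2 < (sqrt (e\<^sup>2 / w))\<^sup>2"
        using L2_norm_nonneg[of \<mu> ?d] by (intro power_strict_mono) auto
      then have "(L2_norm \<mu> ?d)\<^sup>2 < e\<^sup>2 / w" using w by simp
      then have "w * (L2_norm \<mu> ?d)\<^sup>2 < e\<^sup>2" using w by (simp add: pos_less_divide_eq mult.commute)
      then have "(\<bar>l\<bar> + 1) * (L2_norm \<mu> ?d)\<^sup>2 < e\<^sup>2 / 2" by (simp add: w_def algebra_simps)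
      moreover have "l * (L2_norm \<mu> ?d)\<^sup>2 \<le> (\<bar>l\<bar> + 1) * (L2_norm \<mu> ?d)\<^sup>2"
        by (rule mult_right_mono[OF _ zero_le_power2]) linarith
      moreover have "Re (shifted l ?d ?d) < e\<^sup>2 / 2" using M mn by blast
      ultimately have "Re (Q ?d ?d) < e\<^sup>2" unfolding Re_shifted by linarith
      then show ?thesis using e real_sqrt_less_mono by fastforce
    qed
    then show "\<exists>N. \<forall>m\<ge>N. \<forall>n\<ge>N. nrm (\<lambda>x. fs m x - fs n x) < e" by blast
  qed
  have "(f, \<lambda>x. of_real l * f x + k x) \<in> H"
  proof (rule form_operatorI[OF app L2_add[OF L2_scale[OF f(1)] k]])
    fix gs g assume gs: "approx gs g"
    note G = approxD[OF gs]
    have gL: "gs n \<in> L2 \<mu>" for n using dom_L2 G by simp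
    have limI: "(\<lambda>n. L2_inner \<mu> (fs n) (gs n)) \<longlonglongrightarrow> L2_inner \<mu> f g" by (rule L2_inner_limit[OF app gs])
    have limk: "(\<lambda>n. L2_inner \<mu> k (gs n)) \<longlonglongrightarrow> L2_inner \<mu> k g"
    proof -
      have "(\<lambda>n. L2_inner \<mu> k (gs n) - L2_inner \<mu> k g) \<longlonglongrightarrow> 0"
      proof (rule Lim_null_comparison)
        show "(\<lambda>n. L2_norm \<mu> k * L2_norm \<mu> (\<lambda>x. gs n x - g x)) \<longlonglongrightarrow> 0"
          using tendsto_mult_left[OF G(3), of "L2_norm \<mu> k"] by simp
        show "\<forall>\<^sub>F n in sequentially. norm (L2_inner \<mu> k (gs n) - L2_inner \<mu> k g) \<le>
            L2_norm \<mu> k * L2_norm \<mu> (\<lambda>x. gs n x - g x)"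
          using L2_Cauchy_Schwarz[OF k L2.diff_mem[OF gL G(2)]] L2.diff_right[OF gL G(2) k]
          by simp
      qed
      then show ?thesis by (simp add: LIM_zero_iff)
    qed
    have limr: "(\<lambda>n. r n (gs n)) \<longlonglongrightarrow> 0"
    proof -
      have limS: "(\<lambda>n. Re (shifted l (gs n) (gs n))) \<longlonglongrightarrow> Re (cform g g - of_real l * L2_inner \<mu> g g)"
        unfolding shifted_def by (intro tendsto_intros cform_limit[OF gs gs] L2_inner_limit[OF gs gs])
      have "(\<lambda>n. sqrt ((Re (shifted l (gs n) (gs n)) + 1) * (1 / real (Suc n)))) \<longlonglongrightarrow>
          sqrt ((Re (cform g g - of_real l * L2_inner \<mu> g g) + 1) * 0)"
        by (intro tendsto_intros limS LIMSEQ_Suc[OF lim_1_over_n])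
      then have z: "(\<lambda>n. sqrt ((Re (shifted l (gs n) (gs n)) + 1) / real (Suc n))) \<longlonglongrightarrow> 0" by simp
      show ?thesis
        by (rule Lim_null_comparison[OF _ z]) (use EL[OF G(1)] real_le_rsqrt in simp)
    qed
    \<comment> \<open>The residual \<open>r\<close> separates \<open>Q (fs n) (gs n)\<close> from
      the weak equation. By \<open>EL\<close> it vanishes along \<open>gs\<close>, whose shifted
      norms converge.\<close>
    have "(\<lambda>n. of_real l * L2_inner \<mu> (fs n) (gs n) + L2_inner \<mu> k (gs n) + r n (gs n)) \<longlonglongrightarrow>
        of_real l * L2_inner \<mu> f g + L2_inner \<mu> k g + 0"
      by (intro tendsto_intros limI limk limr)
    moreover have "of_real l * L2_inner \<mu> (fs n) (gs n) + L2_inner \<mu> k (gs n) + r n (gs n) = Q (fs n) (gs n)" for n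
      by (simp add: r_def shifted_def)
    moreover have "L2_inner \<mu> (\<lambda>x. of_real l * f x + k x) g = of_real l * L2_inner \<mu> f g + L2_inner \<mu> k g"
      using f k G(2) L2_scale[OF f(1)] by (simp add: L2.add_left L2.scale_left)
    ultimately show "(\<lambda>n. Q (fs n) (gs n)) \<longlonglongrightarrow> L2_inner \<mu> (\<lambda>x. of_real l * f x + k x) g" by simp
  qed
  then show ?thesis by blast
qed

text \<open>
  The resolvent at a real \<open>l < c0\<close> has norm at most \<open>1 / (c0 - l)\<close>, and every \<open>z\<close> in the half-plane lies
  in the disc of radius \<open>c0 - l\<close> around \<open>l\<close> if \<open>l\<close> is small enough, so that a Neumann series converges.
\<close>

lemma complex_resolvent:
  assumes z: "Re z < c0" and k: "k \<in> L2 \<mu>"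
  shows "\<exists>(f, h)\<in>H. AE x in \<mu>. h x - z * f x = k x"
proof -
  define d where "d = c0 - Re z"
  have d: "d > 0" using z by (simp add: d_def)
  \<comment> \<open>Chosen so that the mixed term of \<open>(c0 - l)\<^sup>2\<close> is exactly
    \<open>(Im z)\<^sup>2\<close>; then \<open>(c0 - l)\<^sup>2\<close> exceeds the squared distance
    from \<open>z\<close> to \<open>l\<close> by \<open>d\<^sup>2\<close>.\<close>
  define l where "l = Re z - (Im z)\<^sup>2 / (2 * d)"
  have lc: "c0 - l = d + (Im z)\<^sup>2 / (2 * d)" by (simp add: d_def l_def)
  have l0: "c0 - l > 0" unfolding lc using d by (simp add: add_pos_nonneg)
  define \<theta> where "\<theta> = cmod (z - of_real l) / (c0 - l)"
  have "(cmod (z - of_real l))\<^sup>2 < (c0 - l)\<^sup>2"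
  proof -
    have "(cmod (z - of_real l))\<^sup>2 = ((Im z)\<^sup>2 / (2 * d))\<^sup>2 + (Im z)\<^sup>2"
      by (simp add: cmod_power2 l_def)
    moreover have "(d + (Im z)\<^sup>2 / (2 * d))\<^sup>2 = d\<^sup>2 + (Im z)\<^sup>2 + ((Im z)\<^sup>2 / (2 * d))\<^sup>2"
      using d by (simp add: power2_sum)
    ultimately show ?thesis unfolding lc using d by simp
  qed
  then have "cmod (z - of_real l) < c0 - l" using l0 power2_less_imp_less by fastforce
  then have \<theta>: "0 \<le> \<theta>" "\<theta> < 1" using l0 by (auto simp: \<theta>_def)
  have ex: "\<exists>f. (f, \<lambda>x. of_real l * f x + u x) \<in> H" if "u \<in> L2 \<mu>" for u
    using real_resolvent[OF _ that] l0 by simp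
  define R where "R u = (SOME f. (f, \<lambda>x. of_real l * f x + u x) \<in> H)" for u
  have R: "(R u, \<lambda>x. of_real l * R u x + u x) \<in> H" if "u \<in> L2 \<mu>" for u
    unfolding R_def by (rule someI_ex[OF ex[OF that]])
  have R_L2: "R u \<in> L2 \<mu>" if u: "u \<in> L2 \<mu>" for u
  proof -
    obtain fs where "represents fs (R u) (\<lambda>x. of_real l * R u x + u x)" by (rule form_operatorE[OF R[OF u]])
    then show ?thesis by (rule representsD)
  qed
  \<comment> \<open>A fixed point satisfies \<open>(H - l) f = k + (z - l) f\<close>, that is
    \<open>(H - z) f = k\<close>.\<close>
  define T where "T f = R (\<lambda>x. k x + (z - of_real l) * f x)" for f
  have TL: "T f \<in> L2 \<mu>" if "f \<in> L2 \<mu>" for f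
    unfolding T_def by (rule R_L2[OF L2_add[OF k L2_scale[OF that]]])
  have contr: "L2_norm \<mu> (\<lambda>x. T f x - T g x) \<le> \<theta> * L2_norm \<mu> (\<lambda>x. f x - g x)"
    if f: "f \<in> L2 \<mu>" and g: "g \<in> L2 \<mu>" for f g
  proof -
    let ?w = "z - of_real l"
    have "((\<lambda>x. T f x - T g x), (\<lambda>x. (of_real l * T f x + (k x + ?w * f x)) -
        (of_real l * T g x + (k x + ?w * g x)))) \<in> H"
      unfolding T_def
      by (rule form_operator_diff[OF R[OF L2_add[OF k L2_scale[OF f]]] R[OF L2_add[OF k L2_scale[OF g]]]])
    from form_operator_bound[OF this, of "of_real l"]
    have "(c0 - l) * L2_norm \<mu> (\<lambda>x. T f x - T g x) \<le> L2_norm \<mu>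
      (\<lambda>x. (of_real l * T f x + (k x + ?w * f x)) - (of_real l * T g x + (k x + ?w * g x)) -
        of_real l * (T f x - T g x))" by simp
    also have "(\<lambda>x. (of_real l * T f x + (k x + ?w * f x)) - (of_real l * T g x + (k x + ?w * g x)) -
        of_real l * (T f x - T g x)) = (\<lambda>x. ?w * (f x - g x))"
      by (simp add: fun_eq_iff algebra_simps)
    finally have "(c0 - l) * L2_norm \<mu> (\<lambda>x. T f x - T g x) \<le> L2_norm \<mu> (\<lambda>x. ?w * (f x - g x))" .
    then show ?thesis
      using l0 unfolding L2_norm_scale \<theta>_def by (simp add: pos_le_divide_eq mult.commute)
  qed
  define F where "F n = (T ^^ n) (\<lambda>x. 0)" for n
  have F0: "F 0 = (\<lambda>x. 0)" and FS: "F (Suc n) = T (F n)" for n by (simp_all add: F_def)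
  have FL: "F n \<in> L2 \<mu>" for n
    by (induction n) (simp add: F0 L2_def, simp add: FS TL)
  define K where "K = L2_norm \<mu> (\<lambda>x. F (Suc 0) x - F 0 x)"
  have step: "L2_norm \<mu> (\<lambda>x. F (Suc n) x - F n x) \<le> K * \<theta> ^ n" for n
  proof (induction n)
    case (Suc n)
    have "L2_norm \<mu> (\<lambda>x. F (Suc (Suc n)) x - F (Suc n) x) \<le> \<theta> * L2_norm \<mu> (\<lambda>x. F (Suc n) x - F n x)"
      unfolding FS[of "Suc n"] FS[of n] using contr[OF FL[of "Suc n"] FL[of n]] by (simp add: FS)
    also have "\<dots> \<le> \<theta> * (K * \<theta> ^ n)" using \<theta> Suc by (intro mult_left_mono)
    finally show ?case by (simp add: mult_ac)
  qed (simp add: K_def)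
  have K0: "0 \<le> K" by (simp add: K_def L2_norm_nonneg)
  have dist: "L2_norm \<mu> (\<lambda>x. F (n + j) x - F n x) \<le> K * \<theta> ^ n / (1 - \<theta>)" for n j
  proof (induction j arbitrary: n)
    case 0
    then show ?case using \<theta> K0 by (simp add: L2_norm_def)
  next
    case (Suc j)
    have "L2_norm \<mu> (\<lambda>x. F (n + Suc j) x - F n x) \<le>
        L2_norm \<mu> (\<lambda>x. F (Suc n + j) x - F (Suc n) x) + L2_norm \<mu> (\<lambda>x. F (Suc n) x - F n x)"
      using L2_triangle_diff[of "F (n + Suc j)" \<mu> "F (Suc n)" "F n"] FL by simp
    also have "\<dots> \<le> K * \<theta> ^ Suc n / (1 - \<theta>) + K * \<theta> ^ n"
      by (intro add_mono Suc step)
    also have "\<dots> = K * \<theta> ^ n / (1 - \<theta>)" using \<theta> by (simp add: field_simps)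
    finally show ?case .
  qed
  have Cauchy: "\<exists>N. \<forall>m\<ge>N. \<forall>n\<ge>N. L2_norm \<mu> (\<lambda>x. F m x - F n x) < e" if e: "e > 0" for e
  proof -
    have "(\<lambda>n. K * \<theta> ^ n / (1 - \<theta>)) \<longlonglongrightarrow> K * 0 / (1 - \<theta>)"
      using \<theta> by (intro tendsto_intros LIMSEQ_realpow_zero) auto
    then have "\<forall>\<^sub>F n in sequentially. K * \<theta> ^ n / (1 - \<theta>) < e / 2"
      by (rule order_tendstoD) (use e in simp)
    then obtain N where N: "K * \<theta> ^ N / (1 - \<theta>) < e / 2"
      by (auto simp: eventually_sequentially)
    have "L2_norm \<mu> (\<lambda>x. F m x - F n x) < e" if "m \<ge> N" "n \<ge> N" for m n
    proof -
      have "L2_norm \<mu> (\<lambda>x. F m x - F n x) \<le>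
          L2_norm \<mu> (\<lambda>x. F m x - F N x) + L2_norm \<mu> (\<lambda>x. F N x - F n x)"
        by (rule L2_triangle_diff[OF FL FL FL])
      moreover have "L2_norm \<mu> (\<lambda>x. F N x - F n x) = L2_norm \<mu> (\<lambda>x. F n x - F N x)"
        unfolding L2_norm_inner using L2.norm_commute[OF FL FL] by simp
      moreover have "L2_norm \<mu> (\<lambda>x. F m x - F N x) \<le> K * \<theta> ^ N / (1 - \<theta>)"
        "L2_norm \<mu> (\<lambda>x. F n x - F N x) \<le> K * \<theta> ^ N / (1 - \<theta>)"
        using dist[of N "m - N"] dist[of N "n - N"] that by auto
      ultimately show ?thesis using N by linarith
    qed
    then show ?thesis by blast
  qed
  obtain f where f: "f \<in> L2 \<mu>" and lim: "(\<lambda>n. L2_norm \<mu> (\<lambda>x. F n x - f x)) \<longlonglongrightarrow> 0"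
    using L2_complete[OF FL Cauchy] by blast
  have "L2_norm \<mu> (\<lambda>x. T f x - f x) \<le> 0"
  proof (rule LIMSEQ_le_const)
    show "(\<lambda>n. \<theta> * L2_norm \<mu> (\<lambda>x. F n x - f x) + L2_norm \<mu> (\<lambda>x. F (Suc n) x - f x)) \<longlonglongrightarrow> 0"
      using tendsto_add[OF tendsto_mult_left[OF lim, of \<theta>] LIMSEQ_Suc[OF lim]] by simp
    show "\<exists>N. \<forall>n\<ge>N. L2_norm \<mu> (\<lambda>x. T f x - f x) \<le>
        \<theta> * L2_norm \<mu> (\<lambda>x. F n x - f x) + L2_norm \<mu> (\<lambda>x. F (Suc n) x - f x)"
    proof (intro exI allI impI)
      fix n
      have "L2_norm \<mu> (\<lambda>x. T f x - f x) \<le>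
          L2_norm \<mu> (\<lambda>x. T f x - F (Suc n) x) + L2_norm \<mu> (\<lambda>x. F (Suc n) x - f x)"
        by (rule L2_triangle_diff[OF TL[OF f] FL f])
      moreover have "L2_norm \<mu> (\<lambda>x. T f x - F (Suc n) x) = L2_norm \<mu> (\<lambda>x. F (Suc n) x - T f x)"
        unfolding L2_norm_inner using L2.norm_commute[OF TL[OF f] FL] by simp
      moreover have "L2_norm \<mu> (\<lambda>x. F (Suc n) x - T f x) \<le> \<theta> * L2_norm \<mu> (\<lambda>x. F n x - f x)"
        unfolding FS by (rule contr[OF FL f])
      ultimately show "L2_norm \<mu> (\<lambda>x. T f x - f x) \<le>
        \<theta> * L2_norm \<mu> (\<lambda>x. F n x - f x) + L2_norm \<mu> (\<lambda>x. F (Suc n) x - f x)" by linarith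
    qed
  qed
  then have "L2_norm \<mu> (\<lambda>x. T f x - f x) = 0" using L2_norm_nonneg[of \<mu> "\<lambda>x. T f x - f x"] by linarith
  then have AE: "AE x in \<mu>. T f x - f x = 0"
    by (rule L2_norm_eq_0_AE[OF L2.diff_mem[OF TL[OF f] f]])
  \<comment> \<open>The limit \<open>f\<close> is a fixed point only almost everywhere, so the pair
    is built on \<open>T f\<close>, which lies in the domain of the operator by
    construction.\<close>
  have mem: "(T f, \<lambda>x. of_real l * T f x + (k x + (z - of_real l) * f x)) \<in> H"
    unfolding T_def by (rule R[OF L2_add[OF k L2_scale[OF f]]])
  have "AE x in \<mu>. (of_real l * T f x + (k x + (z - of_real l) * f x)) - z * T f x = k x"
    using AE by eventually_elim (simp add: algebra_simps)
  then show ?thesis by (intro bexI[OF _ mem]) (simp only: prod.case)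
qed

lemma resolvent_half_plane:
  assumes z: "Re z < c0"
  shows "z \<in> resolvent_set \<mu> H"
  unfolding resolvent_set_def
proof (intro CollectI conjI)
  have b: "L2_norm \<mu> f \<le> 1 / (c0 - Re z) * L2_norm \<mu> (\<lambda>x. h x - z * f x)" if "(f, h) \<in> H" for f h
    using form_operator_bound[OF that, of z] z by (simp add: field_simps)
  then show "\<exists>C. \<forall>(f, h)\<in>H. L2_norm \<mu> f \<le> C * L2_norm \<mu> (\<lambda>x. h x - z * f x)" by blast
  show "\<forall>k\<in>L2 \<mu>. \<exists>(f, h)\<in>H. AE x in \<mu>. h x - z * f x = k x"
    using complex_resolvent[OF z] by blast
  show "\<forall>(f, h)\<in>H. (AE x in \<mu>. h x - z * f x = 0) \<longrightarrow> (AE x in \<mu>. f x = 0)"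
  proof -
    have "AE x in \<mu>. f x = 0" if fh: "(f, h) \<in> H" and AE: "AE x in \<mu>. h x - z * f x = 0" for f h
    proof -
    obtain fs where "represents fs f h" by (rule form_operatorE[OF fh])
    note rep = representsD[OF this]
    note [measurable] = L2_D(1)[OF rep(2)] L2_D(1)[OF rep(3)]
    have "L2_norm \<mu> (\<lambda>x. h x - z * f x) = L2_norm \<mu> (\<lambda>x. 0)"
    proof (rule L2_norm_cong_AE)
      show "(\<lambda>x. h x - z * f x) \<in> borel_measurable \<mu>" by measurable
    qed (use AE in auto)
    then have "L2_norm \<mu> f \<le> 0" using b[OF fh] by (simp add: L2_norm_def)
    then have "L2_norm \<mu> f = 0" using L2_norm_nonneg[of \<mu> f] by simp
    then show "AE x in \<mu>. f x = 0" by (rule L2_norm_eq_0_AE[OF rep(3)])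
    qed
    then show ?thesis by blast
  qed
qed

text \<open>A bounded inverse at \<open>c0\<close> would control the resolvents at real points
  slightly below \<open>c0\<close> uniformly. Such control raises the lower bound of the form above
  \<open>c0\<close>, against \<open>sharp\<close>.\<close>

lemma bottom_in_spectrum:
  assumes sharp: "\<And>c. c > c0 \<Longrightarrow> \<exists>f\<in>D. Re (Q f f) < c * (L2_norm \<mu> f)\<^sup>2"
  shows "of_real c0 \<notin> resolvent_set \<mu> H"
proof
  assume "of_real c0 \<in> resolvent_set \<mu> H"
  then obtain C' where C': "\<And>f h. (f, h) \<in> H \<Longrightarrow>
      L2_norm \<mu> f \<le> C' * L2_norm \<mu> (\<lambda>x. h x - of_real c0 * f x)"
    unfolding resolvent_set_def by blast
  define C where "C = max C' 1"
  have C1: "C \<ge> 1" by (simp add: C_def)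
  have C: "L2_norm \<mu> f \<le> C * L2_norm \<mu> (\<lambda>x. h x - of_real c0 * f x)" if "(f, h) \<in> H" for f h
    using C'[OF that] L2_norm_nonneg[of \<mu> "\<lambda>x. h x - of_real c0 * f x"] unfolding C_def
    by (smt (verit) mult_right_mono)
  \<comment> \<open>A resolvent bounded near \<open>c0\<close> would improve the lower bound of the form.\<close>
  have gap: "(L2_norm \<mu> g)\<^sup>2 \<le> 2 * C * Re (shifted l g g)"
    if g: "g \<in> D" and l: "l < c0" "C * (c0 - l) \<le> 1 / 2" for g l
  proof -
    interpret S: psd_form D "shifted l" by (rule psd_shifted) (use l in simp)
    note gL = dom_L2[OF g]
    obtain f where fH: "(f, \<lambda>x. of_real l * f x + g x) \<in> H" using real_resolvent[OF l(1) gL] by blast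
    obtain fs where "represents fs f (\<lambda>x. of_real l * f x + g x)" by (rule form_operatorE[OF fH])
    note rep = representsD[OF this]
    have "L2_norm \<mu> f \<le> C * L2_norm \<mu> (\<lambda>x. of_real l * f x + g x - of_real c0 * f x)" by (rule C[OF fH])
    also have "(\<lambda>x. of_real l * f x + g x - of_real c0 * f x) = (\<lambda>x. g x + of_real (l - c0) * f x)"
      by (simp add: algebra_simps)
    also have "C * L2_norm \<mu> (\<lambda>x. g x + of_real (l - c0) * f x) \<le>
        C * (L2_norm \<mu> g + L2_norm \<mu> (\<lambda>x. of_real (l - c0) * f x))"
      using C1 by (intro mult_left_mono L2_triangle gL L2_scale rep(3)) auto
    also have "\<dots> = C * L2_norm \<mu> g + C * (c0 - l) * L2_norm \<mu> f"
      unfolding L2_norm_scale norm_of_real using l(1) by (simp add: algebra_simps)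
    also have "\<dots> \<le> C * L2_norm \<mu> g + 1 / 2 * L2_norm \<mu> f"
      using l(2) L2_norm_nonneg by (intro add_left_mono mult_right_mono)
    finally have fg: "L2_norm \<mu> f \<le> 2 * C * L2_norm \<mu> g" by simp
    have inner: "L2_inner \<mu> (\<lambda>x. of_real l * f x + g x) u = of_real l * L2_inner \<mu> f u + L2_inner \<mu> g u"
      if "u \<in> L2 \<mu>" for u
      using rep(3) gL that L2_scale[OF rep(3)] by (simp add: L2.add_left L2.scale_left)
    have lim1: "(\<lambda>n. shifted l (fs n) g) \<longlonglongrightarrow> L2_inner \<mu> g g"
    proof -
      have "(\<lambda>n. Q (fs n) g - of_real l * L2_inner \<mu> (fs n) g) \<longlonglongrightarrow>
          L2_inner \<mu> (\<lambda>x. of_real l * f x + g x) g - of_real l * L2_inner \<mu> f g"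
        by (intro tendsto_intros rep(4)[OF approx_const[OF g]] L2_inner_limit[OF rep(1) approx_const[OF g]])
      then show ?thesis using inner[OF gL] by (simp add: shifted_def)
    qed
    have lim2: "(\<lambda>n. shifted l (fs n) (fs n)) \<longlonglongrightarrow> L2_inner \<mu> g f"
    proof -
      have "(\<lambda>n. Q (fs n) (fs n) - of_real l * L2_inner \<mu> (fs n) (fs n)) \<longlonglongrightarrow>
          L2_inner \<mu> (\<lambda>x. of_real l * f x + g x) f - of_real l * L2_inner \<mu> f f"
        by (intro tendsto_intros rep(4)[OF rep(1)] L2_inner_limit[OF rep(1) rep(1)])
      then show ?thesis using inner[OF rep(3)] by (simp add: shifted_def)
    qed
    \<comment> \<open>As \<open>f\<close> solves the equation at \<open>l\<close> with right-hand
      side \<open>g\<close>, the shifted form of \<open>f\<close> with \<open>g\<close> is the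
      squared norm of \<open>g\<close>, and that of \<open>f\<close> with itself is the inner
      product of \<open>g\<close> and \<open>f\<close>. Cauchy-Schwarz is applied to the
      approximants and passes to the limit.\<close>
    have "(cmod (L2_inner \<mu> g g))\<^sup>2 \<le> Re (L2_inner \<mu> g f) * Re (shifted l g g)"
    proof (rule LIMSEQ_le)
      show "(\<lambda>n. (cmod (shifted l (fs n) g))\<^sup>2) \<longlonglongrightarrow> (cmod (L2_inner \<mu> g g))\<^sup>2"
        by (intro tendsto_intros lim1)
      show "(\<lambda>n. Re (shifted l (fs n) (fs n)) * Re (shifted l g g)) \<longlonglongrightarrow>
          Re (L2_inner \<mu> g f) * Re (shifted l g g)"
        by (intro tendsto_intros lim2)
      show "\<exists>N. \<forall>n\<ge>N. (cmod (shifted l (fs n) g))\<^sup>2 \<le> Re (shifted l (fs n) (fs n)) * Re (shifted l g g)"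
        using S.Cauchy_Schwarz_square[OF approxD(1)[OF rep(1)] g] by blast
    qed
    also have "\<dots> \<le> 2 * C * (L2_norm \<mu> g)\<^sup>2 * Re (shifted l g g)"
    proof (rule mult_right_mono)
      have "Re (L2_inner \<mu> g f) \<le> L2_norm \<mu> g * L2_norm \<mu> f"
        using L2_Cauchy_Schwarz[OF gL rep(3)] complex_Re_le_cmod order_trans by blast
      also have "\<dots> \<le> L2_norm \<mu> g * (2 * C * L2_norm \<mu> g)"
        using fg L2_norm_nonneg by (intro mult_left_mono)
      finally show "Re (L2_inner \<mu> g f) \<le> 2 * C * (L2_norm \<mu> g)\<^sup>2"
        by (simp add: power2_eq_square mult_ac)
    qed (rule S.nonneg[OF g])
    also have "cmod (L2_inner \<mu> g g) = (L2_norm \<mu> g)\<^sup>2"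
      using L2.cmod_diag[OF gL] by (simp add: L2_norm_square)
    finally have le: "(L2_norm \<mu> g)\<^sup>2 * (L2_norm \<mu> g)\<^sup>2 \<le> (L2_norm \<mu> g)\<^sup>2 * (2 * C * Re (shifted l g g))"
      by (simp add: power2_eq_square mult_ac)
    show ?thesis
    proof (cases "L2_norm \<mu> g = 0")
      case True
      then show ?thesis using S.nonneg[OF g] C1 by simp
    next
      case False
      then have "(L2_norm \<mu> g)\<^sup>2 > 0" by simp
      then show ?thesis using le by (rule mult_left_le_imp_le[rotated])
    qed
  qed
  \<comment> \<open>With this \<open>l\<close> and a Rayleigh quotient below
    \<open>c0 + 1 / (8 * C)\<close> the gap inequality bounds the squared norm of \<open>g\<close>
    by 3/4 of itself.\<close>
  define l where "l = c0 - 1 / (4 * C)"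
  have l: "l < c0" "C * (c0 - l) \<le> 1 / 2" using C1 by (auto simp: l_def)
  obtain g where g: "g \<in> D" "Re (Q g g) < (c0 + 1 / (8 * C)) * (L2_norm \<mu> g)\<^sup>2"
    using sharp[of "c0 + 1 / (8 * C)"] C1 by auto
  have "(L2_norm \<mu> g)\<^sup>2 \<le> 2 * C * (Re (Q g g) - l * (L2_norm \<mu> g)\<^sup>2)"
    using gap[OF g(1) l] by (simp add: Re_shifted)
  also have "\<dots> < 2 * C * ((c0 + 1 / (8 * C)) * (L2_norm \<mu> g)\<^sup>2 - l * (L2_norm \<mu> g)\<^sup>2)"
    using g(2) C1 by simp
  also have "\<dots> = 3 / 4 * (L2_norm \<mu> g)\<^sup>2"
    using C1 by (simp add: l_def field_simps)
  finally show False by simp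
qed

text \<open>Since the infimum is taken over real parts, a free half-plane and one spectral point on
  its edge determine it, without knowing that the spectrum is real.\<close>

theorem Inf_Re_spectrum:
  assumes "\<And>c. c > c0 \<Longrightarrow> \<exists>f\<in>D. Re (Q f f) < c * (L2_norm \<mu> f)\<^sup>2"
  shows "Inf ((\<lambda>z. ereal (Re z)) ` operator_spectrum \<mu> H) = ereal c0"
proof (rule antisym)
  have "of_real c0 \<in> operator_spectrum \<mu> H"
    using bottom_in_spectrum[OF assms] by (simp add: operator_spectrum_def)
  then have "(\<lambda>z. ereal (Re z)) (of_real c0) \<in> (\<lambda>z. ereal (Re z)) ` operator_spectrum \<mu> H" by (rule imageI)
  from Inf_lower[OF this] show "Inf ((\<lambda>z. ereal (Re z)) ` operator_spectrum \<mu> H) \<le> ereal c0"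
    by simp
  show "ereal c0 \<le> Inf ((\<lambda>z. ereal (Re z)) ` operator_spectrum \<mu> H)"
  proof (rule Inf_greatest)
    fix y assume "y \<in> (\<lambda>z. ereal (Re z)) ` operator_spectrum \<mu> H"
    then obtain z where z: "y = ereal (Re z)" "z \<notin> resolvent_set \<mu> H"
      by (auto simp: operator_spectrum_def)
    then have "\<not> Re z < c0" using resolvent_half_plane by blast
    then show "ereal c0 \<le> y" using z(1) by simp
  qed
qed

end

section \<open>Linear systems of two differential equations\<close>

text \<open>Derivatives are taken within the half-line, as nothing is known about the integrand left
  of 0; the interval \<open>{0..x+1}\<close> defines the same neighbourhoods of
  \<open>x\<close>.\<close>

lemma integral_from_zero_deriv:
  fixes g :: "real \<Rightarrow> real"
  assumes "continuous_on {0..} g" "0 \<le> x"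
  shows "((\<lambda>x. integral {0..x} g) has_real_derivative g x) (at x within {0..})"
proof -
  have "((\<lambda>x. integral {0..x} g) has_real_derivative g x) (at x within {0..x+1})"
    by (rule integral_has_real_derivative) (use assms in \<open>auto intro: continuous_on_subset\<close>)
  moreover have "at x within {0..x+1} = at x within {0..}"
    by (rule at_within_nhd[of _ "{..<x+1}"]) (use assms in auto)
  ultimately show ?thesis by simp
qed

lemma continuous_integral_from_zero:
  fixes g :: "real \<Rightarrow> real"
  assumes "continuous_on {0..} g"
  shows "continuous_on {0..} (\<lambda>x. integral {0..x} g)"
  unfolding continuous_on_eq_continuous_within
  using integral_from_zero_deriv[OF assms] has_field_derivative_imp_has_derivative has_derivative_continuous
  by blast

text \<open>The off-diagonal shape suffices for the flux formulation of a second-order equation.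
  Exchanging the two components turns the initial data \<open>(0, 1)\<close> into
  \<open>(1, 0)\<close>, so both standard solutions come from here.\<close>

lemma linear_system_solution:
  fixes \<alpha> \<beta> :: "real \<Rightarrow> real"
  assumes \<alpha>: "continuous_on {0..} \<alpha>" and \<beta>: "continuous_on {0..} \<beta>"
  obtains y z where
    "\<And>x. 0 \<le> x \<Longrightarrow> (y has_real_derivative \<alpha> x * z x) (at x within {0..})"
    "\<And>x. 0 \<le> x \<Longrightarrow> (z has_real_derivative \<beta> x * y x) (at x within {0..})"
    "y 0 = 0" "z 0 = 1"
proof -
  \<comment> \<open>Picard iteration started at \<open>(0, 1)\<close>, with \<open>z = \<Sum>j. zz j\<close> and \<open>y = \<Sum>j. yy j\<close>\<close>
  define zz where "zz = rec_nat (\<lambda>x. 1) (\<lambda>j f x. integral {0..x} (\<lambda>t. \<beta> t * integral {0..t} (\<lambda>s. \<alpha> s * f s)))"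
  define yy where "yy j x = integral {0..x} (\<lambda>s. \<alpha> s * zz j s)" for j x
  have zz0: "zz 0 = (\<lambda>x. 1)" by (simp add: zz_def)
  have zzS: "zz (Suc j) = (\<lambda>x. integral {0..x} (\<lambda>t. \<beta> t * yy j t))" for j
    by (simp add: zz_def yy_def[abs_def])
  have cz: "continuous_on {0..} (zz j)" for j
  proof (induction j)
    case (Suc j)
    show ?case
      unfolding zzS yy_def[abs_def]
      by (intro continuous_integral_from_zero continuous_on_mult \<alpha> \<beta> Suc)
  qed (simp add: zz0)
  have c\<alpha>z: "continuous_on {0..} (\<lambda>s. \<alpha> s * zz j s)" for j by (intro continuous_on_mult \<alpha> cz)
  have cy: "continuous_on {0..} (yy j)" for j
    unfolding yy_def[abs_def] by (intro continuous_integral_from_zero c\<alpha>z)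
  have c\<beta>y: "continuous_on {0..} (\<lambda>s. \<beta> s * yy j s)" for j by (intro continuous_on_mult \<beta> cy)
  have dy: "(yy j has_real_derivative \<alpha> x * zz j x) (at x within {0..})" if "0 \<le> x" for j x
    unfolding yy_def[abs_def] by (rule integral_from_zero_deriv[OF c\<alpha>z that])
  have dz: "(zz (Suc j) has_real_derivative \<beta> x * yy j x) (at x within {0..})" if "0 \<le> x" for j x
    unfolding zzS by (rule integral_from_zero_deriv[OF c\<beta>y that])
  have pow_int: "((\<lambda>t. c * t ^ j / fact j) has_integral c * x ^ Suc j / fact (Suc j)) {0..x}"
    if "0 \<le> x" for c x :: real and j
  proof -
    have "((\<lambda>t. c * t ^ j / fact j) has_integral
        c * x ^ Suc j / fact (Suc j) - c * 0 ^ Suc j / fact (Suc j)) {0..x}"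
      using that
    proof (intro fundamental_theorem_of_calculus)
      fix t :: real
      have "((\<lambda>t. c / fact (Suc j) * t ^ Suc j) has_real_derivative
          c / fact (Suc j) * (real (Suc j) * t ^ j)) (at t within {0..x})"
        using DERIV_cmult[OF DERIV_pow[of "Suc j" t "{0..x}"], of "c / fact (Suc j)"] by simp
      moreover have "c / fact (Suc j) * (real (Suc j) * t ^ j) = c * t ^ j / fact j"
        by (simp add: fact_Suc del: of_nat_Suc)
      ultimately show "((\<lambda>t. c * t ^ Suc j / fact (Suc j)) has_vector_derivative c * t ^ j / fact j) (at t within {0..x})"
        by (simp add: has_real_derivative_iff_has_vector_derivative)
    qed
    then show ?thesis by simp
  qed
  have bounds: "\<exists>L A. 0 \<le> L \<and> 0 \<le> A \<and> (\<forall>x\<in>{0..N}. \<bar>\<alpha> x\<bar> \<le> A \<and> \<bar>\<beta> x\<bar> \<le> A) \<and>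
      (\<forall>j. \<forall>x\<in>{0..N}. \<bar>zz j x\<bar> \<le> (L * N) ^ j / fact j \<and> \<bar>yy j x\<bar> \<le> A * N * ((L * N) ^ j / fact j))"
    if N: "0 \<le> N" for N
  proof -
    have "compact (\<alpha> ` {0..N})" "compact (\<beta> ` {0..N})"
      by (rule compact_continuous_image; use \<alpha> \<beta> in \<open>auto intro: continuous_on_subset\<close>)+
    then obtain A1 A2 where A1: "\<forall>y\<in>\<alpha> ` {0..N}. norm y \<le> A1" and A2: "\<forall>y\<in>\<beta> ` {0..N}. norm y \<le> A2"
      unfolding bounded_iff by (meson compact_imp_bounded bounded_iff)
    define A where "A = max A1 A2"
    have A: "\<bar>\<alpha> x\<bar> \<le> A" "\<bar>\<beta> x\<bar> \<le> A" if "x \<in> {0..N}" for x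
      using A1 A2 that by (auto simp: A_def le_max_iff_disj)
    have A0: "0 \<le> A" using A[of 0] N by force
    define L where "L = A * A * N"
    have L0: "0 \<le> L" using A0 N by (simp add: L_def)
    have int_bound: "\<bar>integral {0..x} g\<bar> \<le> c * x ^ Suc j / fact (Suc j)"
      if x: "x \<in> {0..N}" and g: "continuous_on {0..} g"
        and le: "\<And>t. t \<in> {0..N} \<Longrightarrow> \<bar>g t\<bar> \<le> c * t ^ j / fact j" for g x c j
    proof -
      have "norm (integral {0..x} g) \<le> integral {0..x} (\<lambda>t. c * t ^ j / fact j)"
      proof (rule integral_norm_bound_integral)
        show "g integrable_on {0..x}"
          by (rule integrable_continuous_interval) (rule continuous_on_subset[OF g], use x in auto)
        show "(\<lambda>t. c * t ^ j / fact j) integrable_on {0..x}"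
          using pow_int[of x c j] x by (auto simp: integrable_on_def)
      qed (use x le in auto)
      also have "\<dots> = c * x ^ Suc j / fact (Suc j)" using pow_int[of x c j] x by (intro integral_unique) auto
      finally show ?thesis by simp
    qed
    have main: "(\<forall>x\<in>{0..N}. \<bar>zz j x\<bar> \<le> L ^ j * x ^ j / fact j)" for j
    proof (induction j)
      case (Suc j)
      have y: "\<bar>yy j x\<bar> \<le> (A * N * L ^ j) * x ^ j / fact j" if x: "x \<in> {0..N}" for x
      proof -
        have "\<bar>yy j x\<bar> \<le> (A * L ^ j) * x ^ Suc j / fact (Suc j)"
          unfolding yy_def
        proof (rule int_bound[OF x c\<alpha>z])
          fix t assume t: "t \<in> {0..N}"
          have "\<bar>\<alpha> t * zz j t\<bar> \<le> A * (L ^ j * t ^ j / fact j)"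
            unfolding abs_mult using A[OF t] Suc t A0 by (intro mult_mono) auto
          then show "\<bar>\<alpha> t * zz j t\<bar> \<le> A * L ^ j * t ^ j / fact j" by (simp add: mult_ac)
        qed
        \<comment> \<open>Each round integrates twice, but one gain \<open>x / (j + 1)\<close> is
          given up for the factor \<open>N\<close>: a single factorial already makes the series
          converge.\<close>
        also have "\<dots> \<le> (A * N * L ^ j) * x ^ j / fact j"
        proof -
          have "x / real (Suc j) \<le> N / 1" using x by (intro frac_le) auto
          then have "(A * L ^ j * x ^ j / fact j) * (x / real (Suc j)) \<le> (A * L ^ j * x ^ j / fact j) * N"
            using A0 L0 x by (intro mult_left_mono) auto
          then show ?thesis by (simp add: fact_Suc field_simps del: of_nat_Suc)
        qed
        finally show ?thesis .
      qed
      show ?case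
      proof
        fix x assume x: "x \<in> {0..N}"
        have "\<bar>zz (Suc j) x\<bar> \<le> (A * (A * N * L ^ j)) * x ^ Suc j / fact (Suc j)"
          unfolding zzS
        proof (rule int_bound[OF x c\<beta>y])
          fix t assume t: "t \<in> {0..N}"
          have "\<bar>\<beta> t * yy j t\<bar> \<le> A * ((A * N * L ^ j) * t ^ j / fact j)"
            unfolding abs_mult using A[OF t] y[OF t] A0 by (intro mult_mono) auto
          then show "\<bar>\<beta> t * yy j t\<bar> \<le> A * (A * N * L ^ j) * t ^ j / fact j" by (simp add: mult_ac)
        qed
        then show "\<bar>zz (Suc j) x\<bar> \<le> L ^ Suc j * x ^ Suc j / fact (Suc j)"
          by (simp add: L_def mult_ac)
      qed
    qed (simp add: zz0)
    have zb: "\<bar>zz j x\<bar> \<le> (L * N) ^ j / fact j" if x: "x \<in> {0..N}" for j x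
    proof -
      have "\<bar>zz j x\<bar> \<le> L ^ j * x ^ j / fact j" using main x by blast
      also have "\<dots> \<le> L ^ j * N ^ j / fact j"
        using x L0 by (intro divide_right_mono mult_left_mono power_mono) auto
      finally show ?thesis by (simp add: power_mult_distrib)
    qed
    have yb: "\<bar>yy j x\<bar> \<le> A * N * ((L * N) ^ j / fact j)" if x: "x \<in> {0..N}" for j x
    proof -
      have "\<bar>yy j x\<bar> \<le> (A * (L * N) ^ j / fact j) * x ^ Suc 0 / fact (Suc 0)"
        unfolding yy_def
      proof (rule int_bound[OF x c\<alpha>z])
        fix t assume t: "t \<in> {0..N}"
        have "\<bar>\<alpha> t * zz j t\<bar> \<le> A * ((L * N) ^ j / fact j)"
          unfolding abs_mult using A[OF t] zb[OF t] A0 by (intro mult_mono) auto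
        then show "\<bar>\<alpha> t * zz j t\<bar> \<le> A * (L * N) ^ j / fact j * t ^ 0 / fact 0" by simp
      qed
      also have "\<dots> \<le> (A * (L * N) ^ j / fact j) * N ^ Suc 0 / fact (Suc 0)"
        using x A0 L0 N by (intro divide_right_mono mult_left_mono power_mono) auto
      finally show ?thesis by (simp add: mult_ac)
    qed
    show ?thesis
      by (rule exI[of _ L], rule exI[of _ A]) (use A0 L0 A zb yb in auto)
  qed
  have sums_ex: "summable (\<lambda>j. c * (r ^ j / fact j))" for c r :: real
    using summable_exp[of r] by (intro summable_mult) (simp add: field_simps)
  define y where "y x = (\<Sum>j. yy j x)" for x
  define z where "z x = (\<Sum>j. zz j x)" for x
  have uniform: "uniform_limit {0..N} (\<lambda>n x. \<Sum>j<n. \<alpha> x * zz j x) (\<lambda>x. \<alpha> x * z x) sequentially \<and>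
      uniform_limit {0..N} (\<lambda>n x. \<Sum>j<n. \<beta> x * yy j x) (\<lambda>x. \<beta> x * y x) sequentially \<and>
      (\<forall>x\<in>{0..N}. summable (\<lambda>j. yy j x) \<and> summable (\<lambda>j. zz j x))" if N: "0 \<le> N" for N
  proof -
    obtain L A where LA: "0 \<le> L" "0 \<le> A" and b: "\<And>x. x \<in> {0..N} \<Longrightarrow> \<bar>\<alpha> x\<bar> \<le> A \<and> \<bar>\<beta> x\<bar> \<le> A"
      and zb: "\<And>j x. x \<in> {0..N} \<Longrightarrow> \<bar>zz j x\<bar> \<le> (L * N) ^ j / fact j"
      and yb: "\<And>j x. x \<in> {0..N} \<Longrightarrow> \<bar>yy j x\<bar> \<le> A * N * ((L * N) ^ j / fact j)"
      using bounds[OF N] by blast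
    have sz: "summable (\<lambda>j. zz j x)" if "x \<in> {0..N}" for x
      by (rule summable_comparison_test'[OF sums_ex[of 1 "L * N"]]) (use zb[OF that] in auto)
    have sy: "summable (\<lambda>j. yy j x)" if "x \<in> {0..N}" for x
      by (rule summable_comparison_test'[OF sums_ex[of "A * N" "L * N"]]) (use yb[OF that] in auto)
    have "uniform_limit {0..N} (\<lambda>n x. \<Sum>j<n. \<alpha> x * zz j x) (\<lambda>x. \<Sum>j. \<alpha> x * zz j x) sequentially"
    proof (rule Weierstrass_m_test)
      fix j x assume x: "x \<in> {0..N}"
      show "norm (\<alpha> x * zz j x) \<le> A * ((L * N) ^ j / fact j)"
        unfolding real_norm_def abs_mult using b[OF x] zb[OF x] LA(2) by (intro mult_mono) auto
    qed (rule sums_ex)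
    then have 1: "uniform_limit {0..N} (\<lambda>n x. \<Sum>j<n. \<alpha> x * zz j x) (\<lambda>x. \<alpha> x * z x) sequentially"
      by (rule uniform_limit_cong'[THEN iffD1, rotated -1]) (use sz in \<open>auto simp: z_def suminf_mult\<close>)
    have "uniform_limit {0..N} (\<lambda>n x. \<Sum>j<n. \<beta> x * yy j x) (\<lambda>x. \<Sum>j. \<beta> x * yy j x) sequentially"
    proof (rule Weierstrass_m_test)
      fix j x assume x: "x \<in> {0..N}"
      have "norm (\<beta> x * yy j x) \<le> A * (A * N * ((L * N) ^ j / fact j))"
        unfolding real_norm_def abs_mult using b[OF x] yb[OF x] LA(2) by (intro mult_mono) auto
      then show "norm (\<beta> x * yy j x) \<le> (A * (A * N)) * ((L * N) ^ j / fact j)" by (simp add: mult_ac)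
    qed (rule sums_ex)
    then have 2: "uniform_limit {0..N} (\<lambda>n x. \<Sum>j<n. \<beta> x * yy j x) (\<lambda>x. \<beta> x * y x) sequentially"
      by (rule uniform_limit_cong'[THEN iffD1, rotated -1]) (use sy in \<open>auto simp: y_def suminf_mult\<close>)
    show ?thesis using 1 2 sy sz by blast
  qed
  \<comment> \<open>Uniform convergence holds on bounded intervals only; ending the interval at
    \<open>x + 1\<close> keeps the derivative at \<open>x\<close> that of the half-line.\<close>
  have nhd: "at x within {0..x+1} = at x within {0..}" for x :: real
    by (rule at_within_nhd[of _ "{..<x+1}"]) auto
  show thesis
  proof
    fix x :: real assume x: "0 \<le> x"
    have x1: "0 \<le> x + 1" using x by simp
    have U1: "uniform_limit {0..x+1} (\<lambda>n t. \<Sum>j<n. \<alpha> t * zz j t) (\<lambda>t. \<alpha> t * z t) sequentially"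
      and U2: "uniform_limit {0..x+1} (\<lambda>n t. \<Sum>j<n. \<beta> t * yy j t) (\<lambda>t. \<beta> t * y t) sequentially"
      and U3: "summable (\<lambda>j. yy j 0)" "summable (\<lambda>j. zz (Suc j) 0)"
      using uniform[OF x1] x1 summable_Suc_iff[of "\<lambda>j. zz j 0"] by auto
    have mem0: "(0::real) \<in> {0..x+1}" using x1 by simp
    have D1: "(yy j has_field_derivative \<alpha> t * zz j t) (at t within {0..x+1})" if "t \<in> {0..x+1}" for j t
      using dy[of t j] that by (auto intro: DERIV_subset)
    have D2: "(zz (Suc j) has_field_derivative \<beta> t * yy j t) (at t within {0..x+1})" if "t \<in> {0..x+1}" for j t
      using dz[of t j] that by (auto intro: DERIV_subset)
    have "\<exists>g. \<forall>t\<in>{0..x+1}. (\<lambda>j. yy j t) sums g t \<and> (g has_field_derivative \<alpha> t * z t) (at t within {0..x+1})"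
      by (rule has_field_derivative_series[OF convex_real_interval(5) D1 U1 mem0 U3(1)])
    then obtain g where g: "\<And>t. t \<in> {0..x+1} \<Longrightarrow> (\<lambda>j. yy j t) sums g t"
      "\<And>t. t \<in> {0..x+1} \<Longrightarrow> (g has_field_derivative \<alpha> t * z t) (at t within {0..x+1})" by blast
    have "(y has_field_derivative \<alpha> x * z x) (at x within {0..x+1})"
      by (rule has_field_derivative_transform_within[OF g(2) zero_less_one])
        (use x g(1) in \<open>auto simp: y_def sums_iff\<close>)
    then have dY: "(y has_real_derivative \<alpha> x * z x) (at x within {0..})" by (simp add: nhd)
    show "(y has_real_derivative \<alpha> x * z x) (at x within {0..})" by (rule dY)
    have E2: "\<exists>g. \<forall>t\<in>{0..x+1}. (\<lambda>j. zz (Suc j) t) sums g t \<and> (g has_field_derivative \<beta> t * y t) (at t within {0..x+1})"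
      by (rule has_field_derivative_series[OF convex_real_interval(5) D2 U2 mem0 U3(2)])
    from E2 obtain g where g: "\<And>t. t \<in> {0..x+1} \<Longrightarrow> (\<lambda>j. zz (Suc j) t) sums g t"
      "\<And>t. t \<in> {0..x+1} \<Longrightarrow> (g has_field_derivative \<beta> t * y t) (at t within {0..x+1})" by blast
    \<comment> \<open>The differentiated series starts at index 1, because \<open>zz 0\<close> is
      the constant 1; that term is restored here.\<close>
    have eq: "g t + 1 = z t" if "t \<in> {0..x+1}" for t
      using sums_Suc[OF g(1)[OF that]] by (simp add: z_def zz0 sums_iff)
    have "((\<lambda>t. g t + 1) has_field_derivative \<beta> x * y x) (at x within {0..x+1})"
      using g(2)[of x] x by (auto intro!: derivative_eq_intros)
    then have "(z has_field_derivative \<beta> x * y x) (at x within {0..x+1})"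
      by (rule has_field_derivative_transform_within[OF _ zero_less_one]) (use x eq in auto)
    then show "(z has_real_derivative \<beta> x * y x) (at x within {0..})" by (simp add: nhd)
  next
    show "y 0 = 0" by (simp add: y_def yy_def)
    have "zz j 0 = (if j = 0 then 1 else 0)" for j by (cases j) (simp_all add: zz0 zzS)
    then have "z 0 = (\<Sum>j. if j = 0 then 1 else 0)" by (simp add: z_def)
    also have "\<dots> = 1" using suminf_finite[of "{0}" "\<lambda>j. if j = 0 then 1 else (0::real)"] by auto
    finally show "z 0 = 1" .
  qed
qed

section \<open>The Dirichlet form\<close>

abbreviation dv :: "(real \<Rightarrow> complex) \<Rightarrow> real \<Rightarrow> complex" where
  "dv f x \<equiv> vector_derivative f (at x)"

text \<open>Values and derivatives vanish at the end points too, so integrations by parts over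
  \<open>{c..d}\<close> have no boundary terms.\<close>

definition supported :: "(real \<Rightarrow> complex) \<Rightarrow> real \<Rightarrow> real \<Rightarrow> bool" where
  "supported f c d \<longleftrightarrow> 0 < c \<and> c < d \<and> (\<forall>x. x \<notin> {c<..<d} \<longrightarrow> f x = 0 \<and> dv f x = 0)"

lemma supported_mono: "supported f c d \<Longrightarrow> 0 < c' \<Longrightarrow> c' \<le> c \<Longrightarrow> d \<le> d' \<Longrightarrow> supported f c' d'"
  unfolding supported_def by (metis greaterThanLessThan_iff less_le_trans le_less_trans)

lemma C1_0D:
  assumes "f \<in> C1_0"
  shows "(f has_vector_derivative dv f x) (at x)" "continuous_on S (dv f)" "continuous_on S f"
proof -
  have C1: "f C1_differentiable_on UNIV" using assms by (simp add: C1_0_def)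
  then show d: "(f has_vector_derivative dv f x) (at x)" for x
    by (simp add: C1_differentiable_on_eq vector_derivative_works)
  show "continuous_on S (dv f)" using C1 by (auto simp: C1_differentiable_on_eq intro: continuous_on_subset)
  show "continuous_on S f"
    using d by (meson continuous_at_imp_continuous_on has_vector_derivative_continuous)
qed

lemma compact_positive_interval:
  fixes K :: "real set"
  assumes "compact K" "K \<subseteq> {0<..}"
  obtains c d where "0 < c" "c < d" "K \<subseteq> {c<..<d}"
proof (cases "K = {}")
  case True
  then show ?thesis using that[of 1 2] by simp
next
  case False
  obtain s where s: "s \<in> K" "\<And>t. t \<in> K \<Longrightarrow> s \<le> t" using compact_attains_inf[OF assms(1) False] by blast
  obtain u where u: "u \<in> K" "\<And>t. t \<in> K \<Longrightarrow> t \<le> u" using compact_attains_sup[OF assms(1) False] by blast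
  have "s > 0" using s assms(2) by auto
  moreover have "s / 2 < u + 1" using s(2)[OF u(1)] \<open>s > 0\<close> by simp
  moreover have "K \<subseteq> {s/2<..<u+1}"
  proof
    fix t assume "t \<in> K"
    then show "t \<in> {s/2<..<u+1}" using s(2)[of t] u(2)[of t] \<open>s > 0\<close> by simp
  qed
  ultimately show ?thesis using that[of "s/2" "u+1"] by simp
qed

lemma dv_zero_outside:
  assumes "closed K" "\<And>x. x \<notin> K \<Longrightarrow> f x = 0" "x \<notin> K"
  shows "dv f x = 0"
proof -
  have "((\<lambda>x. 0) has_vector_derivative 0) (at x)" by simp
  then have "(f has_vector_derivative 0) (at x)"
    by (rule has_vector_derivative_transform_within_open[where S = "- K"]) (use assms in auto)
  then show ?thesis by (rule vector_derivative_at)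
qed

lemma C1_0_supported:
  assumes "f \<in> C1_0"
  obtains c d where "supported f c d"
proof -
  obtain K where K: "compact K" "K \<subseteq> {0<..}" "\<And>x. x \<notin> K \<Longrightarrow> f x = 0"
    using assms by (auto simp: C1_0_def compactly_supported_in_def)
  obtain c d where cd: "0 < c" "c < d" "K \<subseteq> {c<..<d}" by (rule compact_positive_interval[OF K(1,2)])
  have "f x = 0 \<and> dv f x = 0" if "x \<notin> {c<..<d}" for x
  proof -
    have x: "x \<notin> K" using that cd(3) by blast
    show ?thesis using K(3)[OF x] dv_zero_outside[OF compact_imp_closed[OF K(1)] K(3) x] by simp
  qed
  then have "supported f c d" using cd by (simp add: supported_def)
  then show thesis by (rule that)
qed

lemma C1_0_supported2:
  assumes "f \<in> C1_0" "g \<in> C1_0"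
  obtains c d where "supported f c d" "supported g c d"
proof -
  obtain c d where 1: "supported f c d" using C1_0_supported[OF assms(1)] .
  obtain c' d' where 2: "supported g c' d'" using C1_0_supported[OF assms(2)] .
  have "0 < min c c'" using 1 2 by (simp add: supported_def)
  then show thesis
    using that[OF supported_mono[OF 1, of "min c c'" "max d d'"] supported_mono[OF 2, of "min c c'" "max d d'"]]
    by simp
qed

lemma C1_0_I:
  assumes "\<And>x. (f has_vector_derivative f' x) (at x)" "continuous_on UNIV f'"
    and "compact K" "K \<subseteq> {0<..}" "\<And>x. x \<notin> K \<Longrightarrow> f x = 0"
  shows "f \<in> C1_0"
proof -
  have "f C1_differentiable_on UNIV" unfolding C1_differentiable_on_def using assms(1,2) by blast
  moreover have "compactly_supported_in f {0<..}"
    unfolding compactly_supported_in_def using assms(3-5) by blast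
  ultimately show ?thesis by (simp add: C1_0_def)
qed

lemma C1_0_add: assumes "f \<in> C1_0" "g \<in> C1_0" shows "(\<lambda>x. f x + g x) \<in> C1_0"
proof -
  obtain c d where s: "supported f c d" "supported g c d" using C1_0_supported2[OF assms] .
  show ?thesis
  proof (rule C1_0_I[of _ "\<lambda>x. dv f x + dv g x" "{c..d}"])
    show "((\<lambda>x. f x + g x) has_vector_derivative dv f x + dv g x) (at x)" for x
      by (intro has_vector_derivative_add C1_0D assms)
    show "continuous_on UNIV (\<lambda>x. dv f x + dv g x)" by (intro continuous_on_add C1_0D assms)
  qed (use s in \<open>auto simp: supported_def\<close>)
qed

lemma C1_0_scale: assumes "f \<in> C1_0" shows "(\<lambda>x. k * f x) \<in> C1_0"
proof -
  obtain c d where s: "supported f c d" using C1_0_supported[OF assms] .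
  show ?thesis
  proof (rule C1_0_I[of _ "\<lambda>x. k * dv f x" "{c..d}"])
    show "((\<lambda>x. k * f x) has_vector_derivative k * dv f x) (at x)" for x
      by (intro has_vector_derivative_mult_right C1_0D assms)
    show "continuous_on UNIV (\<lambda>x. k * dv f x)" by (intro continuous_intros C1_0D assms)
  qed (use s in \<open>auto simp: supported_def\<close>)
qed

lemma dv_add: assumes "f \<in> C1_0" "g \<in> C1_0" shows "dv (\<lambda>x. f x + g x) x = dv f x + dv g x"
  by (rule vector_derivative_at[OF has_vector_derivative_add[OF C1_0D(1)[OF assms(1)] C1_0D(1)[OF assms(2)]]])

lemma dv_scale: assumes "f \<in> C1_0" shows "dv (\<lambda>x. k * f x) x = k * dv f x"
  by (rule vector_derivative_at[OF has_vector_derivative_mult_right[OF C1_0D(1)[OF assms]]])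

section \<open>Coefficients, speed measure and closability of the Dirichlet form\<close>

locale diffusion_coeffs =
  fixes a b a' :: "real \<Rightarrow> real"
  assumes a_deriv: "\<And>x. 0 \<le> x \<Longrightarrow> (a has_real_derivative a' x) (at x within {0..})"
    and a'_cont: "continuous_on {0..} a'"
    and a_pos: "\<And>x. 0 \<le> x \<Longrightarrow> 0 < a x"
    and b_cont: "continuous_on {0..} b"
begin

abbreviation "B \<equiv> drift_potential a b"
text \<open>In this notation \<open>L u = (p u')' / (2 m)\<close>, and \<open>1 / p\<close> is the density of the scale function.\<close>

definition m :: "real \<Rightarrow> real" where "m x = exp (2 * B x)"
definition p :: "real \<Rightarrow> real" where "p x = a x * m x"
definition p' :: "real \<Rightarrow> real" where "p' x = (a' x + 2 * b x) * m x"

abbreviation "\<mu> \<equiv> speed_measure a b"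

lemma a_cont: "continuous_on {0..} a"
  by (rule DERIV_continuous_on[OF a_deriv]) simp

lemma B_deriv: "0 \<le> x \<Longrightarrow> (B has_real_derivative b x / a x) (at x within {0..})"
  unfolding drift_potential_def[abs_def]
  by (rule integral_from_zero_deriv) (use a_cont b_cont a_pos in \<open>auto intro!: continuous_on_divide simp: less_imp_neq[symmetric]\<close>)

lemma m_deriv: "0 \<le> x \<Longrightarrow> (m has_real_derivative 2 * (b x / a x) * m x) (at x within {0..})"
  unfolding m_def[abs_def] by (rule derivative_eq_intros B_deriv refl | simp)+

lemma p_deriv: "0 \<le> x \<Longrightarrow> (p has_real_derivative p' x) (at x within {0..})"
  unfolding p_def[abs_def] p'_def
  by (rule derivative_eq_intros a_deriv m_deriv refl | simp)+
    (use a_pos[of x] in \<open>simp add: field_simps\<close>)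

lemma m_pos: "0 < m x" by (simp add: m_def)

lemma p_pos: "0 \<le> x \<Longrightarrow> 0 < p x" using a_pos m_pos by (simp add: p_def)

lemma m_cont: "continuous_on {0..} m"
  by (rule DERIV_continuous_on[OF m_deriv]) simp

lemma p_cont: "continuous_on {0..} p"
  by (rule DERIV_continuous_on[OF p_deriv]) simp

lemma p'_cont: "continuous_on {0..} p'"
  unfolding p'_def[abs_def] by (intro continuous_intros a'_cont b_cont m_cont)

lemma at_pos: "0 < x \<Longrightarrow> at x within {0..} = at (x::real)"
  by (rule at_within_interior) simp

lemma m_measurable: "m \<in> borel_measurable (restrict_space lborel {0<..})"
proof -
  have "m \<in> borel_measurable (restrict_space borel {0<..})"
    by (rule borel_measurable_continuous_on_restrict) (use m_cont in \<open>auto intro: continuous_on_subset\<close>)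
  then show ?thesis by (simp cong: measurable_cong_sets add: sets_restrict_space)
qed

text \<open>The bridge between the two integration theories: for functions supported in
  \<open>{c..d}\<close> the speed measure becomes the weight \<open>m\<close> in an ordinary
  integral, to which the fundamental theorem of calculus applies.\<close>

lemma mu_integral:
  fixes g :: "real \<Rightarrow> 'e :: euclidean_space"
  assumes c: "0 < c" and g: "continuous_on {c..d} g" and z: "\<And>x. x \<notin> {c..d} \<Longrightarrow> g x = 0"
  shows "integrable \<mu> g" "integral\<^sup>L \<mu> g = integral {c..d} (\<lambda>x. m x *\<^sub>R g x)"
    "g \<in> borel_measurable \<mu>"
proof -
  have "set_integrable lborel {c..d} g" by (rule borel_integrable_atLeastAtMost'[OF g])
  moreover have "(\<lambda>x. indicator {c..d} x *\<^sub>R g x) = g"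
    using z by (auto simp: fun_eq_iff indicator_def)
  ultimately have "integrable lborel g" by (simp add: set_integrable_def)
  then have "g \<in> borel_measurable lborel" by simp
  then have gm: "g \<in> borel_measurable (restrict_space lborel {0<..})"
    by (rule measurable_restrict_space1)
  show "g \<in> borel_measurable \<mu>"
    using gm by (simp add: speed_measure_def)
  have mc: "continuous_on {c..d} (\<lambda>x. m x *\<^sub>R g x)"
    using m_cont g c by (auto intro!: continuous_intros intro: continuous_on_subset)
  have mg: "set_integrable lborel {c..d} (\<lambda>x. m x *\<^sub>R g x)"
    by (rule borel_integrable_atLeastAtMost'[OF mc])
  have eq: "(\<lambda>x. indicator {0<..} x *\<^sub>R (m x *\<^sub>R g x)) = (\<lambda>x. indicator {c..d} x *\<^sub>R (m x *\<^sub>R g x))"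
    using z c by (auto simp: fun_eq_iff indicator_def)
  have mu: "\<mu> = density (restrict_space lborel {0<..}) (\<lambda>x. ennreal (m x))"
    by (simp add: speed_measure_def m_def)
  have "integrable lborel (\<lambda>x. indicator {0<..} x *\<^sub>R (m x *\<^sub>R g x))"
    unfolding eq using mg by (simp only: set_integrable_def)
  then have "integrable (restrict_space lborel {0<..}) (\<lambda>x. m x *\<^sub>R g x)"
    by (subst integrable_restrict_space) simp_all
  then show "integrable \<mu> g"
    unfolding mu by (subst integrable_density) (use gm m_measurable m_pos in \<open>auto simp: less_imp_le\<close>)
  have "integral\<^sup>L \<mu> g = integral\<^sup>L (restrict_space lborel {0<..}) (\<lambda>x. m x *\<^sub>R g x)"
    unfolding mu by (rule integral_density) (use gm m_measurable m_pos in \<open>auto simp: less_imp_le\<close>)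
  also have "\<dots> = integral\<^sup>L lborel (\<lambda>x. indicator {0<..} x *\<^sub>R (m x *\<^sub>R g x))"
    by (rule integral_restrict_space) simp
  also have "\<dots> = set_lebesgue_integral lborel {c..d} (\<lambda>x. m x *\<^sub>R g x)"
    unfolding eq set_lebesgue_integral_def ..
  also have "\<dots> = integral {c..d} (\<lambda>x. m x *\<^sub>R g x)"
    by (rule set_borel_integral_eq_integral(2)[OF mg])
  finally show "integral\<^sup>L \<mu> g = integral {c..d} (\<lambda>x. m x *\<^sub>R g x)" .
qed

lemma L2_compact:
  assumes c: "0 < c" and g: "continuous_on {c..d} g" and z: "\<And>x. x \<notin> {c..d} \<Longrightarrow> g x = 0"
  shows "g \<in> L2 \<mu>" "(L2_norm \<mu> g)\<^sup>2 = integral {c..d} (\<lambda>x. m x * (cmod (g x))\<^sup>2)"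
proof -
  have c2: "continuous_on {c..d} (\<lambda>x. (cmod (g x))\<^sup>2)" by (intro continuous_intros g)
  have "integrable \<mu> (\<lambda>x. (cmod (g x))\<^sup>2)"
    "(\<integral>x. (cmod (g x))\<^sup>2 \<partial>\<mu>) = integral {c..d} (\<lambda>x. m x *\<^sub>R (cmod (g x))\<^sup>2)"
    by (rule mu_integral[OF c c2]; use z in auto)+
  moreover have "(L2_norm \<mu> g)\<^sup>2 = (\<integral>x. (cmod (g x))\<^sup>2 \<partial>\<mu>)" by (simp add: L2_norm_def)
  ultimately show "g \<in> L2 \<mu>" "(L2_norm \<mu> g)\<^sup>2 = integral {c..d} (\<lambda>x. m x * (cmod (g x))\<^sup>2)"
    using mu_integral(3)[OF c g z] by (auto simp: L2_def)
qed

lemma L2_inner_compact: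
  assumes c: "0 < c" and f: "continuous_on {c..d} f" and g: "continuous_on {c..d} g"
    and z: "\<And>x. x \<notin> {c..d} \<Longrightarrow> g x = 0"
  shows "L2_inner \<mu> f g = integral {c..d} (\<lambda>x. of_real (m x) * (f x * cnj (g x)))"
proof -
  have fg: "continuous_on {c..d} (\<lambda>x. f x * cnj (g x))" by (intro continuous_intros f g)
  show ?thesis
    unfolding L2_inner_def
    by (subst mu_integral(2)[OF c fg]) (use z in \<open>auto simp: scaleR_conv_of_real\<close>)
qed

text \<open>With the root of \<open>a\<close> absorbed, the form is half the inner product of
  \<open>sd f\<close> and \<open>sd g\<close>; sesquilinearity and positivity are inherited from
  \<open>L2\<close>.\<close>

definition sd :: "(real \<Rightarrow> complex) \<Rightarrow> real \<Rightarrow> complex" where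
  "sd f x = of_real (sqrt (a x)) * dv f x"

lemma sd_cont: assumes "f \<in> C1_0" "0 < c" shows "continuous_on {c..d} (sd f)"
proof -
  have "continuous_on {c..d} a" by (rule continuous_on_subset[OF a_cont]) (use assms in auto)
  then show ?thesis unfolding sd_def[abs_def] by (intro continuous_intros C1_0D(2) assms)
qed

lemma sd_zero: "supported f c d \<Longrightarrow> x \<notin> {c..d} \<Longrightarrow> sd f x = 0"
  by (auto simp: supported_def sd_def)

lemma sd_L2: assumes "f \<in> C1_0" shows "sd f \<in> L2 \<mu>"
proof -
  obtain c d where s: "supported f c d" using C1_0_supported[OF assms] .
  show ?thesis by (rule L2_compact[OF _ sd_cont[OF assms] sd_zero[OF s]]) (use s in \<open>auto simp: supported_def\<close>)
qed

lemma C1_0_L2: assumes "f \<in> C1_0" shows "f \<in> L2 \<mu>"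
proof -
  obtain c d where s: "supported f c d" using C1_0_supported[OF assms] .
  show ?thesis
    by (rule L2_compact[of c d f]) (use s C1_0D[OF assms] in \<open>auto simp: supported_def\<close>)
qed

lemma Q_D_sd:
  assumes f: "f \<in> C1_0"
  shows "Q_D a b f g = 1/2 * L2_inner \<mu> (sd f) (sd g)"
proof -
  obtain c d where s: "supported f c d" using C1_0_supported[OF f] .
  have "of_real (a x) * dv f x * cnj (dv g x) = sd f x * cnj (sd g x)" for x
  proof (cases "0 \<le> x")
    case True
    then have "complex_of_real (a x) = of_real (sqrt (a x)) * of_real (sqrt (a x))"
      using a_pos[of x] by (simp flip: of_real_mult)
    then show ?thesis by (simp add: sd_def)
  next
    \<comment> \<open>Left of 0 the coefficient \<open>a\<close> may be negative, but the derivative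
      of \<open>f\<close> vanishes there.\<close>
    case False
    then have "dv f x = 0" using s by (auto simp: supported_def)
    then show ?thesis by (simp add: sd_def)
  qed
  then show ?thesis by (simp add: Q_D_def L2_inner_def)
qed

lemma sd_add: "f \<in> C1_0 \<Longrightarrow> g \<in> C1_0 \<Longrightarrow> sd (\<lambda>x. f x + g x) = (\<lambda>x. sd f x + sd g x)"
  by (simp add: sd_def fun_eq_iff dv_add algebra_simps)

lemma sd_scale: "f \<in> C1_0 \<Longrightarrow> sd (\<lambda>x. k * f x) = (\<lambda>x. k * sd f x)"
  by (simp add: sd_def fun_eq_iff dv_scale algebra_simps)

lemma Re_Q_D: "f \<in> C1_0 \<Longrightarrow> Re (Q_D a b f f) = (L2_norm \<mu> (sd f))\<^sup>2 / 2"
  by (simp add: Q_D_sd L2_norm_square)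

sublocale psd_form C1_0 "Q_D a b"
proof
  fix f g h :: "real \<Rightarrow> complex" and k
  assume f: "f \<in> C1_0"
  show "(\<lambda>x. k * f x) \<in> C1_0" by (rule C1_0_scale[OF f])
  show "0 \<le> Re (Q_D a b f f)" by (simp add: Re_Q_D[OF f])
  { assume h: "h \<in> C1_0"
    show "Q_D a b (\<lambda>x. k * f x) h = k * Q_D a b f h"
      using f h by (simp add: Q_D_sd C1_0_scale sd_scale L2.scale_left sd_L2) }
  assume g: "g \<in> C1_0"
  show "(\<lambda>x. f x + g x) \<in> C1_0" by (rule C1_0_add[OF f g])
  show "Q_D a b g f = cnj (Q_D a b f g)"
    using L2.hermitian[OF sd_L2[OF f] sd_L2[OF g]] by (simp add: Q_D_sd f g)
  assume h: "h \<in> C1_0"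
  show "Q_D a b (\<lambda>x. f x + g x) h = Q_D a b f h + Q_D a b g h"
    using f g h by (simp add: Q_D_sd C1_0_add sd_add L2.add_left sd_L2 algebra_simps)
qed

text \<open>Weierstrass approximation, from which the linear interpolation of the end point values
  is subtracted. These values are below \<open>e / 3\<close>, so the correction keeps the total
  error within \<open>e\<close>.\<close>

lemma polynomial_approx_vanishing:
  fixes G :: "real \<Rightarrow> complex"
  assumes G: "continuous_on {c..d} G" "G c = 0" "G d = 0" and cd: "c < d" and e: "e > 0"
  obtains R R' where "\<And>x. (R has_vector_derivative R' x) (at x)" "continuous_on UNIV R'"
    "R c = 0" "R d = 0" "\<And>x. x \<in> {c..d} \<Longrightarrow> cmod (G x - R x) \<le> e"
proof -
  obtain P where P: "polynomial_function P" "\<forall>x\<in>{c..d}. cmod (G x - P x) < e / 3"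
    using Stone_Weierstrass_polynomial_function[OF compact_Icc G(1), of "e/3"] e by auto
  obtain P' where P': "polynomial_function P'" "\<And>x. (P has_vector_derivative P' x) (at x)"
    by (rule has_vector_derivative_polynomial_function[OF P(1)]) (rule that)
  define s where "s x = (x - c) / (d - c)" for x
  define R where "R x = P x - P c - s x *\<^sub>R (P d - P c)" for x
  have Pc: "cmod (P c) < e/3" "cmod (P d) < e/3" using P(2)[rule_format, of c] P(2)[rule_format, of d] G cd by auto
  show thesis
  proof
    fix x
    show "(R has_vector_derivative P' x - (1 / (d - c)) *\<^sub>R (P d - P c)) (at x)"
      unfolding R_def[abs_def] s_def
      by (rule derivative_eq_intros P'(2) refl | use cd in simp)+
  next
    show "continuous_on UNIV (\<lambda>x. P' x - (1 / (d - c)) *\<^sub>R (P d - P c))"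
      by (intro continuous_intros continuous_on_polymonial_function P'(1))
  next
    show "R c = 0" by (simp add: R_def s_def)
    show "R d = 0" using cd by (simp add: R_def s_def)
  next
    fix x assume x: "x \<in> {c..d}"
    have s: "0 \<le> s x" "s x \<le> 1" using x cd by (auto simp: s_def)
    have "G x - R x = (G x - P x) + ((1 - s x) *\<^sub>R P c + s x *\<^sub>R P d)"
      by (simp add: R_def algebra_simps)
    then have "cmod (G x - R x) \<le> cmod (G x - P x) + (cmod ((1 - s x) *\<^sub>R P c) + cmod (s x *\<^sub>R P d))"
      by (metis add_left_mono norm_triangle_ineq order_trans)
    also have "\<dots> \<le> e/3 + (1 * (e/3) + 1 * (e/3))"
      unfolding norm_scaleR using P(2) x s Pc by (intro add_mono mult_mono) (auto intro: less_imp_le)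
    finally show "cmod (G x - R x) \<le> e" by simp
  qed
qed

text \<open>Integration by parts would move the derivative onto \<open>p\<close> times the
  derivative of \<open>\<phi>\<close>, which need not be differentiable as \<open>\<phi>\<close> is
  only C^1. Hence that function is approximated uniformly by a C^1 function vanishing at the end
  points; boundedness of the form norms controls the error for all \<open>n\<close> at once.\<close>

lemma weak_null:
  assumes fs: "\<And>n. fs n \<in> C1_0" and null: "(\<lambda>n. L2_norm \<mu> (fs n)) \<longlonglongrightarrow> 0"
    and M: "\<And>n. nrm (fs n) \<le> M" and \<phi>: "\<phi> \<in> C1_0"
  shows "(\<lambda>n. Q_D a b (fs n) \<phi>) \<longlonglongrightarrow> 0"
proof -
  obtain c d where s: "supported \<phi> c d" using C1_0_supported[OF \<phi>] .
  then have c: "0 < c" and cd: "c < d" by (auto simp: supported_def)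
  have sub: "{c..d} \<subseteq> {0..}" using c by auto
  note pc = continuous_on_subset[OF p_cont sub] and mc = continuous_on_subset[OF m_cont sub]
    and ac = continuous_on_subset[OF a_cont sub]
  define G where "G x = of_real (p x) * dv \<phi> x" for x
  have G: "continuous_on {c..d} G" "G c = 0" "G d = 0"
    unfolding G_def[abs_def] using s by (auto simp: supported_def intro!: continuous_intros pc C1_0D[OF \<phi>])
  have ipc: "continuous_on {c..d} (\<lambda>x. 1 / p x)"
    using p_pos c by (intro continuous_intros pc) (auto simp: less_imp_neq[symmetric])
  define I where "I = integral {c..d} (\<lambda>x. 1 / p x)"
  have I0: "0 \<le> I" unfolding I_def using p_pos c
    by (intro integral_nonneg integrable_continuous_interval ipc) (auto simp: less_imp_le)
  have M0: "0 \<le> M" using M[of 0] nonneg[OF fs, of 0] by (meson order_trans real_sqrt_ge_zero)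
  have sdM: "L2_norm \<mu> (sd (fs n)) \<le> 2 * M" for n
  proof (rule power2_le_imp_le)
    have "sqrt ((L2_norm \<mu> (sd (fs n)))\<^sup>2 / 2) \<le> M" using M[of n] by (simp add: Re_Q_D[OF fs])
    then have "(L2_norm \<mu> (sd (fs n)))\<^sup>2 / 2 \<le> M\<^sup>2" by (rule sqrt_le_D)
    then have "(L2_norm \<mu> (sd (fs n)))\<^sup>2 \<le> 2 * M\<^sup>2" by simp
    also have "\<dots> \<le> (2 * M)\<^sup>2" by (simp add: power_mult_distrib)
    finally show "(L2_norm \<mu> (sd (fs n)))\<^sup>2 \<le> (2 * M)\<^sup>2" .
  qed (use M0 in simp)
  have "(\<lambda>n. L2_inner \<mu> (sd (fs n)) (sd \<phi>)) \<longlonglongrightarrow> 0"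
  proof (rule LIMSEQ_I)
    fix r :: real assume r: "r > 0"
    \<comment> \<open>Makes the error \<open>2 * M * e * sqrt I\<close> at most
      \<open>r / 2\<close>; the added ones keep the denominator positive.\<close>
    define e where "e = r / (4 * (M + 1) * (sqrt I + 1))"
    have e: "e > 0" unfolding e_def
      using r M0 real_sqrt_ge_zero[OF I0] by (intro divide_pos_pos mult_pos_pos add_nonneg_pos) auto
    obtain R R' where R': "\<And>x. (R has_vector_derivative R' x) (at x)" "continuous_on UNIV R'"
      and R0: "R c = 0" "R d = 0" and Re: "\<And>x. x \<in> {c..d} \<Longrightarrow> cmod (G x - R x) \<le> e"
      by (rule polynomial_approx_vanishing[OF G cd e]) (rule that)
    have Rc: "continuous_on {c..d} R"
      using R'(1) by (meson continuous_at_imp_continuous_on has_vector_derivative_continuous)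
    have R'c: "continuous_on {c..d} R'" using R'(2) by (rule continuous_on_subset) simp
    \<comment> \<open>In \<open>\<langle>sd (fs n), sd \<phi>\<rangle>\<close> replace \<open>p \<phi>'\<close> by the smooth \<open>R\<close> (error \<open>k2\<close>) and integrate by parts.\<close>
    define kR where "kR x = (if x \<in> {c..d} then R x / of_real (m x * sqrt (a x)) else 0)" for x
    define k1 where "k1 x = (if x \<in> {c..d} then R' x / of_real (m x) else 0)" for x
    have ms: "m x * sqrt (a x) \<noteq> 0" if "x \<in> {c..d}" for x
      using m_pos[of x] a_pos[of x] that c by auto
    have kRc: "continuous_on {c..d} kR"
    proof -
      have "continuous_on {c..d} (\<lambda>x. R x / of_real (m x * sqrt (a x)))"
        using ms by (intro continuous_intros Rc mc ac) auto
      then show ?thesis by (rule continuous_on_eq) (simp add: kR_def)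
    qed
    have k1c: "continuous_on {c..d} k1"
    proof -
      have "continuous_on {c..d} (\<lambda>x. R' x / of_real (m x))"
        using m_pos by (intro continuous_intros R'c mc) (auto simp: less_imp_neq[symmetric])
      then show ?thesis by (rule continuous_on_eq) (simp add: k1_def)
    qed
    have kR: "kR \<in> L2 \<mu>" by (rule L2_compact[OF c kRc]) (auto simp: kR_def)
    have k1: "k1 \<in> L2 \<mu>" by (rule L2_compact[OF c k1c]) (auto simp: k1_def)
    define k2 where "k2 x = sd \<phi> x - kR x" for x
    have k2: "k2 \<in> L2 \<mu>" unfolding k2_def[abs_def] by (rule L2.diff_mem[OF sd_L2[OF \<phi>] kR])
    have k2c: "continuous_on {c..d} k2"
      unfolding k2_def[abs_def] by (intro continuous_intros kRc sd_cont \<phi> c)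
    have k2z: "k2 x = 0" if "x \<notin> {c..d}" for x
      using sd_zero[OF s that] that by (auto simp: k2_def kR_def)
    have k2n: "L2_norm \<mu> k2 \<le> e * sqrt I"
    proof (rule power2_le_imp_le)
      \<comment> \<open>Dividing by \<open>m * sqrt a\<close> turns the uniform error into the
        weighted one: \<open>m |k2|\<^sup>2 = |G - R|\<^sup>2 / p\<close>.\<close>
      have k2v: "m x * (cmod (k2 x))\<^sup>2 \<le> e\<^sup>2 * (1 / p x)" if x: "x \<in> {c..d}" for x
      proof -
        have x0: "0 \<le> x" using x c by simp
        have "k2 x = (G x - R x) / of_real (m x * sqrt (a x))"
        proof -
          have "complex_of_real (p x) = of_real (sqrt (a x)) * of_real (m x * sqrt (a x))"
            using a_pos[OF x0] by (simp add: p_def flip: of_real_mult)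
          then have "sd \<phi> x = G x / of_real (m x * sqrt (a x))"
            using ms[OF x] by (simp add: sd_def G_def)
          then show ?thesis using x by (simp add: k2_def kR_def diff_divide_distrib)
        qed
        then have "(cmod (k2 x))\<^sup>2 = (cmod (G x - R x))\<^sup>2 / (m x * sqrt (a x))\<^sup>2"
          by (simp add: norm_divide power_divide norm_mult power_mult_distrib)
        also have "(m x * sqrt (a x))\<^sup>2 = m x * p x"
          using a_pos[OF x0] by (simp add: power_mult_distrib p_def power2_eq_square)
        finally have "m x * (cmod (k2 x))\<^sup>2 = (cmod (G x - R x))\<^sup>2 * (1 / p x)"
          using m_pos[of x] by simp
        also have "\<dots> \<le> e\<^sup>2 * (1 / p x)"
          using Re[OF x] p_pos[OF x0] by (intro mult_right_mono power_mono) (auto simp: less_imp_le)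
        finally show ?thesis .
      qed
      have "(L2_norm \<mu> k2)\<^sup>2 = integral {c..d} (\<lambda>x. m x * (cmod (k2 x))\<^sup>2)"
        by (rule L2_compact(2)[OF c k2c k2z])
      also have "\<dots> \<le> integral {c..d} (\<lambda>x. e\<^sup>2 * (1 / p x))"
        by (intro integral_le integrable_continuous_interval continuous_intros mc k2c ipc k2v)
      also have "\<dots> = e\<^sup>2 * I" unfolding I_def by (rule Henstock_Kurzweil_Integration.integral_mult_right)
      also have "\<dots> = (e * sqrt I)\<^sup>2" using I0 by (simp add: power_mult_distrib)
      finally show "(L2_norm \<mu> k2)\<^sup>2 \<le> (e * sqrt I)\<^sup>2" .
    qed (use e I0 in simp)
    have parts: "L2_inner \<mu> (sd (fs n)) kR = - L2_inner \<mu> (fs n) k1" for n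
    proof -
      note fc = C1_0D(3)[OF fs] and f'c = C1_0D(2)[OF fs]
      have "L2_inner \<mu> (sd (fs n)) kR = integral {c..d} (\<lambda>x. of_real (m x) * (sd (fs n) x * cnj (kR x)))"
        by (rule L2_inner_compact[OF c sd_cont[OF fs c] kRc]) (auto simp: kR_def)
      also have "\<dots> = integral {c..d} (\<lambda>x. dv (fs n) x * cnj (R x))"
        using ms by (intro integral_cong) (simp add: kR_def sd_def)
      finally have 1: "L2_inner \<mu> (sd (fs n)) kR = integral {c..d} (\<lambda>x. dv (fs n) x * cnj (R x))" .
      have "L2_inner \<mu> (fs n) k1 = integral {c..d} (\<lambda>x. of_real (m x) * (fs n x * cnj (k1 x)))"
        by (rule L2_inner_compact[OF c fc k1c]) (auto simp: k1_def)
      also have "\<dots> = integral {c..d} (\<lambda>x. fs n x * cnj (R' x))"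
        using m_pos by (intro integral_cong) (simp add: k1_def less_imp_neq[symmetric])
      finally have 2: "L2_inner \<mu> (fs n) k1 = integral {c..d} (\<lambda>x. fs n x * cnj (R' x))" .
      have "((\<lambda>x. fs n x * cnj (R' x) + dv (fs n) x * cnj (R x)) has_integral
          fs n d * cnj (R d) - fs n c * cnj (R c)) {c..d}"
        by (intro fundamental_theorem_of_calculus has_vector_derivative_mult
            has_vector_derivative_at_within[OF C1_0D(1)[OF fs]]
            bounded_linear.has_vector_derivative[OF bounded_linear_cnj]
            has_vector_derivative_at_within[OF R'(1)]) (use cd in simp)
      then have "integral {c..d} (\<lambda>x. fs n x * cnj (R' x) + dv (fs n) x * cnj (R x)) = 0"
        using R0 by (simp add: integral_unique)
      moreover have "integral {c..d} (\<lambda>x. fs n x * cnj (R' x) + dv (fs n) x * cnj (R x)) =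
          integral {c..d} (\<lambda>x. fs n x * cnj (R' x)) + integral {c..d} (\<lambda>x. dv (fs n) x * cnj (R x))"
        by (intro Henstock_Kurzweil_Integration.integral_add integrable_continuous_interval continuous_intros fc f'c Rc R'c)
      ultimately show ?thesis using 1 2 by (simp add: eq_neg_iff_add_eq_0 add.commute)
    qed
    have lim1: "(\<lambda>n. L2_norm \<mu> (fs n) * L2_norm \<mu> k1) \<longlonglongrightarrow> 0"
      using tendsto_mult_right[OF null, of "L2_norm \<mu> k1"] by simp
    obtain N where N: "\<forall>n\<ge>N. norm (L2_norm \<mu> (fs n) * L2_norm \<mu> k1 - 0) < r / 2"
      using LIMSEQ_D[OF lim1, of "r/2"] r by auto
    have "norm (L2_inner \<mu> (sd (fs n)) (sd \<phi>) - 0) < r" if "n \<ge> N" for n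
    proof -
      have "sd \<phi> = (\<lambda>x. kR x + k2 x)" by (simp add: k2_def)
      then have "L2_inner \<mu> (sd (fs n)) (sd \<phi>) = - L2_inner \<mu> (fs n) k1 + L2_inner \<mu> (sd (fs n)) k2"
        using L2.add_right[OF kR k2 sd_L2[OF fs]] parts by simp
      then have "norm (L2_inner \<mu> (sd (fs n)) (sd \<phi>)) \<le>
          norm (L2_inner \<mu> (fs n) k1) + norm (L2_inner \<mu> (sd (fs n)) k2)"
        using norm_triangle_ineq[of "- L2_inner \<mu> (fs n) k1" "L2_inner \<mu> (sd (fs n)) k2"] by simp
      also have "norm (L2_inner \<mu> (fs n) k1) \<le> L2_norm \<mu> (fs n) * L2_norm \<mu> k1"
        by (rule L2_Cauchy_Schwarz[OF C1_0_L2[OF fs] k1])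
      also have "\<dots> < r / 2" using N that by auto
      also have "norm (L2_inner \<mu> (sd (fs n)) k2) \<le> L2_norm \<mu> (sd (fs n)) * L2_norm \<mu> k2"
        by (rule L2_Cauchy_Schwarz[OF sd_L2[OF fs] k2])
      also have "\<dots> \<le> (2 * M) * (e * sqrt I)"
        using sdM k2n M0 L2_norm_nonneg by (intro mult_mono) auto
      also have "\<dots> \<le> (2 * (M + 1)) * (e * (sqrt I + 1))"
        using M0 e I0 by (intro mult_mono) auto
      also have "\<dots> = r / 2"
      proof -
        have "M + 1 \<noteq> 0" "sqrt I + 1 \<noteq> 0" using M0 real_sqrt_ge_zero[OF I0] by linarith+
        moreover have "2 * A * (r / (4 * A * C) * C) = r / 2" if "A \<noteq> 0" "C \<noteq> 0" for A C :: real
          using that by (simp add: field_simps)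
        ultimately show ?thesis unfolding e_def by blast
      qed
      finally show ?thesis by simp
    qed
    then show "\<exists>N. \<forall>n\<ge>N. norm (L2_inner \<mu> (sd (fs n)) (sd \<phi>) - 0) < r" by blast
  qed
  from tendsto_mult_left[OF this, of "1/2"] show ?thesis by (simp add: Q_D_sd[OF fs])
qed

lemma zero_C1_0: "(\<lambda>x. 0) \<in> C1_0"
  by (rule C1_0_I[of _ "\<lambda>x. 0" "{}"]) auto

sublocale closable_form C1_0 "Q_D a b" \<mu>
proof
  show "C1_0 \<noteq> {}" using zero_C1_0 by blast
  show "f \<in> C1_0 \<Longrightarrow> f \<in> L2 \<mu>" for f by (rule C1_0_L2)
  fix fs :: "nat \<Rightarrow> real \<Rightarrow> complex"
  assume fs: "\<And>n. fs n \<in> C1_0" and null: "(\<lambda>n. L2_norm \<mu> (fs n)) \<longlonglongrightarrow> 0"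
    and C: "\<And>e. e > 0 \<Longrightarrow> \<exists>N. \<forall>m\<ge>N. \<forall>n\<ge>N. nrm (\<lambda>x. fs m x - fs n x) < e"
  obtain M where M: "\<And>n. nrm (fs n) \<le> M" by (rule Cauchy_bounded[OF fs C]) auto
  show "(\<lambda>n. nrm (fs n)) \<longlonglongrightarrow> 0"
    by (rule closable_of_weak_null[OF fs C weak_null[OF fs null M]]) auto
qed

end

section \<open>Eigenvalue equation and test functions\<close>

text \<open>Powers of the positive part supply all cutoffs below: the cube is twice continuously
  differentiable, the square once.\<close>

lemma max0_power_deriv:
  "((\<lambda>t::real. (max 0 t) ^ Suc (Suc n)) has_real_derivative real (Suc (Suc n)) * (max 0 t) ^ Suc n) (at t)"
proof (cases "t = 0")
  case True
  have "((\<lambda>h. \<bar>h::real\<bar> ^ Suc n) \<longlongrightarrow> \<bar>0\<bar> ^ Suc n) (at 0)" by (intro tendsto_intros)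
  then have "((\<lambda>h. \<bar>h::real\<bar> ^ Suc n) \<longlongrightarrow> 0) (at 0)" by simp
  then have "((\<lambda>h::real. ((max 0 h) ^ Suc (Suc n) - (max 0 0) ^ Suc (Suc n)) / (h - 0)) \<longlongrightarrow> 0) (at 0)"
  proof (rule Lim_null_comparison[rotated])
    have "norm (((max 0 h) ^ Suc (Suc n) - (max 0 0) ^ Suc (Suc n)) / (h - 0)) \<le> \<bar>h\<bar> ^ Suc n" for h :: real
      by (cases "h \<le> 0") (simp_all add: max_def abs_mult power_abs del: power_Suc, simp add: power_abs abs_mult)
    then show "\<forall>\<^sub>F h in at 0. norm (((max 0 h) ^ Suc (Suc n) - (max 0 0) ^ Suc (Suc n)) / (h - 0)) \<le> \<bar>h::real\<bar> ^ Suc n"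
      by simp
  qed
  then show ?thesis by (simp add: True has_field_derivative_iff)
next
  case False
  show ?thesis
  proof (cases "0 < t")
    case True
    have "((\<lambda>t. t ^ Suc (Suc n)) has_real_derivative real (Suc (Suc n)) * t ^ Suc n) (at t)"
      using DERIV_pow[of "Suc (Suc n)" t UNIV] by simp
    then have "((\<lambda>t. (max 0 t) ^ Suc (Suc n)) has_real_derivative real (Suc (Suc n)) * t ^ Suc n) (at t)"
      by (rule has_field_derivative_transform_within_open[where S = "{0<..}"]) (use True in auto)
    then show ?thesis using True by simp
  next
    case False
    then have t: "t < 0" using \<open>t \<noteq> 0\<close> by simp
    have "((\<lambda>t. 0) has_real_derivative 0) (at t)" by simp
    then have "((\<lambda>t. (max 0 t) ^ Suc (Suc n)) has_real_derivative 0) (at t)"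
      by (rule has_field_derivative_transform_within_open[where S = "{..<0}"]) (use t in auto)
    then show ?thesis using t by simp
  qed
qed

lemma max0_cube_deriv: "((\<lambda>t. (max 0 t) ^ 3) has_real_derivative 3 * (max 0 t)\<^sup>2) (at t)"
proof -
  have "Suc (Suc 1) = 3" "Suc 1 = 2" by simp_all
  then show ?thesis using max0_power_deriv[of 1 t] by (simp only: of_nat_numeral)
qed

lemma max0_square_deriv: "((\<lambda>t. (max 0 t)\<^sup>2) has_real_derivative 2 * max 0 t) (at t)"
proof -
  have "Suc (Suc 0) = 2" "Suc 0 = 1" by simp_all
  then show ?thesis using max0_power_deriv[of 0 t] by (simp only: of_nat_numeral power_one_right)
qed

text \<open>Derivatives are known only on an open \<open>S\<close> around the support. Off
  \<open>K\<close> the function is 0, and the open sets \<open>S\<close> and \<open>- K\<close>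
  cover the line, so regularity is glued from the two.\<close>

lemma C2_0_I:
  fixes f f1 f2 :: "real \<Rightarrow> real"
  assumes S: "open S" "S \<subseteq> {0<..}" and K: "compact K" "K \<subseteq> S"
    and zero: "\<And>x. x \<notin> K \<Longrightarrow> f x = 0"
    and d1: "\<And>x. x \<in> S \<Longrightarrow> (f has_real_derivative f1 x) (at x)"
    and d2: "\<And>x. x \<in> S \<Longrightarrow> (f1 has_real_derivative f2 x) (at x)"
    and c2: "continuous_on S f2"
  shows "f \<in> C2_0" "\<And>x. x \<in> S \<Longrightarrow> deriv f x = f1 x" "\<And>x. x \<in> S \<Longrightarrow> deriv (deriv f) x = f2 x"
    and "\<And>x. x \<notin> K \<Longrightarrow> deriv f x = 0" "\<And>x. x \<notin> K \<Longrightarrow> deriv (deriv f) x = 0"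
proof -
  have oK: "open (- K)" using K(1) by (simp add: compact_imp_closed open_Compl)
  have z1: "(f has_real_derivative 0) (at x)" if "x \<notin> K" for x
    by (rule has_field_derivative_transform_within_open[OF DERIV_const[of 0] oK]) (use that zero in auto)
  show e1: "deriv f x = f1 x" if "x \<in> S" for x using d1[OF that] by (rule DERIV_imp_deriv)
  show e1': "deriv f x = 0" if "x \<notin> K" for x using z1[OF that] by (rule DERIV_imp_deriv)
  have D1: "(f has_real_derivative deriv f x) (at x)" for x
  proof -
    consider "x \<in> S" | "x \<notin> K" using K(2) by blast
    then show ?thesis by cases (use d1 z1 e1 e1' in auto)
  qed
  have d2': "(deriv f has_real_derivative f2 x) (at x)" if "x \<in> S" for x
    by (rule has_field_derivative_transform_within_open[OF d2[OF that] S(1) that]) (simp add: e1)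
  have z2: "(deriv f has_real_derivative 0) (at x)" if "x \<notin> K" for x
    by (rule has_field_derivative_transform_within_open[OF DERIV_const[of 0] oK]) (use that e1' in auto)
  show e2: "deriv (deriv f) x = f2 x" if "x \<in> S" for x using d2'[OF that] by (rule DERIV_imp_deriv)
  show e2': "deriv (deriv f) x = 0" if "x \<notin> K" for x using z2[OF that] by (rule DERIV_imp_deriv)
  have D2: "(deriv f has_real_derivative deriv (deriv f) x) (at x)" for x
  proof -
    consider "x \<in> S" | "x \<notin> K" using K(2) by blast
    then show ?thesis by cases (use d2' z2 e2 e2' in auto)
  qed
  have "continuous_on S (deriv (deriv f))" using c2 by (rule continuous_on_eq) (simp add: e2)
  moreover have "continuous_on (- K) (deriv (deriv f))"
    by (rule continuous_on_eq[OF continuous_on_const[of _ 0]]) (simp add: e2')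
  ultimately have "continuous_on (S \<union> - K) (deriv (deriv f))" by (rule continuous_on_open_Un[OF S(1) oK])
  moreover have "S \<union> - K = UNIV" using K(2) by auto
  ultimately have c: "continuous_on UNIV (deriv (deriv f))" by simp
  have "continuous_on UNIV (deriv f)" by (rule DERIV_continuous_on[OF D2])
  then have "f C1_differentiable_on UNIV"
    unfolding C1_differentiable_on_def using D1 has_real_derivative_iff_has_vector_derivative by blast
  moreover have "deriv f C1_differentiable_on UNIV"
    unfolding C1_differentiable_on_def using D2 c has_real_derivative_iff_has_vector_derivative by blast
  moreover have "compactly_supported_in f {0<..}"
    unfolding compactly_supported_in_def using K S(2) zero by blast
  ultimately show "f \<in> C2_0" by (simp add: C2_0_def)
qed

lemma C2_0_D:
  assumes "f \<in> C2_0"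
  shows "(f has_real_derivative deriv f x) (at x)" "(deriv f has_real_derivative deriv (deriv f) x) (at x)"
    "continuous_on S f" "continuous_on S (deriv f)" "continuous_on S (deriv (deriv f))"
proof -
  obtain D E where D: "\<And>x. (f has_vector_derivative D x) (at x)" "\<And>x. (deriv f has_vector_derivative E x) (at x)"
    and c: "continuous_on UNIV E"
    using assms unfolding C2_0_def C1_differentiable_on_def by blast
  have 1: "deriv f x = D x" for x
    using D(1) by (intro DERIV_imp_deriv) (simp add: has_real_derivative_iff_has_vector_derivative)
  have 2: "deriv (deriv f) x = E x" for x
    using D(2) by (intro DERIV_imp_deriv) (simp add: has_real_derivative_iff_has_vector_derivative)
  show d1: "(f has_real_derivative deriv f x) (at x)" for x
    using D(1) by (simp add: 1 has_real_derivative_iff_has_vector_derivative)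
  show d2: "(deriv f has_real_derivative deriv (deriv f) x) (at x)" for x
    using D(2) by (simp add: 2 has_real_derivative_iff_has_vector_derivative)
  show "continuous_on S f" by (rule DERIV_continuous_on[OF has_field_derivative_at_within[OF d1]])
  show "continuous_on S (deriv f)" by (rule DERIV_continuous_on[OF has_field_derivative_at_within[OF d2]])
  have "deriv (deriv f) = E" using 2 by auto
  then show "continuous_on S (deriv (deriv f))" using continuous_on_subset[OF c, of S] by simp
qed

lemma first_zero:
  fixes v :: "real \<Rightarrow> real"
  assumes v: "continuous_on {x0..} v" "v x0 > 0" and x: "x \<ge> x0" "v x \<le> 0"
  obtains x2 where "x0 < x2" "v x2 = 0" "\<And>t. x0 \<le> t \<Longrightarrow> t < x2 \<Longrightarrow> v t > 0"
proof -
  have c: "continuous_on {x0..x} v" by (rule continuous_on_subset[OF v(1)]) auto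
  define Z where "Z = {x0..x} \<inter> v -` {..0}"
  have "closed Z"
    unfolding Z_def by (rule continuous_closed_preimage[OF c closed_atLeastAtMost closed_atMost])
  moreover have "bounded Z" by (rule bounded_subset[of "{x0..x}"]) (auto simp: Z_def)
  ultimately have "compact Z" by (simp add: compact_eq_bounded_closed)
  moreover have "Z \<noteq> {}" using x by (auto simp: Z_def)
  ultimately have "\<exists>s\<in>Z. \<forall>t\<in>Z. s \<le> t" by (rule compact_attains_inf)
  then obtain x2 where x2: "x2 \<in> Z" "\<And>t. t \<in> Z \<Longrightarrow> x2 \<le> t" by blast
  have pos: "v t > 0" if "x0 \<le> t" "t < x2" for t
    using x2 that by (force simp: Z_def not_le[symmetric])
  have lt: "x0 < x2" using x2(1) v(2) by (cases "x0 = x2") (auto simp: Z_def)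
  have "v x2 \<ge> 0"
  proof (rule ccontr)
    assume "\<not> v x2 \<ge> 0"
    then have "\<exists>t\<ge>x0. t \<le> x2 \<and> v t = 0"
      using v(2) lt x2(1) by (intro IVT2') (auto simp: Z_def intro: continuous_on_subset[OF c])
    then obtain t where "x0 \<le> t" "t \<le> x2" "v t = 0" by blast
    then show False using pos[of t] \<open>\<not> v x2 \<ge> 0\<close> by (cases "t = x2") auto
  qed
  then have "v x2 = 0" using x2(1) by (simp add: Z_def)
  then show thesis using that lt pos by blast
qed

section \<open>Solutions of the eigenvalue equation and lower bounds of the form\<close>

context diffusion_coeffs
begin

text \<open>\<open>L u = - l u\<close> as a first-order system, with \<open>w = p u'\<close>.\<close>

definition is_sol :: "real \<Rightarrow> (real \<Rightarrow> real) \<Rightarrow> (real \<Rightarrow> real) \<Rightarrow> bool" where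
  "is_sol l u w \<longleftrightarrow> (\<forall>x\<ge>0. (u has_real_derivative w x / p x) (at x within {0..}) \<and>
     (w has_real_derivative - 2 * l * m x * u x) (at x within {0..}))"

lemma is_solD:
  assumes "is_sol l u w"
  shows "0 \<le> x \<Longrightarrow> (u has_real_derivative w x / p x) (at x within {0..})"
    "0 \<le> x \<Longrightarrow> (w has_real_derivative - 2 * l * m x * u x) (at x within {0..})"
    "0 < x \<Longrightarrow> (u has_real_derivative w x / p x) (at x)"
    "0 < x \<Longrightarrow> (w has_real_derivative - 2 * l * m x * u x) (at x)"
    "continuous_on {0..} u" "continuous_on {0..} w"
proof -
  show 1: "0 \<le> x \<Longrightarrow> (u has_real_derivative w x / p x) (at x within {0..})"
    and 2: "0 \<le> x \<Longrightarrow> (w has_real_derivative - 2 * l * m x * u x) (at x within {0..})" for x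
    using assms by (auto simp: is_sol_def)
  show "0 < x \<Longrightarrow> (u has_real_derivative w x / p x) (at x)"
    "0 < x \<Longrightarrow> (w has_real_derivative - 2 * l * m x * u x) (at x)"
    using 1[of x] 2[of x] at_pos[of x] by auto
  show "continuous_on {0..} u" by (rule DERIV_continuous_on[OF 1]) simp
  show "continuous_on {0..} w" by (rule DERIV_continuous_on[OF 2]) simp
qed

lemma inverse_p_cont: "continuous_on {0..} (\<lambda>x. 1 / p x)"
  using p_pos by (intro continuous_intros p_cont) (auto simp: less_imp_neq[symmetric])

lemma sol_Dirichlet:
  obtains u w where "is_sol l u w" "u 0 = 0" "w 0 = 1"
proof -
  have c: "continuous_on {0..} (\<lambda>x. - 2 * l * m x)" by (intro continuous_intros m_cont)
  obtain y z where "\<And>x. 0 \<le> x \<Longrightarrow> (y has_real_derivative 1 / p x * z x) (at x within {0..})"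
    "\<And>x. 0 \<le> x \<Longrightarrow> (z has_real_derivative - 2 * l * m x * y x) (at x within {0..})" "y 0 = 0" "z 0 = 1"
    by (rule linear_system_solution[OF inverse_p_cont c]) (rule that)
  then show thesis by (intro that[of y z]) (auto simp: is_sol_def)
qed

text \<open>The same linear system with the roles of \<open>u\<close> and \<open>w\<close>
  exchanged.\<close>

lemma sol_Neumann:
  obtains u w where "is_sol l u w" "u 0 = 1" "w 0 = 0"
proof -
  have c: "continuous_on {0..} (\<lambda>x. - 2 * l * m x)" by (intro continuous_intros m_cont)
  obtain y z where "\<And>x. 0 \<le> x \<Longrightarrow> (y has_real_derivative - 2 * l * m x * z x) (at x within {0..})"
    "\<And>x. 0 \<le> x \<Longrightarrow> (z has_real_derivative 1 / p x * y x) (at x within {0..})" "y 0 = 0" "z 0 = 1"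
    by (rule linear_system_solution[OF c inverse_p_cont]) (rule that)
  then show thesis by (intro that[of z y]) (auto simp: is_sol_def)
qed

text \<open>\<open>sol1\<close> is the first derivative of the solution and \<open>sol2\<close> the
  second, obtained from the equation for the flux by the quotient rule. This uses that
  \<open>p\<close>, hence \<open>a\<close>, is continuously differentiable.\<close>

definition sol1 :: "(real \<Rightarrow> real) \<Rightarrow> real \<Rightarrow> real" where "sol1 w x = w x / p x"
definition sol2 :: "real \<Rightarrow> (real \<Rightarrow> real) \<Rightarrow> (real \<Rightarrow> real) \<Rightarrow> real \<Rightarrow> real" where
  "sol2 l u w x = (- 2 * l * m x * u x - sol1 w x * p' x) / p x"

lemma sol_second_deriv:
  assumes "is_sol l u w" "0 < x"
  shows "(u has_real_derivative sol1 w x) (at x)" "(sol1 w has_real_derivative sol2 l u w x) (at x)"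
proof -
  show "(u has_real_derivative sol1 w x) (at x)" using is_solD(3)[OF assms] by (simp add: sol1_def)
  have p: "(p has_real_derivative p' x) (at x)" using p_deriv[of x] at_pos[of x] assms(2) by simp
  have "((\<lambda>x. w x / p x) has_real_derivative (- 2 * l * m x * u x * p x - w x * p' x) / (p x * p x)) (at x)"
    by (rule DERIV_divide[OF is_solD(4)[OF assms] p]) (use p_pos[of x] assms in simp)
  moreover have "(- 2 * l * m x * u x * p x - w x * p' x) / (p x * p x) = sol2 l u w x"
    using p_pos[of x] assms(2) by (simp add: sol2_def sol1_def field_simps)
  ultimately show "(sol1 w has_real_derivative sol2 l u w x) (at x)" by (simp add: sol1_def[abs_def])
qed

lemma sol_cont:
  assumes "is_sol l u w"
  shows "continuous_on {0..} (sol1 w)" "continuous_on {0..} (sol2 l u w)"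
proof -
  show c: "continuous_on {0..} (sol1 w)"
    unfolding sol1_def[abs_def] using p_pos
    by (intro continuous_intros is_solD(6)[OF assms] p_cont) (auto simp: less_imp_neq[symmetric])
  show "continuous_on {0..} (sol2 l u w)"
    unfolding sol2_def[abs_def] using p_pos
    by (intro continuous_intros c is_solD(5)[OF assms] p_cont m_cont p'_cont) (auto simp: less_imp_neq[symmetric])
qed

lemma sol_ode:
  assumes "0 < x"
  shows "1/2 * a x * sol2 l u w x + (1/2 * a' x + b x) * sol1 w x = - l * u x"
proof -
  have "a x * sol2 l u w x = - 2 * l * u x - sol1 w x * (a' x + 2 * b x)"
    using a_pos[of x] m_pos[of x] assms by (simp add: sol2_def p'_def p_def field_simps)
  then have "1/2 * (a x * sol2 l u w x) + (1/2 * a' x + b x) * sol1 w x = - l * u x"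
    by (simp add: algebra_simps)
  then show ?thesis by simp
qed

text \<open>The hypothesis on \<open>a\<close> is one-sided at 0, while \<open>generator\<close>
  uses the two-sided \<open>deriv a\<close>; the two agree on the open half-line, where the test
  functions live.\<close>

lemma deriv_a: "0 < x \<Longrightarrow> deriv a x = a' x"
  using a_deriv[of x] at_pos[of x] by (intro DERIV_imp_deriv) simp

text \<open>\<open>h = |\<phi>|\<^sup>2 w / u\<close> vanishes at both ends of the support, so its
  derivative integrates to 0 and can be subtracted from the integrand of the form. The support stays
  away from 0, so \<open>u\<close> may vanish there.\<close>

lemma positive_solution_bound:
  assumes sol: "is_sol l u w" and pos: "\<And>x. 0 < x \<Longrightarrow> 0 < u x" and \<phi>: "\<phi> \<in> C1_0"
  shows "l * (L2_norm \<mu> \<phi>)\<^sup>2 \<le> Re (Q_D a b \<phi> \<phi>)"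
proof -
  obtain c d where s: "supported \<phi> c d" using C1_0_supported[OF \<phi>] .
  then have c: "0 < c" and cd: "c < d" by (auto simp: supported_def)
  have sub: "{c..d} \<subseteq> {0..}" using c by auto
  note pc = continuous_on_subset[OF p_cont sub] and mc = continuous_on_subset[OF m_cont sub]
  note \<phi>c = C1_0D(3)[OF \<phi>] and \<phi>'c = C1_0D(2)[OF \<phi>]
  have norm: "(L2_norm \<mu> \<phi>)\<^sup>2 = integral {c..d} (\<lambda>x. m x * (cmod (\<phi> x))\<^sup>2)"
    by (rule L2_compact(2)[OF c \<phi>c]) (use s in \<open>auto simp: supported_def\<close>)
  have "(L2_norm \<mu> (sd \<phi>))\<^sup>2 = integral {c..d} (\<lambda>x. m x * (cmod (sd \<phi> x))\<^sup>2)"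
    by (rule L2_compact(2)[OF c sd_cont[OF \<phi> c] sd_zero[OF s]])
  also have "\<dots> = integral {c..d} (\<lambda>x. p x * (cmod (dv \<phi> x))\<^sup>2)"
  proof (rule integral_cong)
    fix x assume "x \<in> {c..d}"
    then have "0 \<le> a x" using a_pos[of x] c by simp
    then show "m x * (cmod (sd \<phi> x))\<^sup>2 = p x * (cmod (dv \<phi> x))\<^sup>2"
      by (simp add: sd_def norm_mult power_mult_distrib p_def)
  qed
  finally have Q: "2 * Re (Q_D a b \<phi> \<phi>) = integral {c..d} (\<lambda>x. p x * (cmod (dv \<phi> x))\<^sup>2)"
    by (simp add: Re_Q_D[OF \<phi>])
  define r where "r x = Re (\<phi> x)" for x
  define s where "s x = Im (\<phi> x)" for x
  define r1 where "r1 x = Re (dv \<phi> x)" for x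
  define s1 where "s1 x = Im (dv \<phi> x)" for x
  have dr: "(r has_real_derivative r1 x) (at x)" "(s has_real_derivative s1 x) (at x)" for x
    unfolding r_def[abs_def] s_def[abs_def] r1_def s1_def has_real_derivative_iff_has_vector_derivative
    by (rule bounded_linear.has_vector_derivative[OF bounded_linear_Re C1_0D(1)[OF \<phi>]]
        bounded_linear.has_vector_derivative[OF bounded_linear_Im C1_0D(1)[OF \<phi>]])+
  define h where "h x = ((r x)\<^sup>2 + (s x)\<^sup>2) * (w x / u x)" for x
  define h' where "h' x = (2 * r x * r1 x + 2 * s x * s1 x) * (w x / u x) +
      ((r x)\<^sup>2 + (s x)\<^sup>2) * (- 2 * l * m x - (w x / u x)\<^sup>2 / p x)" for x
  define F where "F x = p x * (cmod (dv \<phi> x))\<^sup>2 - 2 * l * (m x * (cmod (\<phi> x))\<^sup>2)" for x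
  have dh: "(h has_real_derivative h' x) (at x)" if "x \<in> {c..d}" for x
  proof -
    have x: "0 < x" using that c by simp
    have u: "u x > 0" by (rule pos[OF x])
    have "((\<lambda>x. w x / u x) has_real_derivative
        (- 2 * l * m x * u x * u x - w x * (w x / p x)) / (u x * u x)) (at x)"
      by (rule DERIV_divide[OF is_solD(4)[OF sol x] is_solD(3)[OF sol x]]) (use u in simp)
    moreover have "(- 2 * l * m x * u x * u x - w x * (w x / p x)) / (u x * u x) =
        - 2 * l * m x - (w x / u x)\<^sup>2 / p x"
      using u p_pos[of x] x by (simp add: field_simps power2_eq_square)
    ultimately have 1: "((\<lambda>x. w x / u x) has_real_derivative - 2 * l * m x - (w x / u x)\<^sup>2 / p x) (at x)"
      by simp
    have 2: "((\<lambda>x. (r x)\<^sup>2 + (s x)\<^sup>2) has_real_derivative 2 * r x * r1 x + 2 * s x * s1 x) (at x)"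
      by (rule derivative_eq_intros dr refl | simp)+
    show ?thesis
      using DERIV_mult[OF 2 1] unfolding h_def[abs_def] h'_def by (simp add: add.commute mult.commute)
  qed
  have "(h' has_integral h d - h c) {c..d}"
    using cd dh by (intro fundamental_theorem_of_calculus)
      (auto simp: has_real_derivative_iff_has_vector_derivative[symmetric] intro: has_field_derivative_at_within)
  moreover have "h d = 0" "h c = 0"
    using \<open>supported \<phi> c d\<close> by (auto simp: h_def r_def s_def supported_def)
  ultimately have h0: "(h' has_integral 0) {c..d}" by simp
  have Fc: "continuous_on {c..d} F" unfolding F_def[abs_def] by (intro continuous_intros pc mc \<phi>c \<phi>'c)
  have "0 \<le> integral {c..d} F"
  proof (rule has_integral_le[OF h0 integrable_integral[OF integrable_continuous_interval[OF Fc]]])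
    fix x assume "x \<in> {c..d}"
    then have px: "p x > 0" using p_pos c by simp
    define k where "k = w x / u x"
    \<comment> \<open>Jacobi's identity: \<open>F - h' = p |\<phi>' - \<phi> u'/u|\<^sup>2\<close>\<close>
    have "F x - h' x = ((p x * r1 x - r x * k)\<^sup>2 + (p x * s1 x - s x * k)\<^sup>2) / p x"
      unfolding F_def h'_def k_def[symmetric] cmod_power2 r_def s_def r1_def s1_def
      using px by (simp add: field_simps power2_eq_square)
    moreover have "\<dots> \<ge> 0" using px by simp
    ultimately show "h' x \<le> F x" by linarith
  qed
  also have "integral {c..d} F = 2 * Re (Q_D a b \<phi> \<phi>) - 2 * l * (L2_norm \<mu> \<phi>)\<^sup>2"
    unfolding F_def[abs_def] Q norm
    by (subst Henstock_Kurzweil_Integration.integral_diff)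
      (auto intro!: integrable_continuous_interval continuous_intros pc mc \<phi>c \<phi>'c)
  finally show ?thesis by simp
qed

end

section \<open>Truncated solutions and positive solutions bounded below\<close>

text \<open>
  This truncation \<open>\<Phi>\<close> is convex and twice continuously differentiable on \<open>(0, \<infinity>)\<close>, vanishes up to \<open>\<eta>\<close>, and is
  asymptotically linear: \<open>s \<Phi>'(s) - \<Phi>(s) = 3 \<eta> (s - \<eta>)\<^sup>2 / s\<^sup>2\<close> for \<open>s \<ge> \<eta>\<close>. Hence \<open>\<Phi>(u)\<close> loses little of
  \<open>\<lambda>\<close> where \<open>u\<close> is large compared with \<open>\<eta>\<close>; elsewhere \<open>\<Phi>''(u) u'\<^sup>2\<close> compensates the loss, as \<open>u'/u\<close> is
  large near the zeros of \<open>u\<close>.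
\<close>

definition trunc :: "real \<Rightarrow> real \<Rightarrow> real" where
  "trunc \<eta> s = (max 0 (s - \<eta>)) ^ 3 / s\<^sup>2"
definition trunc1 :: "real \<Rightarrow> real \<Rightarrow> real" where
  "trunc1 \<eta> s = 3 * (max 0 (s - \<eta>))\<^sup>2 / s\<^sup>2 - 2 * (max 0 (s - \<eta>)) ^ 3 / s ^ 3"
definition trunc2 :: "real \<Rightarrow> real \<Rightarrow> real" where
  "trunc2 \<eta> s = 6 * max 0 (s - \<eta>) * (s - max 0 (s - \<eta>))\<^sup>2 / s ^ 4"

lemma trunc_deriv:
  assumes s: "0 < s"
  shows "(trunc \<eta> has_real_derivative trunc1 \<eta> s) (at s)"
    "(trunc1 \<eta> has_real_derivative trunc2 \<eta> s) (at s)"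
proof -
  let ?q = "\<lambda>s. max 0 (s - \<eta>)"
  have sh: "((\<lambda>s. s - \<eta>) has_real_derivative 1) (at s)" by (auto intro!: derivative_eq_intros)
  have q3: "((\<lambda>s. (?q s) ^ 3) has_real_derivative 3 * (?q s)\<^sup>2) (at s)"
    using DERIV_chain2[OF max0_cube_deriv sh] by simp
  have q2: "((\<lambda>s. (?q s)\<^sup>2) has_real_derivative 2 * ?q s) (at s)"
    using DERIV_chain2[OF max0_square_deriv sh] by simp
  have s2: "((\<lambda>s. s\<^sup>2) has_real_derivative 2 * s) (at s)" by (auto intro!: derivative_eq_intros)
  have s3: "((\<lambda>s. s ^ 3) has_real_derivative 3 * s\<^sup>2) (at s)" by (auto intro!: derivative_eq_intros)
  have "((\<lambda>s. (?q s) ^ 3 / s\<^sup>2) has_real_derivative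
      (3 * (?q s)\<^sup>2 * s\<^sup>2 - (?q s) ^ 3 * (2 * s)) / (s\<^sup>2 * s\<^sup>2)) (at s)"
    by (rule DERIV_divide[OF q3 s2]) (use s in simp)
  moreover have "(3 * q\<^sup>2 * s\<^sup>2 - q ^ 3 * (2 * s)) / (s\<^sup>2 * s\<^sup>2) = 3 * q\<^sup>2 / s\<^sup>2 - 2 * q ^ 3 / s ^ 3" for q
    using s by (simp add: field_simps eval_nat_numeral)
  ultimately show "(trunc \<eta> has_real_derivative trunc1 \<eta> s) (at s)"
    by (simp only: trunc_def[abs_def] trunc1_def)
  have "((\<lambda>s. 3 * (?q s)\<^sup>2 / s\<^sup>2 - 2 * (?q s) ^ 3 / s ^ 3) has_real_derivative
      (3 * (2 * ?q s) * s\<^sup>2 - 3 * (?q s)\<^sup>2 * (2 * s)) / (s\<^sup>2 * s\<^sup>2) -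
      (2 * (3 * (?q s)\<^sup>2) * s ^ 3 - 2 * (?q s) ^ 3 * (3 * s\<^sup>2)) / (s ^ 3 * s ^ 3)) (at s)"
    by (intro DERIV_diff DERIV_divide DERIV_cmult q2 q3 s2 s3) (use s in auto)
  moreover have "(3 * (2 * q) * s\<^sup>2 - 3 * q\<^sup>2 * (2 * s)) / (s\<^sup>2 * s\<^sup>2) -
      (2 * (3 * q\<^sup>2) * s ^ 3 - 2 * q ^ 3 * (3 * s\<^sup>2)) / (s ^ 3 * s ^ 3) = 6 * q * (s - q)\<^sup>2 / s ^ 4" for q
    using s by (simp add: field_simps eval_nat_numeral)
  ultimately show "(trunc1 \<eta> has_real_derivative trunc2 \<eta> s) (at s)"
    by (simp only: trunc1_def[abs_def] trunc2_def)
qed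

lemma continuous_trunc:
  assumes "continuous_on S u" "\<And>x. x \<in> S \<Longrightarrow> u x \<noteq> 0"
  shows "continuous_on S (\<lambda>x. trunc1 \<eta> (u x))" "continuous_on S (\<lambda>x. trunc2 \<eta> (u x))"
  unfolding trunc1_def trunc2_def using assms
  by (auto intro!: continuous_intros)

section \<open>Subsolutions and supersolutions built from solutions\<close>

context diffusion_coeffs
begin

text \<open>Rolle gives an interior point of zero flux, and after it the flux decreases strictly
  because its derivative is \<open>- 2 * l * m * u\<close>. Thus \<open>u\<close> crosses its zero
  transversally, which makes \<open>u'/u\<close> unbounded there.\<close>

lemma flux_neg_at_first_zero:
  assumes sol: "is_sol l u w" and l: "0 < l" and init: "u 0 = 0" "w 0 = 1"
    and \<gamma>: "0 < \<gamma>" "u \<gamma> = 0" and pos: "\<And>x. 0 < x \<Longrightarrow> x < \<gamma> \<Longrightarrow> 0 < u x"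
  shows "w \<gamma> < 0"
proof -
  have cu: "continuous_on {0..\<gamma>} u" "continuous_on {0..\<gamma>} w"
    using is_solD(5,6)[OF sol] by (auto intro: continuous_on_subset)
  obtain \<xi> where \<xi>: "0 < \<xi>" "\<xi> < \<gamma>" "w \<xi> / p \<xi> = 0"
  proof -
    have ends: "u 0 = u \<gamma>" using init \<gamma> by simp
    have der: "(u has_derivative (\<lambda>h. w x / p x * h)) (at x)" if "0 < x" "x < \<gamma>" for x
      using is_solD(3)[OF sol that(1)] by (simp only: has_field_derivative_def)
    from Rolle_deriv[OF \<gamma>(1) ends cu(1) der]
    obtain z where z: "0 < z" "z < \<gamma>" "(\<lambda>h. w z / p z * h) = (\<lambda>v. 0)" by blast
    have "w z / p z * 1 = 0" using z(3) by (rule fun_cong)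
    then show thesis using that[OF z(1,2)] by simp
  qed
  have w0: "w \<xi> = 0" using \<xi> p_pos[of \<xi>] by simp
  have "w \<gamma> < w \<xi>"
  proof (rule DERIV_neg_imp_decreasing_open[OF \<xi>(2)])
    fix x assume x: "\<xi> < x" "x < \<gamma>"
    have "- 2 * l * m x * u x < 0"
      using l m_pos[of x] pos[of x] x \<xi> by simp
    then show "\<exists>y. (w has_real_derivative y) (at x) \<and> y < 0"
      using is_solD(4)[OF sol, of x] x \<xi> by auto
  next
    show "continuous_on {\<xi>..\<gamma>} w" using cu(2) by (rule continuous_on_subset) (use \<xi> in auto)
  qed
  then show ?thesis using w0 by simp
qed

text \<open>For \<open>f = trunc \<eta> u\<close> and \<open>q = u - \<eta> \<ge> 0\<close>, the
  quantity \<open>L f + l1 f\<close> is \<open>q / u\<^sup>2\<close> times \<open>(l1 - l) q\<^sup>2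
  - 3 l \<eta> q + 3 \<eta>\<^sup>2 a (u'/u)\<^sup>2\<close>. The middle term is the loss; the first
  term pays for it when \<open>q\<close> is large compared with \<open>\<eta>\<close>, the last one
  near the zeros of \<open>u\<close>.\<close>

lemma subsolution:
  assumes sol: "is_sol l u w" and l: "0 < l" "l < l1" and init: "u 0 = 0" "w 0 = 1"
    and \<gamma>: "0 < \<gamma>" "u \<gamma> = 0" and pos: "\<And>x. 0 < x \<Longrightarrow> x < \<gamma> \<Longrightarrow> 0 < u x"
    and y0: "0 < y0" "y0 < \<gamma>"
  obtains f where "f \<in> C2_0" "\<And>x. 0 \<le> f x" "f y0 > 0" "\<And>x. - l1 * f x \<le> generator a b f x"
proof -
  have w\<gamma>: "w \<gamma> < 0" by (rule flux_neg_at_first_zero[OF sol l(1) init \<gamma> pos])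
  have sub: "{0..\<gamma>} \<subseteq> {0..}" by auto
  \<comment> \<open>For \<open>q \<ge> \<kappa> * \<eta>\<close> the term
    \<open>(l1 - l) q\<^sup>2\<close> alone dominates \<open>3 l \<eta> q\<close>. Below that
    threshold \<open>a u'\<^sup>2 \<ge> l \<kappa> u\<^sup>2\<close>, the condition
    \<open>H \<ge> 0\<close>, is enough.\<close>
  define \<kappa> where "\<kappa> = 3 * l / (l1 - l)"
  have \<kappa>: "\<kappa> > 0" "(l1 - l) * \<kappa> = 3 * l" using l by (auto simp: \<kappa>_def)
  define H where "H x = a x * (sol1 w x)\<^sup>2 - l * \<kappa> * (u x)\<^sup>2" for x
  have uc: "continuous_on {0..\<gamma>} u" using is_solD(5)[OF sol] by (rule continuous_on_subset) auto
  have Hc: "continuous_on {0..\<gamma>} H"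
    unfolding H_def[abs_def]
    by (intro continuous_intros uc continuous_on_subset[OF a_cont sub] continuous_on_subset[OF sol_cont(1)[OF sol] sub])
  have H0: "H 0 > 0" using a_pos[of 0] p_pos[of 0] init by (simp add: H_def sol1_def)
  have H\<gamma>: "H \<gamma> > 0" using a_pos[of \<gamma>] p_pos[of \<gamma>] w\<gamma> \<gamma> by (simp add: H_def sol1_def zero_less_mult_iff)
  \<comment> \<open>The set where the gradient may be too small. It is compact and avoids both end
    points, since \<open>H\<close> is positive there, so \<open>u\<close> has a positive lower bound
    on it.\<close>
  define Z where "Z = {0..\<gamma>} \<inter> H -` {..0}"
  have "closed Z" unfolding Z_def by (rule continuous_closed_preimage[OF Hc closed_atLeastAtMost closed_atMost])
  moreover have "bounded Z" by (rule bounded_subset[of "{0..\<gamma>}"]) (auto simp: Z_def)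
  ultimately have Z: "compact Z" by (simp add: compact_eq_bounded_closed)
  have Zpos: "u x > 0" if "x \<in> Z" for x
  proof -
    have "x \<noteq> 0" "x \<noteq> \<gamma>" using that H0 H\<gamma> by (auto simp: Z_def)
    then show ?thesis using that pos[of x] by (auto simp: Z_def)
  qed
  obtain \<mu>0 where \<mu>0: "\<mu>0 > 0" "\<And>x. x \<in> Z \<Longrightarrow> \<mu>0 \<le> u x"
  proof (cases "Z = {}")
    case True then show ?thesis using that[of 1] by simp
  next
    case False
    have "continuous_on Z u" by (rule continuous_on_subset[OF uc]) (auto simp: Z_def)
    from continuous_attains_inf[OF Z False this] obtain x where "x \<in> Z" "\<forall>y\<in>Z. u x \<le> u y" by blast
    then show ?thesis using that[of "u x"] Zpos by blast
  qed
  \<comment> \<open>So small that \<open>u < (1 + \<kappa>) * \<eta>\<close> forces a point outside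
    \<open>Z\<close>, and below \<open>u y0\<close>, so that the truncated function is positive at
    \<open>y0\<close>; halving makes both inequalities strict.\<close>
  define \<eta> where "\<eta> = min (\<mu>0 / (1 + \<kappa>)) (u y0) / 2"
  have uy0: "u y0 > 0" using pos y0 by blast
  have \<eta>: "0 < \<eta>" "(1 + \<kappa>) * \<eta> < \<mu>0" "\<eta> < u y0"
  proof -
    define t where "t = min (\<mu>0 / (1 + \<kappa>)) (u y0)"
    have K: "1 + \<kappa> > 0" using \<kappa>(1) by simp
    have t: "0 < t" "t \<le> \<mu>0 / (1 + \<kappa>)" "t \<le> u y0" "\<eta> = t / 2"
      using \<mu>0(1) K uy0 by (auto simp: t_def \<eta>_def)
    show "0 < \<eta>" "\<eta> < u y0" using t uy0 by linarith+
    have "\<eta> < \<mu>0 / (1 + \<kappa>)" using t by linarith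
    then show "(1 + \<kappa>) * \<eta> < \<mu>0" unfolding pos_less_divide_eq[OF K] by (simp only: mult.commute)
  qed
  have near: "a x * (sol1 w x)\<^sup>2 \<ge> l * \<kappa> * (u x)\<^sup>2" if "0 < x" "x < \<gamma>" "u x < (1 + \<kappa>) * \<eta>" for x
  proof -
    have "x \<notin> Z" using \<mu>0(2)[of x] \<eta>(2) that by auto
    then show ?thesis using that by (simp add: Z_def H_def)
  qed
  define K where "K = {0..\<gamma>} \<inter> u -` {\<eta>..}"
  have "closed K" unfolding K_def by (rule continuous_closed_preimage[OF uc closed_atLeastAtMost closed_atLeast])
  moreover have "bounded K" by (rule bounded_subset[of "{0..\<gamma>}"]) (auto simp: K_def)
  ultimately have K: "compact K" by (simp add: compact_eq_bounded_closed)
  have KS: "K \<subseteq> {0<..<\<gamma>}"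
  proof
    fix x assume "x \<in> K"
    moreover from this have "x \<noteq> 0" "x \<noteq> \<gamma>" using init \<gamma> \<eta>(1) by (auto simp: K_def)
    ultimately show "x \<in> {0<..<\<gamma>}" by (auto simp: K_def)
  qed
  \<comment> \<open>The restriction to \<open>(0, \<gamma>)\<close> is needed because
    \<open>u\<close> may be positive again beyond its first zero and is not controlled left of
    0.\<close>
  define f where "f x = (if 0 < x \<and> x < \<gamma> then trunc \<eta> (u x) else 0)" for x
  define f1 where "f1 x = trunc1 \<eta> (u x) * sol1 w x" for x
  define f2 where "f2 x = trunc2 \<eta> (u x) * sol1 w x * sol1 w x + sol2 l u w x * trunc1 \<eta> (u x)" for x
  have fz: "f x = 0" if "x \<notin> K" for x
    using that by (auto simp: f_def K_def trunc_def max_def)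
  have d1: "(f has_real_derivative f1 x) (at x)" if x: "x \<in> {0<..<\<gamma>}" for x
  proof -
    have "((\<lambda>x. trunc \<eta> (u x)) has_real_derivative f1 x) (at x)"
      unfolding f1_def using x
      by (intro DERIV_chain2[OF trunc_deriv(1) sol_second_deriv(1)[OF sol]] pos) auto
    then show ?thesis
      by (rule has_field_derivative_transform_within_open[where S = "{0<..<\<gamma>}"]) (use x in \<open>auto simp: f_def\<close>)
  qed
  have d2: "(f1 has_real_derivative f2 x) (at x)" if x: "x \<in> {0<..<\<gamma>}" for x
  proof -
    have "((\<lambda>x. trunc1 \<eta> (u x)) has_real_derivative trunc2 \<eta> (u x) * sol1 w x) (at x)"
      using x by (intro DERIV_chain2[OF trunc_deriv(2) sol_second_deriv(1)[OF sol]] pos) auto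
    from DERIV_mult[OF this sol_second_deriv(2)[OF sol]] show ?thesis
      unfolding f1_def[abs_def] f2_def using x by (simp add: mult_ac)
  qed
  have c2: "continuous_on {0<..<\<gamma>} f2"
  proof -
    have S: "{0<..<\<gamma>} \<subseteq> {0..}" by auto
    have u': "continuous_on {0<..<\<gamma>} u" using uc by (rule continuous_on_subset) auto
    have un: "u x \<noteq> 0" if "x \<in> {0<..<\<gamma>}" for x using pos[of x] that by auto
    show ?thesis unfolding f2_def[abs_def]
      by (intro continuous_intros continuous_trunc[OF u' un] continuous_on_subset[OF sol_cont(1)[OF sol] S]
          continuous_on_subset[OF sol_cont(2)[OF sol] S]) auto
  qed
  have SS: "{0<..<\<gamma>} \<subseteq> {0<..}" by auto
  have f: "f \<in> C2_0" by (rule C2_0_I(1)[OF open_greaterThanLessThan SS K KS fz d1 d2 c2])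
  have df: "deriv f x = f1 x" if "x \<in> {0<..<\<gamma>}" for x
    by (rule C2_0_I(2)[OF open_greaterThanLessThan SS K KS fz d1 d2 c2 that])
  have ddf: "deriv (deriv f) x = f2 x" if "x \<in> {0<..<\<gamma>}" for x
    by (rule C2_0_I(3)[OF open_greaterThanLessThan SS K KS fz d1 d2 c2 that])
  have dfz: "deriv f x = 0" if "x \<notin> K" for x
    by (rule C2_0_I(4)[OF open_greaterThanLessThan SS K KS fz d1 d2 c2 that])
  have ddfz: "deriv (deriv f) x = 0" if "x \<notin> K" for x
    by (rule C2_0_I(5)[OF open_greaterThanLessThan SS K KS fz d1 d2 c2 that])
  have gen: "- l1 * f x \<le> generator a b f x" for x
  proof (cases "x \<in> K")
    case False
    then show ?thesis using dfz[OF False] ddfz[OF False] fz[OF False] by (simp add: generator_def)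
  next
    case True
    then have x: "x \<in> {0<..<\<gamma>}" using KS by blast
    then have x0: "0 < x" by simp
    define s where "s = u x"
    define q where "q = s - \<eta>"
    have q: "q \<ge> 0" "max 0 (u x - \<eta>) = q" using True by (auto simp: K_def q_def s_def)
    have s: "s > 0" "s = q + \<eta>" using pos[of x] x by (auto simp: s_def q_def)
    define A where "A = a x * (sol1 w x)\<^sup>2"
    have A0: "A \<ge> 0" using a_pos[of x] x0 by (simp add: A_def)
    have Ph: "trunc \<eta> (u x) = q ^ 3 / s\<^sup>2" "trunc2 \<eta> (u x) = 6 * q * \<eta>\<^sup>2 / s ^ 4"
      "trunc1 \<eta> (u x) = q\<^sup>2 * (q + 3 * \<eta>) / s ^ 3"
    proof -
      show "trunc \<eta> (u x) = q ^ 3 / s\<^sup>2" by (simp add: trunc_def q s_def)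
      show "trunc2 \<eta> (u x) = 6 * q * \<eta>\<^sup>2 / s ^ 4" unfolding trunc2_def q(2) by (simp add: q_def s_def)
      have "trunc1 \<eta> (u x) = 3 * q\<^sup>2 / s\<^sup>2 - 2 * q ^ 3 / s ^ 3" unfolding trunc1_def q(2) by (simp add: s_def)
      also have "\<dots> = q\<^sup>2 * (3 * s - 2 * q) / s ^ 3" using s(1) by (simp add: field_simps eval_nat_numeral)
      also have "3 * s - 2 * q = q + 3 * \<eta>" using s(2) by simp
      finally show "trunc1 \<eta> (u x) = q\<^sup>2 * (q + 3 * \<eta>) / s ^ 3" .
    qed
    have "generator a b f x = 1/2 * a x * f2 x + (1/2 * a' x + b x) * f1 x"
      using df[OF x] ddf[OF x] deriv_a[OF x0] by (simp add: generator_def)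
    also have "\<dots> = 1/2 * trunc2 \<eta> (u x) * A +
        trunc1 \<eta> (u x) * (1/2 * a x * sol2 l u w x + (1/2 * a' x + b x) * sol1 w x)"
      by (simp add: f2_def f1_def A_def power2_eq_square algebra_simps)
    also have "\<dots> = 1/2 * trunc2 \<eta> (u x) * A - l * s * trunc1 \<eta> (u x)"
      using sol_ode[OF x0, of l u w] by (simp add: s_def)
    finally have "generator a b f x + l1 * f x = 1/2 * (6 * q * \<eta>\<^sup>2 / s ^ 4) * A
        - l * s * (q\<^sup>2 * (q + 3 * \<eta>) / s ^ 3) + l1 * (q ^ 3 / s\<^sup>2)"
      using x by (simp add: f_def Ph)
    also have "\<dots> = q / s\<^sup>2 * ((l1 - l) * q\<^sup>2 - 3 * l * \<eta> * q + 3 * \<eta>\<^sup>2 * (A / s\<^sup>2))"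
      using s(1) by (simp add: field_simps eval_nat_numeral)
    also have "\<dots> \<ge> 0"
    proof -
      have "(l1 - l) * q\<^sup>2 - 3 * l * \<eta> * q + 3 * \<eta>\<^sup>2 * (A / s\<^sup>2) \<ge> 0"
      proof (cases "\<kappa> * \<eta> \<le> q")
        case True
        have "3 * l * \<eta> * q = (l1 - l) * (\<kappa> * \<eta>) * q" using \<kappa>(2) by simp
        also have "\<dots> \<le> (l1 - l) * q * q" using True l q(1) by (intro mult_right_mono mult_left_mono) auto
        finally have "3 * l * \<eta> * q \<le> (l1 - l) * q\<^sup>2" by (simp add: power2_eq_square mult.assoc)
        moreover have "0 \<le> 3 * \<eta>\<^sup>2 * (A / s\<^sup>2)" using A0 by simp
        ultimately show ?thesis by linarith
      next
        case False
        then have "u x < (1 + \<kappa>) * \<eta>" using s(2) by (simp add: s_def algebra_simps)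
        then have "l * \<kappa> * s\<^sup>2 \<le> A" unfolding A_def s_def using near[of x] x by simp
        then have "l * \<kappa> \<le> A / s\<^sup>2" using s(1) by (simp add: pos_le_divide_eq)
        then have "3 * \<eta>\<^sup>2 * (l * \<kappa>) \<le> 3 * \<eta>\<^sup>2 * (A / s\<^sup>2)" by (intro mult_left_mono) auto
        moreover have "3 * l * \<eta> * q \<le> 3 * l * \<eta> * (\<kappa> * \<eta>)" using False l \<eta>(1) by (intro mult_left_mono) auto
        moreover have "3 * l * \<eta> * (\<kappa> * \<eta>) = 3 * \<eta>\<^sup>2 * (l * \<kappa>)" by (simp add: power2_eq_square)
        moreover have "0 \<le> (l1 - l) * q\<^sup>2" using l by simp
        ultimately show ?thesis by linarith
      qed
      then show ?thesis using q(1) by simp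
    qed
    finally show ?thesis by simp
  qed
  show thesis
  proof (rule that[OF f])
    show "0 \<le> f x" for x by (simp add: f_def trunc_def)
    show "f y0 > 0" using y0 uy0 \<eta>(3) by (simp add: f_def trunc_def)
    show "- l1 * f x \<le> generator a b f x" for x by (rule gen)
  qed
qed

text \<open>Integrating by parts gives
  \<open>\<integral> p f'\<^sup>2 = - 2 \<integral> m f L f\<close>. Since \<open>f \<ge> 0\<close>,
  the pointwise inequality may be multiplied by \<open>f\<close> and integrated.\<close>

lemma C2_0_form_bound:
  assumes f: "f \<in> C2_0" and f0: "\<And>x. 0 \<le> f x" and gen: "\<And>x. - l1 * f x \<le> generator a b f x"
  shows "(\<lambda>x. complex_of_real (f x)) \<in> C1_0"
    "Re (Q_D a b (\<lambda>x. of_real (f x)) (\<lambda>x. of_real (f x))) \<le> l1 * (L2_norm \<mu> (\<lambda>x. of_real (f x)))\<^sup>2"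
proof -
  note D = C2_0_D[OF f]
  let ?F = "\<lambda>x. complex_of_real (f x)"
  obtain K where K: "compact K" "K \<subseteq> {0<..}" "\<And>x. x \<notin> K \<Longrightarrow> f x = 0"
    using f by (auto simp: C2_0_def compactly_supported_in_def)
  have dF: "(?F has_vector_derivative of_real (deriv f x)) (at x)" for x
    by (rule bounded_linear.has_vector_derivative[OF bounded_linear_of_real
        D(1)[unfolded has_real_derivative_iff_has_vector_derivative]])
  show F: "?F \<in> C1_0"
    by (rule C1_0_I[OF dF _ K(1,2)]) (use K(3) in \<open>auto intro!: continuous_intros D\<close>)
  have dvF: "dv ?F x = of_real (deriv f x)" for x by (rule vector_derivative_at[OF dF])
  obtain c d where s: "supported ?F c d" using C1_0_supported[OF F] .
  then have c: "0 < c" and cd: "c < d" by (auto simp: supported_def)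
  have z: "f c = 0" "f d = 0" using s by (auto simp: supported_def)
  have sub: "{c..d} \<subseteq> {0..}" using c by auto
  note pc = continuous_on_subset[OF p_cont sub] and mc = continuous_on_subset[OF m_cont sub]
    and ac = continuous_on_subset[OF a_cont sub] and a'c = continuous_on_subset[OF a'_cont sub]
    and bc = continuous_on_subset[OF b_cont sub]
  have norm: "(L2_norm \<mu> ?F)\<^sup>2 = integral {c..d} (\<lambda>x. m x * (cmod (?F x))\<^sup>2)"
    by (rule L2_compact(2)[OF c]) (use s in \<open>auto simp: supported_def intro!: continuous_intros D\<close>)
  have "(L2_norm \<mu> (sd ?F))\<^sup>2 = integral {c..d} (\<lambda>x. m x * (cmod (sd ?F x))\<^sup>2)"
    by (rule L2_compact(2)[OF c sd_cont[OF F c] sd_zero[OF s]])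
  also have "\<dots> = integral {c..d} (\<lambda>x. p x * (deriv f x)\<^sup>2)"
  proof (rule integral_cong)
    fix x assume "x \<in> {c..d}"
    then have "0 \<le> a x" using a_pos[of x] c by simp
    then show "m x * (cmod (sd ?F x))\<^sup>2 = p x * (deriv f x)\<^sup>2"
      by (simp add: sd_def dvF norm_mult power_mult_distrib p_def)
  qed
  finally have Q: "2 * Re (Q_D a b ?F ?F) = integral {c..d} (\<lambda>x. p x * (deriv f x)\<^sup>2)"
    by (simp add: Re_Q_D[OF F])
  define h where "h x = p x * deriv f x * f x" for x
  define L where "L x = 1/2 * a x * deriv (deriv f) x + (1/2 * a' x + b x) * deriv f x" for x
  have Lgen: "generator a b f x = L x" if "x \<in> {c..d}" for x
    using deriv_a[of x] that c by (simp add: generator_def L_def)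
  have dh: "(h has_real_derivative p x * (deriv f x)\<^sup>2 + 2 * m x * L x * f x) (at x)" if "x \<in> {c..d}" for x
  proof -
    have x: "0 < x" using that c by simp
    have "(p has_real_derivative p' x) (at x)" using p_deriv[of x] at_pos[OF x] x by simp
    from DERIV_mult[OF DERIV_mult[OF this D(2)] D(1)]
    show ?thesis unfolding h_def[abs_def]
      by (rule DERIV_cong) (simp add: L_def p'_def p_def power2_eq_square algebra_simps)
  qed
  have Lc: "continuous_on {c..d} L" unfolding L_def[abs_def] by (intro continuous_intros ac a'c bc D)
  have "((\<lambda>x. p x * (deriv f x)\<^sup>2 + 2 * m x * L x * f x) has_integral h d - h c) {c..d}"
    using cd dh by (intro fundamental_theorem_of_calculus)
      (auto simp: has_real_derivative_iff_has_vector_derivative[symmetric] intro: has_field_derivative_at_within)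
  then have I0: "((\<lambda>x. p x * (deriv f x)\<^sup>2 + 2 * m x * L x * f x) has_integral 0) {c..d}"
    using z by (simp add: h_def)
  have I1: "((\<lambda>x. p x * (deriv f x)\<^sup>2 - 2 * l1 * (m x * (cmod (?F x))\<^sup>2)) has_integral
      integral {c..d} (\<lambda>x. p x * (deriv f x)\<^sup>2 - 2 * l1 * (m x * (cmod (?F x))\<^sup>2))) {c..d}"
    by (intro integrable_integral integrable_continuous_interval continuous_intros pc mc D)
  have "integral {c..d} (\<lambda>x. p x * (deriv f x)\<^sup>2 - 2 * l1 * (m x * (cmod (?F x))\<^sup>2)) \<le> 0"
  proof (rule has_integral_le[OF I1 I0])
    fix x assume x: "x \<in> {c..d}"
    have "2 * m x * f x * (- l1 * f x) \<le> 2 * m x * f x * L x"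
      using gen[of x] f0[of x] m_pos[of x] Lgen[OF x] by (intro mult_left_mono) auto
    moreover have "2 * m x * f x * (- l1 * f x) = - (2 * l1 * (m x * (f x)\<^sup>2))"
      by (simp add: power2_eq_square)
    moreover have "2 * m x * f x * L x = 2 * m x * L x * f x" by simp
    ultimately have "- (2 * l1 * (m x * (f x)\<^sup>2)) \<le> 2 * m x * L x * f x" by linarith
    moreover have "(cmod (?F x))\<^sup>2 = (f x)\<^sup>2" by simp
    ultimately show "p x * (deriv f x)\<^sup>2 - 2 * l1 * (m x * (cmod (?F x))\<^sup>2) \<le> p x * (deriv f x)\<^sup>2 + 2 * m x * L x * f x"
      by (simp only:)
  qed
  also have "integral {c..d} (\<lambda>x. p x * (deriv f x)\<^sup>2 - 2 * l1 * (m x * (cmod (?F x))\<^sup>2)) =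
      2 * Re (Q_D a b ?F ?F) - 2 * l1 * (L2_norm \<mu> ?F)\<^sup>2"
    unfolding Q norm
    by (subst Henstock_Kurzweil_Integration.integral_diff)
      (auto intro!: integrable_continuous_interval continuous_intros pc mc D)
  finally show "Re (Q_D a b ?F ?F) \<le> l1 * (L2_norm \<mu> ?F)\<^sup>2" by simp
qed

text \<open>The Dirichlet solution \<open>u\<close> is perturbed by a small multiple
  \<open>\<delta>\<close> of the Neumann solution \<open>g\<close>, which lifts the value at 0 to
  \<open>\<delta>\<close>. Then \<open>v / U\<close> has derivative equal to the Wronskian over
  \<open>p U\<^sup>2\<close>; as long as it increases, \<open>v\<close> cannot reach 0.\<close>

lemma supersolution:
  assumes sol': "is_sol l' U V" "U 0 = 0" "V 0 = 1" and U: "\<And>x. 0 < x \<Longrightarrow> 0 < U x"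
    and l: "0 < l" "l < l'"
    and scale: "\<And>C. \<exists>x\<ge>0. C < integral {0..x} (\<lambda>x. 1 / p x)"
  obtains v z \<delta> where "is_sol l v z" "0 < \<delta>" "\<And>x. 0 \<le> x \<Longrightarrow> \<delta> \<le> v x"
proof -
  obtain u w where uw: "is_sol l u w" "u 0 = 0" "w 0 = 1" by (rule sol_Dirichlet)
  obtain g h where gh: "is_sol l g h" "g 0 = 1" "h 0 = 0" by (rule sol_Neumann)
  \<comment> \<open>Near 0 the signs of \<open>u\<close>, \<open>w\<close> and \<open>g\<close>
    follow from the initial values. The comparison starts at a point \<open>x0\<close> in that
    region, where \<open>U\<close> is already positive.\<close>
  have "continuous (at 0 within {0..}) w" "continuous (at 0 within {0..}) g"
    using is_solD(6)[OF uw(1)] is_solD(5)[OF gh(1)] by (auto simp: continuous_on_eq_continuous_within)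
  have ev: "\<forall>\<^sub>F x in at 0 within {0..}. w x > 0 \<and> g x > 0"
    using \<open>continuous (at 0 within {0..}) w\<close> \<open>continuous (at 0 within {0..}) g\<close> uw gh
    by (intro eventually_conj order_tendstoD(1)) (auto simp: continuous_within)
  then obtain e where e: "e > 0" "\<And>x. 0 \<le> x \<Longrightarrow> x < e \<Longrightarrow> x \<noteq> 0 \<Longrightarrow> w x > 0 \<and> g x > 0"
    by (auto simp: eventually_at dist_real_def)
  define x0 where "x0 = e / 2"
  have x0: "x0 > 0" "x0 < e" using e by (auto simp: x0_def)
  have w_pos: "w x > 0" and g_pos: "g x > 0" if "0 \<le> x" "x \<le> x0" for x
    using e(2)[of x] that x0 uw gh by (cases "x = 0"; force)+
  have u_pos: "u x > 0" if x: "0 < x" "x \<le> x0" for x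
  proof -
    have "u 0 < u x"
    proof (rule DERIV_pos_imp_increasing_open[OF x(1)])
      fix t assume t: "0 < t" "t < x"
      then have "w t / p t > 0" using w_pos[of t] p_pos[of t] x by simp
      then show "\<exists>y. (u has_real_derivative y) (at t) \<and> y > 0" using is_solD(3)[OF uw(1) t(1)] by blast
    next
      show "continuous_on {0..x} u" using is_solD(5)[OF uw(1)] by (rule continuous_on_subset) auto
    qed
    then show ?thesis using uw by simp
  qed
  have wronskian: "((\<lambda>x. k x * U x - j x * V x) has_real_derivative 2 * (l' - l) * m x * j x * U x) (at x)"
    if "is_sol l j k" "0 < x" for j k x
    using DERIV_diff[OF DERIV_mult[OF is_solD(4)[OF that] is_solD(3)[OF sol'(1) that(2)]]
        DERIV_mult[OF is_solD(3)[OF that] is_solD(4)[OF sol'(1) that(2)]]]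
    by (rule DERIV_cong) (simp add: algebra_simps)
  \<comment> \<open>The Wronskian with \<open>U\<close> is positive at \<open>x0\<close> and stays so if a small multiple of \<open>g\<close> is added to \<open>u\<close>.\<close>
  define W0 where "W0 = w x0 * U x0 - u x0 * V x0"
  have W0: "W0 > 0"
  proof -
    have "w 0 * U 0 - u 0 * V 0 < w x0 * U x0 - u x0 * V x0"
    proof (rule DERIV_pos_imp_increasing_open[OF x0(1)])
      fix t assume t: "0 < t" "t < x0"
      then have "2 * (l' - l) * m t * u t * U t > 0" using l u_pos[of t] U[of t] m_pos[of t] by simp
      then show "\<exists>y. ((\<lambda>x. w x * U x - u x * V x) has_real_derivative y) (at t) \<and> y > 0"
        using wronskian[OF uw(1) t(1)] by blast
    next
      show "continuous_on {0..x0} (\<lambda>x. w x * U x - u x * V x)"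
        by (intro continuous_intros; rule continuous_on_subset[of "{0..}"])
          (use is_solD(5,6)[OF uw(1)] is_solD(5,6)[OF sol'(1)] in auto)
    qed
    then show ?thesis using uw sol' by (simp add: W0_def)
  qed
  define cc where "cc = h x0 * U x0 - g x0 * V x0"
  \<comment> \<open>The perturbation changes the Wronskian at \<open>x0\<close> by at most
    \<open>W0 / 2\<close>; the summand 1 avoids division by 0.\<close>
  define \<delta> where "\<delta> = W0 / (2 * (\<bar>cc\<bar> + 1))"
  have \<delta>: "\<delta> > 0" using W0 by (simp add: \<delta>_def add_nonneg_pos)
  have W\<delta>: "W0 + \<delta> * cc > 0"
  proof -
    have "\<delta> * \<bar>cc\<bar> \<le> \<delta> * (\<bar>cc\<bar> + 1)" using \<delta> by simp
    also have "\<dots> = W0 / 2" by (simp add: \<delta>_def field_simps add_nonneg_eq_0_iff)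
    finally have "\<bar>\<delta> * cc\<bar> \<le> W0 / 2" using \<delta> by (simp add: abs_mult)
    then show ?thesis using W0 by linarith
  qed
  define v where "v x = u x + \<delta> * g x" for x
  define z where "z x = w x + \<delta> * h x" for x
  have vz: "is_sol l v z"
    unfolding is_sol_def
  proof (intro allI impI conjI)
    fix x :: real assume x: "0 \<le> x"
    show "(v has_real_derivative z x / p x) (at x within {0..})"
      unfolding v_def[abs_def] z_def
      by (rule DERIV_cong[OF DERIV_add[OF is_solD(1)[OF uw(1) x] DERIV_cmult[OF is_solD(1)[OF gh(1) x]]]])
        (simp add: add_divide_distrib)
    show "(z has_real_derivative - 2 * l * m x * v x) (at x within {0..})"
      unfolding z_def[abs_def] v_def
      by (rule DERIV_cong[OF DERIV_add[OF is_solD(2)[OF uw(1) x] DERIV_cmult[OF is_solD(2)[OF gh(1) x]]]])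
        (simp add: algebra_simps)
  qed
  have v_small: "v x > 0" if "0 \<le> x" "x \<le> x0" for x
    using u_pos[of x] g_pos[of x] \<delta> that uw by (cases "x = 0") (auto simp: v_def add_pos_pos)
  have Wx0: "z x0 * U x0 - v x0 * V x0 > 0"
    using W\<delta> by (simp add: z_def v_def W0_def cc_def algebra_simps)
  note Uc = is_solD(5,6)[OF sol'(1)] and vc = is_solD(5,6)[OF vz]
  have v_pos: "v x > 0" if "0 \<le> x" for x
  proof (rule ccontr)
    assume neg: "\<not> v x > 0"
    then have nv: "v x \<le> 0" by simp
    have xx: "x \<ge> x0"
    proof (rule ccontr)
      assume "\<not> x \<ge> x0"
      then show False using v_small[of x] that neg by simp
    qed
    have cv: "continuous_on {x0..} v" using vc(1) by (rule continuous_on_subset) (use x0 in auto)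
    have v0: "v x0 > 0" using v_small[of x0] x0 by simp
    obtain x2 where x2: "x0 < x2" "v x2 = 0" "\<And>t. x0 \<le> t \<Longrightarrow> t < x2 \<Longrightarrow> v t > 0"
      by (rule first_zero[OF cv v0 xx nv]) (rule that)
    \<comment> \<open>Up to the first zero \<open>x2\<close> of \<open>v\<close> the derivative of
      the Wronskian, \<open>2 * (l' - l) * m * v * U\<close>, is nonnegative, so its positivity at
      \<open>x0\<close> persists.\<close>
    have Wt: "z t * U t - v t * V t > 0" if t: "x0 \<le> t" "t < x2" for t
    proof -
      have "z x0 * U x0 - v x0 * V x0 \<le> z t * U t - v t * V t"
      proof (rule DERIV_nonneg_imp_nondecreasing[OF t(1)])
        fix r assume r: "x0 \<le> r" "r \<le> t"
        then have "2 * (l' - l) * m r * v r * U r \<ge> 0"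
          using l x2(3)[of r] U[of r] m_pos[of r] x0 t by simp
        then show "\<exists>y. ((\<lambda>x. z x * U x - v x * V x) has_real_derivative y) (at r) \<and> y \<ge> 0"
          using wronskian[OF vz, of r] r x0 by force
      qed
      then show ?thesis using Wx0 by linarith
    qed
    have "v x0 / U x0 < v x2 / U x2"
    proof (rule DERIV_pos_imp_increasing_open[OF x2(1)])
      fix t assume t: "x0 < t" "t < x2"
      then have t0: "0 < t" using x0 by simp
      have "((\<lambda>x. v x / U x) has_real_derivative (z t / p t * U t - v t * (V t / p t)) / (U t * U t)) (at t)"
        by (rule DERIV_divide[OF is_solD(3)[OF vz t0] is_solD(3)[OF sol'(1) t0]]) (use U[OF t0] in simp)
      moreover have "(z t / p t * U t - v t * (V t / p t)) / (U t * U t) =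
          (z t * U t - v t * V t) / (p t * (U t * U t))"
        using p_pos[of t] t0 by (simp add: field_simps)
      moreover have "\<dots> > 0" using Wt[of t] t p_pos[of t] U[OF t0] t0 by simp
      ultimately show "\<exists>y. ((\<lambda>x. v x / U x) has_real_derivative y) (at t) \<and> y > 0" by metis
    next
      have "U t \<noteq> 0" if "t \<in> {x0..x2}" for t using U[of t] that x0 by auto
      then show "continuous_on {x0..x2} (\<lambda>x. v x / U x)"
        by (intro continuous_intros continuous_on_subset[OF vc(1)] continuous_on_subset[OF Uc(1)])
          (use x0 in auto)
    qed
    moreover have "v x0 / U x0 > 0" using v_small[of x0] U[of x0] x0 by simp
    ultimately show False using x2(2) by simp
  qed
  \<comment> \<open>If \<open>p v'\<close> became negative, \<open>v\<close> would decrease at least linearly in the scale and turn negative.\<close>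
  have z_nonneg: "z x1 \<ge> 0" if x1: "0 \<le> x1" for x1
  proof (rule ccontr)
    assume "\<not> z x1 \<ge> 0"
    then have z1: "z x1 < 0" by simp
    define S where "S x = integral {0..x} (\<lambda>x. 1 / p x)" for x
    have Sd: "(S has_real_derivative 1 / p x) (at x within {0..})" if "0 \<le> x" for x
      unfolding S_def[abs_def] by (rule integral_from_zero_deriv[OF inverse_p_cont that])
    have z_le: "z x \<le> z x1" if "x1 \<le> x" for x
    proof (rule DERIV_nonpos_imp_decreasing_open[OF that])
      fix t assume t: "x1 < t" "t < x"
      then have "- 2 * l * m t * v t \<le> 0" using l m_pos[of t] v_pos[of t] x1 by simp
      then show "\<exists>y. (z has_real_derivative y) (at t) \<and> y \<le> 0"
        using is_solD(4)[OF vz, of t] t x1 by force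
    next
      show "continuous_on {x1..x} z" using vc(2) by (rule continuous_on_subset) (use x1 in auto)
    qed
    have v_le: "v x - z x1 * S x \<le> v x1 - z x1 * S x1" if "x1 \<le> x" for x
    proof (rule DERIV_nonpos_imp_decreasing_open[OF that])
      fix t assume t: "x1 < t" "t < x"
      then have t0: "0 < t" using x1 by simp
      have "((\<lambda>x. v x - z x1 * S x) has_real_derivative z t / p t - z x1 * (1 / p t)) (at t)"
        using DERIV_diff[OF is_solD(3)[OF vz t0] DERIV_cmult[OF Sd[of t, unfolded at_pos[OF t0]]]] t0 by simp
      moreover have "z t / p t - z x1 * (1 / p t) \<le> 0"
        using z_le[of t] t p_pos[of t] t0 by (simp add: divide_right_mono)
      ultimately show "\<exists>y. ((\<lambda>x. v x - z x1 * S x) has_real_derivative y) (at t) \<and> y \<le> 0" by blast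
    next
      have cS: "continuous_on {0..} S" by (rule DERIV_continuous_on[OF Sd]) simp
      then show "continuous_on {x1..x} (\<lambda>x. v x - z x1 * S x)"
        by (intro continuous_intros continuous_on_subset[OF vc(1)] continuous_on_subset[OF cS]) (use x1 in auto)
    qed
    \<comment> \<open>The first entry of the maximum forces \<open>x\<close> beyond
      \<open>x1\<close>, as \<open>S\<close> is nondecreasing; the second makes the linear upper
      bound for \<open>v x\<close> negative.\<close>
    obtain x where x: "0 \<le> x" "max (S x1) (S x1 + v x1 / (- z x1)) < S x"
      using scale[of "max (S x1) (S x1 + v x1 / (- z x1))"] unfolding S_def by blast
    have "x1 \<le> x"
    proof (rule ccontr)
      assume "\<not> x1 \<le> x"
      then have "S x \<le> S x1"
        unfolding S_def using x(1) p_pos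
        by (intro integral_subset_le integrable_continuous_interval continuous_on_subset[OF inverse_p_cont])
          (auto simp: less_imp_le)
      then show False using x(2) by simp
    qed
    from v_le[OF this] have "v x \<le> v x1 + z x1 * (S x - S x1)" by (simp add: algebra_simps)
    moreover have "v x1 < (- z x1) * (S x - S x1)" using x(2) z1 by (simp add: field_simps)
    ultimately have "v x < 0" by simp
    then show False using v_pos[OF x(1)] by simp
  qed
  have "\<delta> \<le> v x" if "0 \<le> x" for x
  proof -
    have "v 0 \<le> v x"
    proof (rule DERIV_nonneg_imp_increasing_open[OF that])
      fix t assume t: "0 < t" "t < x"
      then have "z t / p t \<ge> 0" using z_nonneg[of t] p_pos[of t] by simp
      then show "\<exists>y. (v has_real_derivative y) (at t) \<and> y \<ge> 0" using is_solD(3)[OF vz t(1)] by blast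
    next
      show "continuous_on {0..x} v" using vc(1) by (rule continuous_on_subset) auto
    qed
    then show ?thesis using uw gh by (simp add: v_def)
  qed
  then show thesis by (rule that[OF vz \<delta>])
qed

end

section \<open>Dynkin's formula on decreasing events\<close>

text \<open>A Gronwall argument for functions that may jump downwards, as expectations over
  decreasing events do. The one-sided Lipschitz bound rules out upward jumps, and
  \<open>dini\<close> bounds the upper right derivative by \<open>- l * k\<close>. The comparison
  holds up to a maximal time, which neither condition allows to be smaller than
  \<open>T\<close>.\<close>

lemma dini_decay:
  fixes k :: "real \<Rightarrow> real"
  assumes lip: "\<And>s t. 0 \<le> s \<Longrightarrow> s \<le> t \<Longrightarrow> k t - k s \<le> C * (t - s)"
    and dini: "\<And>s e. 0 \<le> s \<Longrightarrow> 0 < e \<Longrightarrow> \<forall>\<^sub>F h in at_right 0. k (s + h) - k s \<le> h * (- l * k s + e)"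
    and T: "0 \<le> T"
  shows "k T \<le> exp (- l * T) * k 0"
proof -
  have main: "k T \<le> exp (- l * T) * (k 0 + \<epsilon> * T)" if \<epsilon>: "\<epsilon> > 0" for \<epsilon>
  proof -
    \<comment> \<open>The term \<open>\<epsilon> * t\<close> makes the comparison function a strict
      supersolution, so it can be continued past a point of contact; \<open>\<epsilon>\<close> tends
      to 0 at the end.\<close>
    define y where "y t = exp (- l * t) * (k 0 + \<epsilon> * t)" for t
    have y': "(y has_real_derivative - l * y t + \<epsilon> * exp (- l * t)) (at t)" for t
      unfolding y_def[abs_def] by (auto intro!: derivative_eq_intros simp: algebra_simps)
    define S where "S = {t \<in> {0..T}. \<forall>r\<in>{0..t}. k r \<le> y r}"
    have S0: "0 \<in> S" using T by (simp add: S_def y_def)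
    have bdd: "bdd_above S" by (auto simp: S_def intro!: bdd_aboveI[of _ T])
    define s where "s = Sup S"
    have s0: "0 \<le> s" unfolding s_def using S0 bdd by (rule cSup_upper)
    have sT: "s \<le> T" unfolding s_def using S0 by (intro cSup_least) (auto simp: S_def)
    have below: "k r \<le> y r" if r: "0 \<le> r" "r < s" for r
    proof -
      have "\<exists>t\<in>S. r < t" using less_cSupD[of S r] r S0 unfolding s_def by blast
      then show ?thesis using r by (auto simp: S_def)
    qed
    have ks: "k s \<le> y s"
    proof (cases "s = 0")
      case True then show ?thesis using S0 by (simp add: S_def)
    next
      case False
      then have sp: "0 < s" using s0 by simp
      have "isCont y s" using y' by (rule DERIV_isCont)
      then have lim: "((\<lambda>r. y r + C * (s - r)) \<longlongrightarrow> y s + C * (s - s)) (at_left s)"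
        by (intro tendsto_intros) (simp add: isCont_def filterlim_at_split)
      have ev: "\<forall>\<^sub>F r in at_left s. k s \<le> y r + C * (s - r)"
      proof (rule eventually_at_leftI[OF _ sp])
        fix r assume "r \<in> {0<..<s}"
        then show "k s \<le> y r + C * (s - r)" using lip[of r s] below[of r] by simp
      qed
      have "k s \<le> y s + C * (s - s)" by (rule tendsto_lowerbound[OF lim ev]) simp
      then show ?thesis by simp
    qed
    have "s = T"
    proof (rule ccontr)
      assume "s \<noteq> T"
      then have sT': "s < T" using sT by simp
      define e where "e = \<epsilon> * exp (- l * s) / 2"
      have e: "e > 0" using \<epsilon> by (simp add: e_def)
      have "((\<lambda>h. (y (s + h) - y s) / h) \<longlongrightarrow> - l * y s + \<epsilon> * exp (- l * s)) (at_right 0)"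
        using DERIV_D[OF y'[of s]] by (simp add: filterlim_at_split)
      then have "\<forall>\<^sub>F h in at_right 0. - l * y s + e < (y (s + h) - y s) / h"
        by (rule order_tendstoD) (use e in \<open>simp add: e_def\<close>)
      moreover have "\<forall>\<^sub>F h in at_right 0. (0::real) < h" by (simp add: eventually_at_right_less)
      moreover have "\<forall>\<^sub>F h in at_right (0::real). h < T - s" using sT' by (intro eventually_at_right_real[THEN eventually_mono]) auto
      \<comment> \<open>Keeps the factor \<open>1 - l * h\<close> positive, so that the inequality
        \<open>k s \<le> y s\<close> survives one small time step.\<close>
      moreover have "\<forall>\<^sub>F h in at_right (0::real). l * h < 1"
      proof -
        have "((\<lambda>h. l * h) \<longlongrightarrow> l * 0) (at_right 0)" by (intro tendsto_intros)
        then show ?thesis by (rule order_tendstoD) simp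
      qed
      moreover note dini[OF s0 e]
      ultimately have "\<forall>\<^sub>F h in at_right 0. k (s + h) \<le> y (s + h) \<and> h < T - s"
      proof eventually_elim
        case (elim h)
        have "h * (- l * y s + e) < y (s + h) - y s"
          using elim(1,2) by (simp add: pos_less_divide_eq mult.commute)
        moreover have "(y s - k s) * (1 - l * h) \<ge> 0" using ks elim by (intro mult_nonneg_nonneg) auto
        moreover have "(y s - k s) * (1 - l * h) = y s - k s + h * (- l * y s + e) - h * (- l * k s + e)"
          by (simp add: algebra_simps)
        ultimately show ?case using elim by linarith
      qed
      then obtain \<delta> where \<delta>: "\<delta> > 0" "\<And>h. 0 < h \<Longrightarrow> h < \<delta> \<Longrightarrow> k (s + h) \<le> y (s + h) \<and> h < T - s"
        unfolding eventually_at_right_field by auto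
      have "s + \<delta> / 2 \<in> S"
        unfolding S_def
      proof (intro CollectI conjI ballI)
        show "s + \<delta> / 2 \<in> {0..T}" using \<delta>(2)[of "\<delta>/2"] \<delta>(1) s0 by auto
        fix r assume r: "r \<in> {0..s + \<delta> / 2}"
        show "k r \<le> y r"
          using below[of r] ks \<delta>(2)[of "r - s"] \<delta>(1) r by (cases r s rule: linorder_cases) auto
      qed
      then have "s + \<delta> / 2 \<le> s" unfolding s_def using bdd by (rule cSup_upper)
      then show False using \<delta>(1) by simp
    qed
    then show ?thesis using ks by (simp add: y_def)
  qed
  have lim: "((\<lambda>\<epsilon>. exp (- l * T) * (k 0 + \<epsilon> * T)) \<longlongrightarrow> exp (- l * T) * (k 0 + 0 * T)) (at_right 0)"
    by (intro tendsto_intros)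
  have "k T \<le> exp (- l * T) * (k 0 + 0 * T)"
    by (rule tendsto_lowerbound[OF lim]) (use main in \<open>auto intro!: eventually_at_rightI[of 0 1]\<close>)
  then show ?thesis by simp
qed

section \<open>The martingale problem in integrated form\<close>

lemma natural_filtration_subalgebra:
  assumes "\<And>t. 0 \<le> t \<Longrightarrow> X t \<in> borel_measurable M"
  shows "subalgebra M (natural_filtration M X s)"
proof -
  have "sets (natural_filtration M X s) =
      sigma_sets (space M) {X r -` A \<inter> space M | r A. 0 \<le> r \<and> r \<le> s \<and> A \<in> sets borel}"
    unfolding natural_filtration_def by (rule sets_measure_of) auto
  also have "\<dots> \<subseteq> sets M"
    by (rule sets.sigma_sets_subset) (use assms in \<open>auto intro: measurable_sets\<close>)
  finally show ?thesis by (simp add: subalgebra_def natural_filtration_def space_measure_of_conv)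
qed

lemma natural_filtration_sets:
  assumes "0 \<le> r" "r \<le> s" "A \<in> sets borel"
  shows "{\<omega> \<in> space M. X r \<omega> \<in> A} \<in> sets (natural_filtration M X s)"
proof -
  have "sets (natural_filtration M X s) =
      sigma_sets (space M) {X r -` A \<inter> space M | r A. 0 \<le> r \<and> r \<le> s \<and> A \<in> sets borel}"
    unfolding natural_filtration_def by (rule sets_measure_of) auto
  moreover have "{\<omega> \<in> space M. X r \<omega> \<in> A} = X r -` A \<inter> space M" by auto
  ultimately show ?thesis using assms by (auto intro!: sigma_sets.Basic)
qed

text \<open>\<open>G\<close> will be \<open>generator a b f\<close>. The estimates see it only as a
  bounded continuous function whose time integral compensates \<open>f (X t)\<close> to a
  martingale.\<close>

locale Dynkin_path = prob_space M for M :: "'w measure" +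
  fixes X :: "real \<Rightarrow> 'w \<Rightarrow> real" and f G :: "real \<Rightarrow> real" and Cf CG :: real
  assumes X_meas: "0 \<le> t \<Longrightarrow> X t \<in> borel_measurable M"
    and X_cont: "\<omega> \<in> space M \<Longrightarrow> continuous_on {0..} (\<lambda>t. X t \<omega>)"
    and f_cont: "continuous_on UNIV f" and f_bound: "\<bar>f y\<bar> \<le> Cf"
    and G_cont: "continuous_on UNIV G" and G_bound: "\<bar>G y\<bar> \<le> CG"
    and martingale: "is_martingale M (natural_filtration M X)
      (\<lambda>t \<omega>. f (X t \<omega>) - f (X 0 \<omega>) - integral {0..t} (\<lambda>s. G (X s \<omega>)))"
begin

abbreviation "F \<equiv> natural_filtration M X"

lemma f_meas: "f \<in> borel_measurable borel" using f_cont by (rule borel_measurable_continuous_onI)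

lemma G_meas: "G \<in> borel_measurable borel" using G_cont by (rule borel_measurable_continuous_onI)

lemma fX_int: assumes "0 \<le> t" shows "integrable M (\<lambda>\<omega>. f (X t \<omega>))"
  by (rule integrable_const_bound[of _ Cf]) (use f_bound measurable_compose[OF X_meas[OF assms] f_meas] in auto)

lemma GX_int: assumes "0 \<le> t" shows "integrable M (\<lambda>\<omega>. G (X t \<omega>))"
  by (rule integrable_const_bound[of _ CG]) (use G_bound measurable_compose[OF X_meas[OF assms] G_meas] in auto)

lemma GX_cont:
  assumes "\<omega> \<in> space M" "0 \<le> s"
  shows "continuous_on {s..t} (\<lambda>r. G (X r \<omega>))"
  by (rule continuous_on_compose2[OF G_cont continuous_on_subset[OF X_cont[OF assms(1)]]]) (use assms in auto)

definition incr :: "real \<Rightarrow> real \<Rightarrow> 'w \<Rightarrow> real" where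
  "incr s t \<omega> = integral {s..t} (\<lambda>r. G (X r \<omega>))"

lemma incr_bound:
  assumes "\<omega> \<in> space M" "0 \<le> s" "s \<le> t"
  shows "\<bar>incr s t \<omega>\<bar> \<le> CG * (t - s)"
proof -
  have "norm (integral {s..t} (\<lambda>r. G (X r \<omega>))) \<le> CG * (t - s)"
    by (rule integral_bound[OF assms(3) GX_cont[OF assms(1,2)]]) (use G_bound in auto)
  then show ?thesis by (simp add: incr_def)
qed

definition Y :: "real \<Rightarrow> 'w \<Rightarrow> real" where
  "Y t \<omega> = f (X t \<omega>) - f (X 0 \<omega>) - integral {0..t} (\<lambda>s. G (X s \<omega>))"

lemma incr_Y:
  assumes "\<omega> \<in> space M" "0 \<le> s" "s \<le> t"
  shows "incr s t \<omega> = f (X t \<omega>) - f (X s \<omega>) - (Y t \<omega> - Y s \<omega>)"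
proof -
  have "integral {0..s} (\<lambda>r. G (X r \<omega>)) + integral {s..t} (\<lambda>r. G (X r \<omega>)) = integral {0..t} (\<lambda>r. G (X r \<omega>))"
    by (rule Henstock_Kurzweil_Integration.integral_combine[OF assms(2,3)])
      (rule integrable_continuous_interval, rule GX_cont[OF assms(1)], simp)
  then show ?thesis by (simp add: incr_def Y_def)
qed

lemma Y_int: "0 \<le> t \<Longrightarrow> integrable M (Y t)"
  using martingale unfolding is_martingale_def Y_def[abs_def] by blast

text \<open>The time integral is expressed through \<open>Y\<close>, whose integrability is part of
  the martingale property; joint measurability of the process in time and path does not
  enter.\<close>

lemma incr_int: assumes "0 \<le> s" "s \<le> t" shows "integrable M (incr s t)"
proof -
  have "integrable M (\<lambda>\<omega>. f (X t \<omega>) - f (X s \<omega>) - (Y t \<omega> - Y s \<omega>))"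
    using assms by (intro Bochner_Integration.integrable_diff fX_int Y_int) auto
  moreover have "integrable M (incr s t) \<longleftrightarrow> integrable M (\<lambda>\<omega>. f (X t \<omega>) - f (X s \<omega>) - (Y t \<omega> - Y s \<omega>))"
    by (rule Bochner_Integration.integrable_cong[OF refl]) (rule incr_Y[OF _ assms])
  ultimately show ?thesis by simp
qed

lemma sub: "subalgebra M (F s)" by (rule natural_filtration_subalgebra[OF X_meas])

lemma F_sets: "A \<in> sets (F s) \<Longrightarrow> A \<in> sets M" using sub by (auto simp: subalgebra_def)

lemma Y_martingale:
  assumes "0 \<le> s" "s \<le> t" "A \<in> sets (F s)"
  shows "(\<integral>\<omega>. indicator A \<omega> * Y t \<omega> \<partial>M) = (\<integral>\<omega>. indicator A \<omega> * Y s \<omega> \<partial>M)"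
proof -
  interpret S: finite_measure_subalgebra M "F s" by unfold_locales (rule sub)
  have AE: "AE \<omega> in M. real_cond_exp M (F s) (Y t) \<omega> = Y s \<omega>"
    using martingale assms unfolding is_martingale_def Y_def[abs_def] by blast
  have "(\<integral>\<omega>\<in>A. Y t \<omega> \<partial>M) = (\<integral>\<omega>\<in>A. real_cond_exp M (F s) (Y t) \<omega> \<partial>M)"
    by (rule S.real_cond_exp_intA) (use Y_int assms in auto)
  also have "\<dots> = (\<integral>\<omega>\<in>A. Y s \<omega> \<partial>M)"
    unfolding set_lebesgue_integral_def
  proof (rule integral_cong_AE)
    show "AE \<omega> in M. indicator A \<omega> *\<^sub>R real_cond_exp M (F s) (Y t) \<omega> = indicator A \<omega> *\<^sub>R Y s \<omega>"
      using AE by eventually_elim simp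
  qed (use F_sets[OF assms(3)] Y_int[OF assms(1)] in auto)
  finally show ?thesis by (simp add: set_lebesgue_integral_def)
qed

text \<open>Dynkin's formula on an event known at time \<open>s\<close>: the martingale difference
  integrates to 0 over it, which leaves the time integral of \<open>G\<close>.\<close>

lemma increment:
  assumes "0 \<le> s" "s \<le> t" "A \<in> sets (F s)"
  shows "(\<integral>\<omega>. indicator A \<omega> * f (X t \<omega>) \<partial>M) - (\<integral>\<omega>. indicator A \<omega> * f (X s \<omega>) \<partial>M)
    = (\<integral>\<omega>. indicator A \<omega> * incr s t \<omega> \<partial>M)"
proof -
  have A: "A \<in> sets M" by (rule F_sets[OF assms(3)])
  have t: "0 \<le> t" using assms by simp
  have "(\<integral>\<omega>. indicator A \<omega> * incr s t \<omega> \<partial>M) =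
      (\<integral>\<omega>. indicator A \<omega> * f (X t \<omega>) - indicator A \<omega> * f (X s \<omega>) -
        (indicator A \<omega> * Y t \<omega> - indicator A \<omega> * Y s \<omega>) \<partial>M)"
    by (rule Bochner_Integration.integral_cong[OF refl]) (simp add: incr_Y assms algebra_simps)
  also have "\<dots> = (\<integral>\<omega>. indicator A \<omega> * f (X t \<omega>) \<partial>M) - (\<integral>\<omega>. indicator A \<omega> * f (X s \<omega>) \<partial>M) -
      ((\<integral>\<omega>. indicator A \<omega> * Y t \<omega> \<partial>M) - (\<integral>\<omega>. indicator A \<omega> * Y s \<omega> \<partial>M))"
    using integrable_real_mult_indicator[OF A fX_int[OF t]] integrable_real_mult_indicator[OF A fX_int[OF assms(1)]]
      integrable_real_mult_indicator[OF A Y_int[OF t]] integrable_real_mult_indicator[OF A Y_int[OF assms(1)]]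
    by (simp add: mult.commute)
  finally show ?thesis using Y_martingale[OF assms] by simp
qed

lemma increment_bound:
  assumes "0 \<le> s" "s \<le> t" "A \<in> sets (F s)"
  shows "\<bar>(\<integral>\<omega>. indicator A \<omega> * f (X t \<omega>) \<partial>M) - (\<integral>\<omega>. indicator A \<omega> * f (X s \<omega>) \<partial>M)\<bar> \<le> CG * (t - s)"
proof -
  have A: "A \<in> sets M" by (rule F_sets[OF assms(3)])
  have c: "0 \<le> CG * (t - s)" using G_bound[of 0] assms by simp
  have int: "integrable M (\<lambda>\<omega>. indicator A \<omega> * incr s t \<omega>)"
    using integrable_real_mult_indicator[OF A incr_int[OF assms(1,2)]] by (simp add: mult.commute)
  have "norm (\<integral>\<omega>. indicator A \<omega> * incr s t \<omega> \<partial>M) \<le> (\<integral>\<omega>. norm (indicator A \<omega> * incr s t \<omega>) \<partial>M)"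
    by (rule integral_norm_bound)
  also have "\<dots> \<le> (\<integral>\<omega>. CG * (t - s) \<partial>M)"
  proof (rule integral_mono[OF integrable_norm[OF int]])
    show "norm (indicator A \<omega> * incr s t \<omega>) \<le> CG * (t - s)" if "\<omega> \<in> space M" for \<omega>
      using incr_bound[OF that assms(1,2)] c by (simp add: indicator_def)
  qed simp
  finally have "norm (\<integral>\<omega>. indicator A \<omega> * incr s t \<omega> \<partial>M) \<le> (\<integral>\<omega>. CG * (t - s) \<partial>M)" .
  then show ?thesis using increment[OF assms] by (simp add: prob_space)
qed

lemma incr_limit:
  assumes \<omega>: "\<omega> \<in> space M" and s: "0 \<le> s" and h: "\<And>n. 0 < h n" "\<And>n. h n < (1::real)" "h \<longlonglongrightarrow> 0"
  shows "(\<lambda>n. incr s (s + h n) \<omega> / h n) \<longlonglongrightarrow> G (X s \<omega>)"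
proof -
  have "((\<lambda>x. integral {s..x} (\<lambda>r. G (X r \<omega>))) has_real_derivative G (X s \<omega>)) (at s within {s..s+1})"
    by (rule integral_has_real_derivative[OF GX_cont[OF \<omega> s]]) simp
  then have lim: "((\<lambda>y. (integral {s..y} (\<lambda>r. G (X r \<omega>)) - integral {s..s} (\<lambda>r. G (X r \<omega>))) / (y - s))
      \<longlongrightarrow> G (X s \<omega>)) (at s within {s..s+1})"
    by (simp add: has_field_derivative_iff)
  have "(\<lambda>n. s + h n) \<longlonglongrightarrow> s + 0" by (intro tendsto_intros h)
  then have "filterlim (\<lambda>n. s + h n) (at s within {s..s+1}) sequentially"
    using h(1,2) by (auto simp: filterlim_at less_imp_le less_imp_neq[symmetric])
  from filterlim_compose[OF lim this] show ?thesis by (simp add: incr_def)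
qed

text \<open>The right derivative of the expectation: the averages of \<open>G\<close> along the path
  converge by continuity and are bounded by \<open>CG\<close>, so dominated convergence
  applies.\<close>

lemma increment_limit:
  assumes s: "0 \<le> s" and A: "A \<in> sets (F s)"
  shows "((\<lambda>h. ((\<integral>\<omega>. indicator A \<omega> * f (X (s + h) \<omega>) \<partial>M) - (\<integral>\<omega>. indicator A \<omega> * f (X s \<omega>) \<partial>M)) / h)
    \<longlongrightarrow> (\<integral>\<omega>. indicator A \<omega> * G (X s \<omega>) \<partial>M)) (at_right 0)"
proof (rule tendsto_at_right_sequentially[of 0 1])
  fix h :: "nat \<Rightarrow> real" assume h: "\<And>n. 0 < h n" "\<And>n. h n < 1" "h \<longlonglongrightarrow> 0"
  have AM: "A \<in> sets M" by (rule F_sets[OF A])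
  have eq: "((\<integral>\<omega>. indicator A \<omega> * f (X (s + h n) \<omega>) \<partial>M) - (\<integral>\<omega>. indicator A \<omega> * f (X s \<omega>) \<partial>M)) / h n =
      (\<integral>\<omega>. indicator A \<omega> * (incr s (s + h n) \<omega> / h n) \<partial>M)" for n
    using increment[OF s, of "s + h n" A] h(1)[of n] A by (simp add: less_imp_le)
  have "(\<lambda>n. \<integral>\<omega>. indicator A \<omega> * (incr s (s + h n) \<omega> / h n) \<partial>M) \<longlonglongrightarrow>
      (\<integral>\<omega>. indicator A \<omega> * G (X s \<omega>) \<partial>M)"
  proof (rule integral_dominated_convergence[where w = "\<lambda>_. CG"])
    show "(\<lambda>\<omega>. indicator A \<omega> * G (X s \<omega>)) \<in> borel_measurable M"
      using AM GX_int[OF s] by simp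
    show "(\<lambda>\<omega>. indicator A \<omega> * (incr s (s + h n) \<omega> / h n)) \<in> borel_measurable M" for n
      using AM incr_int[OF s, of "s + h n"] h(1)[of n] by (simp add: less_imp_le)
    show "AE \<omega> in M. (\<lambda>n. indicator A \<omega> * (incr s (s + h n) \<omega> / h n)) \<longlonglongrightarrow> indicator A \<omega> * G (X s \<omega>)"
      using incr_limit[OF _ s h] by (intro AE_I2 tendsto_mult_left)
    show "AE \<omega> in M. norm (indicator A \<omega> * (incr s (s + h n) \<omega> / h n)) \<le> CG" for n
    proof (rule AE_I2)
      fix \<omega> assume "\<omega> \<in> space M"
      then have "\<bar>incr s (s + h n) \<omega>\<bar> \<le> CG * h n"
        using incr_bound[OF _ s, of \<omega> "s + h n"] h(1)[of n] by simp
      then have "\<bar>incr s (s + h n) \<omega> / h n\<bar> \<le> CG" using h(1)[of n] by (simp add: abs_divide pos_divide_le_eq)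
      moreover have "0 \<le> CG" using G_bound[of 0] by simp
      ultimately show "norm (indicator A \<omega> * (incr s (s + h n) \<omega> / h n)) \<le> CG"
        by (simp add: indicator_def)
    qed
  qed simp
  then show "(\<lambda>n. ((\<integral>\<omega>. indicator A \<omega> * f (X (s + h n) \<omega>) \<partial>M) - (\<integral>\<omega>. indicator A \<omega> * f (X s \<omega>) \<partial>M)) / h n)
      \<longlonglongrightarrow> (\<integral>\<omega>. indicator A \<omega> * G (X s \<omega>) \<partial>M)"
    by (simp only: eq)
qed simp

text \<open>
  As \<open>f\<close> is nonnegative and \<open>A\<close> decreasing, replacing \<open>A (s + h)\<close> by the \<open>F s\<close>-measurable \<open>A s\<close> only increases
  \<open>E(f(X\<^sub>s\<^sub>+\<^sub>h); A (s + h))\<close>. This takes the place of optional stopping.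
\<close>

lemma killed_decay:
  assumes f0: "\<And>y. 0 \<le> f y"
    and A: "\<And>s. 0 \<le> s \<Longrightarrow> A s \<in> sets (F s)" "\<And>s t. 0 \<le> s \<Longrightarrow> s \<le> t \<Longrightarrow> A t \<subseteq> A s"
    and G_le: "\<And>s \<omega>. 0 \<le> s \<Longrightarrow> \<omega> \<in> A s \<Longrightarrow> G (X s \<omega>) \<le> - l * f (X s \<omega>)"
    and T: "0 \<le> T"
  shows "(\<integral>\<omega>. indicator (A T) \<omega> * f (X T \<omega>) \<partial>M) \<le> exp (- l * T) * (\<integral>\<omega>. indicator (A 0) \<omega> * f (X 0 \<omega>) \<partial>M)"
proof -
  define k where "k s = (\<integral>\<omega>. indicator (A s) \<omega> * f (X s \<omega>) \<partial>M)" for s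
  have AM: "A s \<in> sets M" if "0 \<le> s" for s by (rule F_sets[OF A(1)[OF that]])
  have int: "integrable M (\<lambda>\<omega>. indicator (A s) \<omega> * f (X t \<omega>))" if "0 \<le> s" "0 \<le> t" for s t
    using integrable_real_mult_indicator[OF AM[OF that(1)] fX_int[OF that(2)]] by (simp add: mult.commute)
  have mono: "k t \<le> (\<integral>\<omega>. indicator (A s) \<omega> * f (X t \<omega>) \<partial>M)" if st: "0 \<le> s" "s \<le> t" for s t
    unfolding k_def
    using A(2)[OF st] f0 st by (intro integral_mono int) (auto simp: indicator_def)
  have "k T \<le> exp (- l * T) * k 0"
  proof (rule dini_decay[OF _ _ T])
    fix s t :: real assume st: "0 \<le> s" "s \<le> t"
    show "k t - k s \<le> CG * (t - s)"
      using mono[OF st] increment_bound[OF st A(1)[OF st(1)]] unfolding k_def[of s] by linarith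
  next
    fix s e :: real assume s: "0 \<le> s" and e: "0 < e"
    have "(\<integral>\<omega>. indicator (A s) \<omega> * G (X s \<omega>) \<partial>M) \<le> (\<integral>\<omega>. - l * (indicator (A s) \<omega> * f (X s \<omega>)) \<partial>M)"
    proof (rule integral_mono)
      show "integrable M (\<lambda>\<omega>. indicator (A s) \<omega> * G (X s \<omega>))"
        using integrable_real_mult_indicator[OF AM[OF s] GX_int[OF s]] by (simp add: mult.commute)
      show "integrable M (\<lambda>\<omega>. - l * (indicator (A s) \<omega> * f (X s \<omega>)))"
        by (intro Bochner_Integration.integrable_mult_right int s)
      show "indicator (A s) \<omega> * G (X s \<omega>) \<le> - l * (indicator (A s) \<omega> * f (X s \<omega>))" for \<omega>
        using G_le[OF s, of \<omega>] by (auto simp: indicator_def)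
    qed
    also have "\<dots> = - l * k s" unfolding k_def by simp
    also have "\<dots> < - l * k s + e" using e by simp
    finally have "\<forall>\<^sub>F h in at_right 0. ((\<integral>\<omega>. indicator (A s) \<omega> * f (X (s + h) \<omega>) \<partial>M) - k s) / h < - l * k s + e"
      unfolding k_def[of s] by (intro order_tendstoD[OF increment_limit[OF s A(1)[OF s]]])
    moreover have "\<forall>\<^sub>F h in at_right 0. (0::real) < h" by (simp add: eventually_at_right_less)
    ultimately show "\<forall>\<^sub>F h in at_right 0. k (s + h) - k s \<le> h * (- l * k s + e)"
    proof eventually_elim
      case (elim h)
      then have "(\<integral>\<omega>. indicator (A s) \<omega> * f (X (s + h) \<omega>) \<partial>M) - k s < (- l * k s + e) * h"
        by (simp only: pos_divide_less_eq)
      then show ?case using mono[OF s, of "s + h"] elim by (simp add: mult.commute)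
    qed
  qed
  then show ?thesis by (simp add: k_def)
qed

text \<open>Applied to minus the expectation, the decay estimate becomes a lower bound; the
  inequality for \<open>G\<close> holds everywhere, so the event is the whole space. The initial
  time \<open>q\<close> is free because the expectation at time 0 may vanish.\<close>

lemma growth:
  assumes G_ge: "\<And>y. - l * f y \<le> G y" and q: "0 \<le> q" and T: "0 \<le> T"
  shows "exp (- l * T) * (\<integral>\<omega>. f (X q \<omega>) \<partial>M) \<le> (\<integral>\<omega>. f (X (q + T) \<omega>) \<partial>M)"
proof -
  define k where "k t = - (\<integral>\<omega>. indicator (space M) \<omega> * f (X (q + t) \<omega>) \<partial>M)" for t
  have full: "space M \<in> sets (F s)" for s
    using sets.top[of "F s"] sub[of s] unfolding subalgebra_def by metis
  have k: "k t = - (\<integral>\<omega>. f (X (q + t) \<omega>) \<partial>M)" for t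
    unfolding k_def by (intro arg_cong[where f = uminus] Bochner_Integration.integral_cong) auto
  have "k T \<le> exp (- l * T) * k 0"
  proof (rule dini_decay[OF _ _ T])
    fix s t :: real assume st: "0 \<le> s" "s \<le> t"
    show "k t - k s \<le> CG * (t - s)"
      using increment_bound[OF _ _ full, of "q + s" "q + t"] st q unfolding k_def by simp
  next
    fix s e :: real assume s: "0 \<le> s" and e: "0 < e"
    have qs: "0 \<le> q + s" using q s by simp
    have "(\<integral>\<omega>. - l * f (X (q + s) \<omega>) \<partial>M) \<le> (\<integral>\<omega>. G (X (q + s) \<omega>) \<partial>M)"
      by (intro integral_mono Bochner_Integration.integrable_mult_right fX_int GX_int qs G_ge)
    then have "l * k s \<le> (\<integral>\<omega>. G (X (q + s) \<omega>) \<partial>M)" by (simp add: k)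
    also have "\<dots> = (\<integral>\<omega>. indicator (space M) \<omega> * G (X (q + s) \<omega>) \<partial>M)"
      by (intro Bochner_Integration.integral_cong) auto
    finally have "l * k s - e < (\<integral>\<omega>. indicator (space M) \<omega> * G (X (q + s) \<omega>) \<partial>M)" using e by simp
    then have "\<forall>\<^sub>F h in at_right 0. l * k s - e < ((\<integral>\<omega>. indicator (space M) \<omega> * f (X (q + s + h) \<omega>) \<partial>M) -
        (\<integral>\<omega>. indicator (space M) \<omega> * f (X (q + s) \<omega>) \<partial>M)) / h"
      by (rule order_tendstoD(1)[OF increment_limit[OF qs full]])
    moreover have "\<forall>\<^sub>F h in at_right 0. (0::real) < h" by (simp add: eventually_at_right_less)
    ultimately show "\<forall>\<^sub>F h in at_right 0. k (s + h) - k s \<le> h * (- l * k s + e)"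
    proof eventually_elim
      case (elim h)
      then have "(l * k s - e) * h < (\<integral>\<omega>. indicator (space M) \<omega> * f (X (q + s + h) \<omega>) \<partial>M) -
        (\<integral>\<omega>. indicator (space M) \<omega> * f (X (q + s) \<omega>) \<partial>M)"
        by (simp only: pos_less_divide_eq)
      then have "(l * k s - e) * h < k s - k (s + h)" unfolding k_def by (simp add: add.assoc)
      then show ?case by (simp add: algebra_simps)
    qed
  qed
  then show ?thesis by (simp add: k)
qed

end

section \<open>Cutoffs and the bottom of the form\<close>

text \<open>On \<open>[0, 1]\<close> this is \<open>1 - (1 - s^3)^3\<close>: the inner cube flattens
  it to second order at 0, the outer one at 1, so it joins the constants 0 and 1 with two continuous
  derivatives.\<close>

definition step :: "real \<Rightarrow> real" where
  "step s = 1 - (max 0 (1 - (max 0 s) ^ 3)) ^ 3"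
definition step1 :: "real \<Rightarrow> real" where
  "step1 s = 9 * (max 0 (1 - (max 0 s) ^ 3))\<^sup>2 * (max 0 s)\<^sup>2"
definition step2 :: "real \<Rightarrow> real" where
  "step2 s = - 54 * max 0 (1 - (max 0 s) ^ 3) * (max 0 s)\<^sup>2 * (max 0 s)\<^sup>2
    + 18 * (max 0 (1 - (max 0 s) ^ 3))\<^sup>2 * max 0 s"

lemma step_deriv:
  "(step has_real_derivative step1 s) (at s)" "(step1 has_real_derivative step2 s) (at s)"
proof -
  have i: "((\<lambda>s. 1 - (max 0 s) ^ 3) has_real_derivative - (3 * (max 0 s)\<^sup>2)) (at s)"
    using DERIV_diff[OF DERIV_const[of 1] max0_cube_deriv[of s]] by simp
  have c: "((\<lambda>s. (max 0 (1 - (max 0 s) ^ 3)) ^ 3) has_real_derivative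
      3 * (max 0 (1 - (max 0 s) ^ 3))\<^sup>2 * - (3 * (max 0 s)\<^sup>2)) (at s)"
    by (rule DERIV_chain2[OF max0_cube_deriv i])
  have q: "((\<lambda>s. (max 0 (1 - (max 0 s) ^ 3))\<^sup>2) has_real_derivative
      2 * max 0 (1 - (max 0 s) ^ 3) * - (3 * (max 0 s)\<^sup>2)) (at s)"
    by (rule DERIV_chain2[OF max0_square_deriv i])
  show "(step has_real_derivative step1 s) (at s)"
    unfolding step_def[abs_def] step1_def
    by (rule DERIV_cong[OF DERIV_diff[OF DERIV_const[of 1] c]]) simp
  show "(step1 has_real_derivative step2 s) (at s)"
    unfolding step1_def[abs_def] step2_def
    by (rule DERIV_cong[OF DERIV_mult[OF DERIV_cmult[OF q, of 9] max0_square_deriv[of s]]])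
      (simp add: algebra_simps)
qed

lemma step_cont: "continuous_on S step" "continuous_on S step1" "continuous_on S step2"
  unfolding step_def[abs_def] step1_def[abs_def] step2_def[abs_def] by (intro continuous_intros)+

lemma step_vals: "s \<le> 0 \<Longrightarrow> step s = 0" "1 \<le> s \<Longrightarrow> step s = 1" "1 \<le> s \<Longrightarrow> step1 s = 0" "1 \<le> s \<Longrightarrow> step2 s = 0"
proof -
  show "s \<le> 0 \<Longrightarrow> step s = 0" by (simp add: step_def max_def)
  assume "1 \<le> s"
  then have "1 \<le> s ^ 3" "max 0 s = s" by (auto intro: one_le_power)
  then have "max 0 (1 - (max 0 s) ^ 3) = 0" by simp
  then show "step s = 1" "step1 s = 0" "step2 s = 0" by (simp_all add: step_def step1_def step2_def)
qed

lemma step_nonneg: "0 \<le> step s"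
proof -
  have "max 0 (1 - (max 0 s) ^ 3) \<le> 1" by simp
  then have "(max 0 (1 - (max 0 s) ^ 3)) ^ 3 \<le> 1" by (intro power_le_one) auto
  then show ?thesis by (simp add: step_def)
qed

lemma exp_ereal_mono: "r \<le> s \<Longrightarrow> exp_ereal r \<le> exp_ereal s"
  by (cases r; cases s) (auto simp: exp_ereal_def ennreal_leI)

lemma bounded_of_compact_support:
  fixes g :: "real \<Rightarrow> real"
  assumes "continuous_on UNIV g" "compact K" "\<And>x. x \<notin> K \<Longrightarrow> g x = 0"
  obtains C where "\<And>x. \<bar>g x\<bar> \<le> C"
proof -
  have "bounded (g ` K)"
    by (intro compact_imp_bounded compact_continuous_image continuous_on_subset[OF assms(1)] assms(2)) auto
  then obtain C where C: "\<forall>y\<in>g ` K. norm y \<le> C" by (auto simp: bounded_iff)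
  have "\<bar>g x\<bar> \<le> max C 0" for x
    using C assms(3)[of x] by (cases "x \<in> K") (auto simp: le_max_iff_disj)
  then show thesis by (rule that)
qed

context diffusion_coeffs
begin

text \<open>Left of 0 the coefficients are arbitrary, but the derivatives of \<open>f\<close> vanish
  there. Continuity is proved on the open half-line and off the support separately.\<close>

lemma C2_0_generator:
  assumes f: "f \<in> C2_0"
  obtains Cf CG where "continuous_on UNIV f" "\<And>y. \<bar>f y\<bar> \<le> Cf"
    "continuous_on UNIV (generator a b f)" "\<And>y. \<bar>generator a b f y\<bar> \<le> CG"
proof -
  obtain K where K: "compact K" "K \<subseteq> {0<..}" "\<And>x. x \<notin> K \<Longrightarrow> f x = 0"
    using f by (auto simp: C2_0_def compactly_supported_in_def)
  have oK: "open (- K)" using K(1) by (simp add: compact_imp_closed open_Compl)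
  note D = C2_0_D[OF f]
  have z1: "deriv f x = 0" if "x \<notin> K" for x
    using has_field_derivative_transform_within_open[OF DERIV_const[of 0] oK, of x f] that K(3)
    by (intro DERIV_imp_deriv) auto
  have z2: "deriv (deriv f) x = 0" if "x \<notin> K" for x
    using has_field_derivative_transform_within_open[OF DERIV_const[of 0] oK, of x "deriv f"] that z1
    by (intro DERIV_imp_deriv) auto
  have gz: "generator a b f x = 0" if "x \<notin> K" for x using z1[OF that] z2[OF that] by (simp add: generator_def)
  have sub: "{0<..} \<subseteq> {0::real..}" by auto
  have "continuous_on {0<..} (\<lambda>x. 1/2 * a x * deriv (deriv f) x + (1/2 * a' x + b x) * deriv f x)"
    by (intro continuous_intros D continuous_on_subset[OF a_cont sub] continuous_on_subset[OF a'_cont sub]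
        continuous_on_subset[OF b_cont sub])
  then have "continuous_on {0<..} (generator a b f)"
    by (rule continuous_on_eq) (simp add: generator_def deriv_a)
  moreover have "continuous_on (- K) (generator a b f)"
    by (rule continuous_on_eq[OF continuous_on_const[of _ 0]]) (simp add: gz)
  ultimately have "continuous_on ({0<..} \<union> - K) (generator a b f)"
    by (rule continuous_on_open_Un[OF open_greaterThan oK])
  moreover have "{0<..} \<union> - K = UNIV" using K(2) by auto
  ultimately have gc: "continuous_on UNIV (generator a b f)" by simp
  obtain Cf where Cf: "\<And>x. \<bar>f x\<bar> \<le> Cf" using bounded_of_compact_support[OF D(3) K(1,3)] by blast
  obtain CG where CG: "\<And>x. \<bar>generator a b f x\<bar> \<le> CG"
    using bounded_of_compact_support[OF gc K(1) gz] by blast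
  show thesis by (rule that[OF D(3) Cf gc CG])
qed

text \<open>Makes a solution admissible for the martingale problem without changing it or its
  equation on \<open>{\<alpha>..\<beta>}\<close>; the equation is used only while the path stays in
  that interval.\<close>

lemma cutoff_solution:
  assumes sol: "is_sol l v z" and v: "\<And>x. 0 \<le> x \<Longrightarrow> 0 \<le> v x" and \<alpha>: "0 < \<alpha>" "\<alpha> \<le> \<beta>"
  obtains f where "f \<in> C2_0" "\<And>x. 0 \<le> f x" "\<And>x. x \<in> {\<alpha>..\<beta>} \<Longrightarrow> f x = v x"
    "\<And>x. x \<in> {\<alpha>..\<beta>} \<Longrightarrow> generator a b f x = - l * f x"
proof -
  \<comment> \<open>\<open>A\<close> rises from 0 at \<open>\<alpha>/4\<close> to 1 at
    \<open>\<alpha>/2\<close>, and \<open>R\<close> falls from 1 at \<open>\<beta> + 1\<close> to 0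
    at \<open>\<beta> + 2\<close>; on \<open>{\<alpha>..\<beta>}\<close> both are at least 1, so the
    cutoff is flat there.\<close>
  define A where "A t = (t - \<alpha>/4) * (4 / \<alpha>)" for t
  define R where "R t = \<beta> + 2 - t" for t
  have dA: "(A has_real_derivative 4 / \<alpha>) (at t)" for t
    unfolding A_def[abs_def] using \<alpha> by (auto intro!: derivative_eq_intros)
  have dR: "(R has_real_derivative - 1) (at t)" for t
    unfolding R_def[abs_def] by (auto intro!: derivative_eq_intros)
  define \<zeta> where "\<zeta> t = step (A t) * step (R t)" for t
  define \<zeta>1 where "\<zeta>1 t = step1 (A t) * (4/\<alpha>) * step (R t) + step1 (R t) * (-1) * step (A t)" for t
  define \<zeta>2 where "\<zeta>2 t = (step2 (A t) * (4/\<alpha>) * (4/\<alpha>)) * step (R t) + step1 (R t) * (-1) * (step1 (A t) * (4/\<alpha>))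
      + ((step2 (R t) * (-1) * (-1)) * step (A t) + step1 (A t) * (4/\<alpha>) * (step1 (R t) * (-1)))" for t
  have sA: "((\<lambda>t. step (A t)) has_real_derivative step1 (A t) * (4/\<alpha>)) (at t)"
    and sA1: "((\<lambda>t. step1 (A t)) has_real_derivative step2 (A t) * (4/\<alpha>)) (at t)"
    and sR: "((\<lambda>t. step (R t)) has_real_derivative step1 (R t) * (-1)) (at t)"
    and sR1: "((\<lambda>t. step1 (R t)) has_real_derivative step2 (R t) * (-1)) (at t)" for t
    by (rule DERIV_chain2[OF step_deriv(1) dA] DERIV_chain2[OF step_deriv(2) dA]
        DERIV_chain2[OF step_deriv(1) dR] DERIV_chain2[OF step_deriv(2) dR])+
  have d1: "(\<zeta> has_real_derivative \<zeta>1 t) (at t)" for t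
    unfolding \<zeta>_def[abs_def] \<zeta>1_def by (rule DERIV_mult[OF sA sR])
  have d2: "(\<zeta>1 has_real_derivative \<zeta>2 t) (at t)" for t
    unfolding \<zeta>1_def[abs_def] \<zeta>2_def
    by (rule DERIV_add[OF DERIV_mult[OF DERIV_cmult_right[OF sA1] sR] DERIV_mult[OF DERIV_cmult_right[OF sR1] sA]])
  have cA: "continuous_on S A" "continuous_on S R" for S
    unfolding A_def[abs_def] R_def[abs_def] by (intro continuous_intros)+
  have c: "continuous_on S \<zeta>" "continuous_on S \<zeta>1" "continuous_on S \<zeta>2" for S
    unfolding \<zeta>_def[abs_def] \<zeta>1_def[abs_def] \<zeta>2_def[abs_def]
    by (intro continuous_intros continuous_on_compose2[OF step_cont(1)[of UNIV]]
        continuous_on_compose2[OF step_cont(2)[of UNIV]] continuous_on_compose2[OF step_cont(3)[of UNIV]] cA subset_UNIV)+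
  have one: "\<zeta> t = 1 \<and> \<zeta>1 t = 0 \<and> \<zeta>2 t = 0" if "t \<in> {\<alpha>..\<beta>}" for t
  proof -
    have "A t \<ge> 1" using that \<alpha> by (simp add: A_def field_simps)
    moreover have "R t \<ge> 1" using that by (simp add: R_def)
    ultimately show ?thesis by (simp add: \<zeta>_def \<zeta>1_def \<zeta>2_def step_vals)
  qed
  define K where "K = {\<alpha>/4..\<beta> + 2}"
  have \<zeta>z: "\<zeta> t = 0" if "t \<notin> K" for t
  proof -
    have "A t \<le> 0 \<or> R t \<le> 0"
    proof (cases "t < \<alpha>/4")
      case True
      then have "A t \<le> 0" unfolding A_def using \<alpha> by (intro mult_nonpos_nonneg) auto
      then show ?thesis ..
    next
      case False
      then show ?thesis using that by (simp add: K_def R_def)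
    qed
    then show ?thesis by (auto simp: \<zeta>_def step_vals)
  qed
  have K: "compact K" "K \<subseteq> {0<..}" using \<alpha> by (auto simp: K_def)
  define f where "f t = v t * \<zeta> t" for t
  define f1 where "f1 t = sol1 z t * \<zeta> t + \<zeta>1 t * v t" for t
  define f2 where "f2 t = (sol2 l v z t * \<zeta> t + \<zeta>1 t * sol1 z t) + (\<zeta>2 t * v t + sol1 z t * \<zeta>1 t)" for t
  have fz: "f t = 0" if "t \<notin> K" for t using \<zeta>z[OF that] by (simp add: f_def)
  have e1: "(f has_real_derivative f1 t) (at t)" if "t \<in> {0<..}" for t
    unfolding f_def[abs_def] f1_def using that by (intro DERIV_mult sol_second_deriv(1)[OF sol] d1) auto
  have e2: "(f1 has_real_derivative f2 t) (at t)" if "t \<in> {0<..}" for t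
    unfolding f1_def[abs_def] f2_def using that
    by (intro DERIV_add DERIV_mult sol_second_deriv[OF sol] d1 d2) auto
  have S: "{0<..} \<subseteq> {0::real..}" by auto
  have c2: "continuous_on {0<..} f2"
    unfolding f2_def[abs_def]
    by (intro continuous_intros c continuous_on_subset[OF sol_cont(1)[OF sol] S]
        continuous_on_subset[OF sol_cont(2)[OF sol] S] continuous_on_subset[OF is_solD(5)[OF sol] S])
  show thesis
  proof (rule that[of f])
    show "f \<in> C2_0" by (rule C2_0_I(1)[OF open_greaterThan order_refl K fz e1 e2 c2])
    show "0 \<le> f t" for t
    proof (cases "0 \<le> t")
      case True
      then show ?thesis using v[OF True] step_nonneg by (simp add: f_def \<zeta>_def)
    next
      case False
      then have "t \<notin> K" using \<alpha> by (auto simp: K_def)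
      then show ?thesis using fz by simp
    qed
    fix t assume t: "t \<in> {\<alpha>..\<beta>}"
    then have t0: "t \<in> {0<..}" "0 < t" using \<alpha> by auto
    show "f t = v t" using one[OF t] by (simp add: f_def)
    have "deriv f t = f1 t" by (rule C2_0_I(2)[OF open_greaterThan order_refl K fz e1 e2 c2 t0(1)])
    moreover have "deriv (deriv f) t = f2 t"
      by (rule C2_0_I(3)[OF open_greaterThan order_refl K fz e1 e2 c2 t0(1)])
    ultimately show "generator a b f t = - l * f t"
      using one[OF t] sol_ode[OF t0(2), of l v z] deriv_a[OF t0(2)]
      by (simp add: generator_def f_def f1_def f2_def)
  qed
qed

lemma L2_norm_pos:
  assumes \<phi>: "\<phi> \<in> C1_0" and y: "\<phi> y \<noteq> 0"
  shows "0 < L2_norm \<mu> \<phi>"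
proof (rule ccontr)
  assume "\<not> 0 < L2_norm \<mu> \<phi>"
  then have "L2_norm \<mu> \<phi> = 0" using L2_norm_nonneg[of \<mu> \<phi>] by simp
  obtain c d where s: "supported \<phi> c d" using C1_0_supported[OF \<phi>] .
  then have c: "0 < c" and cd: "c < d" by (auto simp: supported_def)
  have yin: "y \<in> {c..d}" using s y unfolding supported_def by (cases "y \<in> {c<..<d}") auto
  have cont: "continuous_on {c..d} (\<lambda>x. m x * (cmod (\<phi> x))\<^sup>2)"
    by (intro continuous_intros C1_0D[OF \<phi>] continuous_on_subset[OF m_cont]) (use c in auto)
  have "(L2_norm \<mu> \<phi>)\<^sup>2 = integral {c..d} (\<lambda>x. m x * (cmod (\<phi> x))\<^sup>2)"
    by (rule L2_compact(2)[OF c C1_0D(3)[OF \<phi>]]) (use s in \<open>auto simp: supported_def\<close>)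
  then have "integral {c..d} (\<lambda>x. m x * (cmod (\<phi> x))\<^sup>2) = 0" using \<open>L2_norm \<mu> \<phi> = 0\<close> by simp
  then have "\<forall>x\<in>{c..d}. m x * (cmod (\<phi> x))\<^sup>2 = 0"
    using integral_eq_0_iff[OF cont cd] m_pos by (simp add: less_imp_le)
  then show False using yin y m_pos[of y] by fastforce
qed

text \<open>One nonzero test function bounds \<open>form_bounds\<close> from above, so its supremum
  is a genuine real number.\<close>

lemma nontrivial: "\<exists>\<phi>\<in>C1_0. 0 < L2_norm \<mu> \<phi>"
proof -
  define g where "g x = (max 0 (x - 1))\<^sup>2 * (max 0 (3 - x))\<^sup>2" for x :: real
  define g' where "g' x = 2 * max 0 (x - 1) * 1 * (max 0 (3 - x))\<^sup>2 + 2 * max 0 (3 - x) * (-1) * (max 0 (x - 1))\<^sup>2" for x :: real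
  have "((\<lambda>x. x - 1) has_real_derivative 1) (at x)" "((\<lambda>x. 3 - x) has_real_derivative -1) (at x)" for x :: real
    by (auto intro!: derivative_eq_intros)
  then have d: "(g has_real_derivative g' x) (at x)" for x
    unfolding g_def[abs_def] g'_def
    by (intro DERIV_mult DERIV_chain2[OF max0_square_deriv])
  have "(\<lambda>x. complex_of_real (g x)) \<in> C1_0"
  proof (rule C1_0_I[of _ "\<lambda>x. of_real (g' x)" "{1..3}"])
    show "((\<lambda>x. complex_of_real (g x)) has_vector_derivative of_real (g' x)) (at x)" for x
      by (rule bounded_linear.has_vector_derivative[OF bounded_linear_of_real
          d[unfolded has_real_derivative_iff_has_vector_derivative]])
    show "continuous_on UNIV (\<lambda>x. complex_of_real (g' x))"
      unfolding g'_def[abs_def] by (intro continuous_intros)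
  qed (auto simp: g_def max_def)
  moreover have "complex_of_real (g 2) \<noteq> 0" by (simp add: g_def)
  ultimately show ?thesis using L2_norm_pos by blast
qed

section \<open>The optimal lower bound of the form and the infimum of the spectrum\<close>

definition form_bounds :: "real set" where
  "form_bounds = {l. 0 \<le> l \<and> (\<forall>\<phi>\<in>C1_0. l * (L2_norm \<mu> \<phi>)\<^sup>2 \<le> Re (Q_D a b \<phi> \<phi>))}"

definition bottom :: real where "bottom = Sup form_bounds"

lemma form_bounds_0: "0 \<in> form_bounds" using nonneg by (simp add: form_bounds_def)

lemma form_bounds_bdd: "bdd_above form_bounds"
proof -
  obtain \<phi> where \<phi>: "\<phi> \<in> C1_0" "0 < L2_norm \<mu> \<phi>" using nontrivial by blast
  have "l \<le> Re (Q_D a b \<phi> \<phi>) / (L2_norm \<mu> \<phi>)\<^sup>2" if "l \<in> form_bounds" for l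
    using that \<phi> by (simp add: form_bounds_def pos_le_divide_eq)
  then show ?thesis by (rule bdd_aboveI)
qed

lemma bottom_nonneg: "0 \<le> bottom"
  unfolding bottom_def by (rule cSup_upper[OF form_bounds_0 form_bounds_bdd])

lemma le_bottom: "l \<in> form_bounds \<Longrightarrow> l \<le> bottom"
  unfolding bottom_def by (rule cSup_upper[OF _ form_bounds_bdd])

lemma bottom_lower:
  assumes \<phi>: "\<phi> \<in> C1_0"
  shows "bottom * (L2_norm \<mu> \<phi>)\<^sup>2 \<le> Re (Q_D a b \<phi> \<phi>)"
proof (cases "L2_norm \<mu> \<phi> = 0")
  case True
  then show ?thesis using nonneg[OF \<phi>] by simp
next
  case False
  then have pos: "0 < (L2_norm \<mu> \<phi>)\<^sup>2" by simp
  have "bottom \<le> Re (Q_D a b \<phi> \<phi>) / (L2_norm \<mu> \<phi>)\<^sup>2"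
    unfolding bottom_def
  proof (rule cSup_least)
    show "form_bounds \<noteq> {}" using form_bounds_0 by blast
    fix l assume "l \<in> form_bounds"
    then show "l \<le> Re (Q_D a b \<phi> \<phi>) / (L2_norm \<mu> \<phi>)\<^sup>2"
      using \<phi> pos by (simp add: form_bounds_def pos_le_divide_eq)
  qed
  then show ?thesis using pos by (simp add: pos_le_divide_eq)
qed

lemma Inf_spectrum:
  "Inf ((\<lambda>z. ereal (Re z)) ` operator_spectrum \<mu> (H_D a b)) = ereal bottom"
proof -
  interpret bb: bounded_below_form C1_0 "Q_D a b" \<mu> bottom
    by unfold_locales (rule bottom_lower)
  have "\<exists>f\<in>C1_0. Re (Q_D a b f f) < c * (L2_norm \<mu> f)\<^sup>2" if "c > bottom" for c
  proof (rule ccontr)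
    assume "\<not> ?thesis"
    then have "c \<in> form_bounds" using that bottom_nonneg by (auto simp: form_bounds_def not_less)
    then show False using le_bottom[of c] that by simp
  qed
  from bb.Inf_Re_spectrum[OF this] show ?thesis unfolding Defs.H_D_def .
qed

text \<open>The search for a zero cannot start at 0, where \<open>u\<close> itself vanishes. The
  initial flux 1 makes \<open>u\<close> positive just to the right of 0, and the search starts
  there.\<close>

lemma Dirichlet_first_zero:
  assumes sol: "is_sol l u w" "u 0 = 0" "w 0 = 1" and x: "0 < x" "u x \<le> 0"
  obtains \<gamma> where "0 < \<gamma>" "u \<gamma> = 0" "\<And>x. 0 < x \<Longrightarrow> x < \<gamma> \<Longrightarrow> 0 < u x"
proof -
  have "continuous (at 0 within {0..}) w" using is_solD(6)[OF sol(1)] by (auto simp: continuous_on_eq_continuous_within)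
  then have "\<forall>\<^sub>F x in at 0 within {0..}. w x > 0"
    using sol by (intro order_tendstoD(1)) (auto simp: continuous_within)
  then obtain e where e: "e > 0" "\<And>x. 0 \<le> x \<Longrightarrow> x < e \<Longrightarrow> x \<noteq> 0 \<Longrightarrow> w x > 0"
    by (auto simp: eventually_at dist_real_def)
  have near: "u t > 0" if t: "0 < t" "t < e" for t
  proof -
    have "u 0 < u t"
    proof (rule DERIV_pos_imp_increasing_open[OF t(1)])
      fix r assume r: "0 < r" "r < t"
      then have "w r / p r > 0" using e(2)[of r] p_pos[of r] t by simp
      then show "\<exists>y. (u has_real_derivative y) (at r) \<and> y > 0" using is_solD(3)[OF sol(1) r(1)] by blast
    next
      show "continuous_on {0..t} u" using is_solD(5)[OF sol(1)] by (rule continuous_on_subset) auto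
    qed
    then show ?thesis using sol by simp
  qed
  define x0 where "x0 = min (e/2) x"
  have x0: "0 < x0" "x0 < e" "x0 \<le> x" using e(1) x by (auto simp: x0_def)
  have cu: "continuous_on {x0..} u" using is_solD(5)[OF sol(1)] by (rule continuous_on_subset) (use x0 in auto)
  obtain \<gamma> where \<gamma>: "x0 < \<gamma>" "u \<gamma> = 0" "\<And>t. x0 \<le> t \<Longrightarrow> t < \<gamma> \<Longrightarrow> u t > 0"
    by (rule first_zero[OF cu near[OF x0(1,2)] x0(3) x(2)]) (rule that)
  show thesis
  proof (rule that[of \<gamma>])
    show "0 < \<gamma>" "u \<gamma> = 0" using \<gamma> x0 by auto
    fix t assume t: "0 < t" "t < \<gamma>"
    show "0 < u t" using near[of t] \<gamma>(3)[of t] x0 t by (cases "t < x0") auto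
  qed
qed

end

section \<open>Tail of the hitting time\<close>

lemma ennreal_ge_of_nat_imp_top:
  fixes r :: ennreal
  assumes "\<And>n. of_nat n \<le> r"
  shows "r = \<infinity>"
proof (rule ccontr)
  assume "r \<noteq> \<infinity>"
  then obtain n where "r < of_nat n" using ennreal_Ex_less_of_nat[of r] by (auto simp: less_top[symmetric])
  then show False using assms[of n] by simp
qed

locale diffusion_process = diffusion_coeffs +
  fixes P :: "real \<Rightarrow> 'w measure" and X :: "real \<Rightarrow> 'w \<Rightarrow> real"
  assumes killed: "killed_diffusion a b P X"
    and scale: "\<And>C. \<exists>x\<ge>0. C < integral {0..x} (\<lambda>x. 1 / p x)"
begin

lemma process:
  assumes "0 < x"
  shows "prob_space (P x)" "0 \<le> t \<Longrightarrow> X t \<in> borel_measurable (P x)"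
    "\<omega> \<in> space (P x) \<Longrightarrow> continuous_on {0..} (\<lambda>t. X t \<omega>)"
    "\<omega> \<in> space (P x) \<Longrightarrow> 0 \<le> t \<Longrightarrow> 0 \<le> X t \<omega>"
    "\<omega> \<in> space (P x) \<Longrightarrow> 0 \<le> s \<Longrightarrow> s \<le> t \<Longrightarrow> X s \<omega> = 0 \<Longrightarrow> X t \<omega> = 0"
    "AE \<omega> in P x. X 0 \<omega> = x"
proof -
  note k = killed[unfolded killed_diffusion_def]
  note k3 = k[THEN conjunct2, THEN conjunct2]
  note paths = k3[THEN conjunct2, THEN conjunct1, rule_format, OF assms]
  show "prob_space (P x)" by (rule k[THEN conjunct1, rule_format, OF assms])
  show "0 \<le> t \<Longrightarrow> X t \<in> borel_measurable (P x)"
    by (rule k3[THEN conjunct1, rule_format, OF assms])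
  show "\<omega> \<in> space (P x) \<Longrightarrow> continuous_on {0..} (\<lambda>t. X t \<omega>)"
    using paths by simp
  show "\<omega> \<in> space (P x) \<Longrightarrow> 0 \<le> t \<Longrightarrow> 0 \<le> X t \<omega>"
    using paths by simp
  show "\<omega> \<in> space (P x) \<Longrightarrow> 0 \<le> s \<Longrightarrow> s \<le> t \<Longrightarrow> X s \<omega> = 0 \<Longrightarrow> X t \<omega> = 0"
    using paths by blast
  show "AE \<omega> in P x. X 0 \<omega> = x"
    by (rule k3[THEN conjunct2, THEN conjunct2, THEN conjunct1, rule_format, OF assms])
qed

lemma Dynkin:
  assumes x: "0 < x" and f: "f \<in> C2_0"
  obtains Cf CG where "Dynkin_path (P x) X f (generator a b f) Cf CG"
proof -
  obtain Cf CG where C: "continuous_on UNIV f" "\<And>y. \<bar>f y\<bar> \<le> Cf"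
    "continuous_on UNIV (generator a b f)" "\<And>y. \<bar>generator a b f y\<bar> \<le> CG"
    by (rule C2_0_generator[OF f]) (rule that)
  have mart: "is_martingale (P x) (natural_filtration (P x) X)
      (\<lambda>t \<omega>. f (X t \<omega>) - f (X 0 \<omega>) - integral {0..t} (\<lambda>s. generator a b f (X s \<omega>)))"
    using killed[unfolded killed_diffusion_def, THEN conjunct2, THEN conjunct2, THEN conjunct2,
        THEN conjunct2, THEN conjunct2] x f by blast
  interpret prob_space "P x" by (rule process(1)[OF x])
  have "Dynkin_path (P x) X f (generator a b f) Cf CG"
    by unfold_locales (use process[OF x] C mart in auto)
  then show thesis by (rule that)
qed

lemma hitting_time_lower:
  assumes x: "0 < x" and \<omega>: "\<omega> \<in> space (P x)" and t: "0 \<le> t" "0 < X t \<omega>"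
  shows "ereal t \<le> hitting_time_0 X \<omega>"
  unfolding hitting_time_0_def
proof (rule Inf_greatest)
  fix r assume "r \<in> ereal ` {t. 0 \<le> t \<and> X t \<omega> = 0}"
  then obtain s where s: "r = ereal s" "0 \<le> s" "X s \<omega> = 0" by auto
  then have "\<not> s \<le> t" using process(5)[OF x \<omega> s(2) _ s(3), of t] t by auto
  then show "ereal t \<le> r" using s by simp
qed

lemma hitting_time_upper: "0 \<le> t \<Longrightarrow> X t \<omega> = 0 \<Longrightarrow> hitting_time_0 X \<omega> \<le> ereal t"
  unfolding hitting_time_0_def by (rule Inf_lower) auto

text \<open>Time is discretised. If \<open>j + 1\<close> is the first integer at which the path is
  at 0, then term \<open>j\<close> alone dominates the moment; the summand 1 covers a path at 0 from
  the start, and for a path positive at all integers the series is infinite.\<close>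

lemma exp_moment_upper:
  assumes x: "0 < x" and l: "0 \<le> l" and \<omega>: "\<omega> \<in> space (P x)"
  shows "exp_ereal (ereal l * hitting_time_0 X \<omega>) \<le>
    1 + (\<Sum>n. ennreal (exp (l * (real n + 1))) * indicator {\<omega> \<in> space (P x). 0 < X (real n) \<omega>} \<omega>)"
    (is "_ \<le> 1 + (\<Sum>n. ?t n)")
proof (cases "\<exists>n. X (real n) \<omega> = 0")
  case False
  then have "0 < X (real n) \<omega>" for n using process(4)[OF x \<omega>, of "real n"] by (simp add: less_le)
  then have t: "1 \<le> ?t n" for n using l \<omega> by (simp add: ennreal_ge_1)
  have "of_nat N \<le> (\<Sum>n. ?t n)" for N
  proof -
    have "of_nat N = (\<Sum>n<N. 1 :: ennreal)" by simp
    also have "\<dots> \<le> (\<Sum>n<N. ?t n)" by (rule sum_mono) (rule t)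
    also have "\<dots> \<le> (\<Sum>n. ?t n)" by (rule sum_le_suminf) auto
    finally show ?thesis .
  qed
  then have "(\<Sum>n. ?t n) = \<infinity>" by (rule ennreal_ge_of_nat_imp_top)
  then show ?thesis by simp
next
  case True
  define n where "n = (LEAST n. X (real n) \<omega> = 0)"
  have n: "X (real n) \<omega> = 0" unfolding n_def using True by (rule LeastI_ex)
  have "ereal l * hitting_time_0 X \<omega> \<le> ereal l * ereal (real n)"
    by (rule ereal_mult_left_mono[OF hitting_time_upper]) (use n l in auto)
  then have le: "exp_ereal (ereal l * hitting_time_0 X \<omega>) \<le> ennreal (exp (l * real n))"
    using exp_ereal_mono[of "ereal l * hitting_time_0 X \<omega>" "ereal (l * real n)"] by (simp add: exp_ereal_def)
  show ?thesis
  proof (cases n)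
    case 0
    then show ?thesis using le by (simp add: add_increasing2)
  next
    case (Suc j)
    then have "X (real j) \<omega> \<noteq> 0" unfolding n_def using not_less_Least[of j] by (metis lessI)
    then have "0 < X (real j) \<omega>" using process(4)[OF x \<omega>, of "real j"] by (simp add: less_le)
    then have "?t j = ennreal (exp (l * real n))" using \<omega> Suc by (simp add: add.commute)
    moreover have "?t j \<le> (\<Sum>n. ?t n)"
    proof -
      have "sum h {j} = h j" for h :: "nat \<Rightarrow> ennreal" by simp
      moreover have "sum ?t {j} \<le> (\<Sum>n. ?t n)" by (rule sum_le_suminf) auto
      ultimately show ?thesis by metis
    qed
    ultimately have "ennreal (exp (l * real n)) \<le> (\<Sum>n. ?t n)" by (simp only:)
    from order_trans[OF le this] show ?thesis by (rule add_increasing[OF zero_le])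
  qed
qed

text \<open>A path alive at time \<open>T\<close> has stayed in some compact interval
  \<open>I n\<close> up to then. On that event \<open>v\<close> may be replaced by a cutoff, the
  decay estimate applies, and \<open>\<delta> \<le> v\<close> turns it into a bound on the
  probability. The bound does not depend on \<open>n\<close>.\<close>

lemma survival_decay:
  assumes x: "0 < x" and sol: "is_sol l v z" and \<delta>: "0 < \<delta>" "\<And>y. 0 \<le> y \<Longrightarrow> \<delta> \<le> v y" and T: "0 \<le> T"
  shows "measure (P x) {\<omega> \<in> space (P x). 0 < X T \<omega>} \<le> exp (- l * T) * (v x / \<delta>)"
proof -
  interpret prob_space "P x" by (rule process(1)[OF x])
  have v0: "0 \<le> v y" if "0 \<le> y" for y using \<delta>(2)[OF that] \<delta>(1) by linarith
  \<comment> \<open>These intervals contain \<open>x\<close>, increase with \<open>n\<close> and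
    exhaust the open half-line.\<close>
  define I where "I n = {x / (real n + 1)..x + real n}" for n
  define A where "A n s = {\<omega> \<in> space (P x). \<forall>r\<in>{0..s}. X r \<omega> \<in> I n}" for n s
  have I: "0 < x / (real n + 1)" "x / (real n + 1) \<le> x + real n" "x \<in> I n" for n
  proof -
    show "0 < x / (real n + 1)" using x by simp
    have "x / (real n + 1) \<le> x" using x by (simp add: field_simps)
    then show "x / (real n + 1) \<le> x + real n" "x \<in> I n" by (auto simp: I_def)
  qed
  have A_F: "A n s \<in> sets (natural_filtration (P x) X s)" if s: "0 \<le> s" for n s
  proof -
    \<comment> \<open>Countably many times suffice by path continuity. A time outside the set is
      approximated by rationals from the right, which works except at the end point
      \<open>s\<close>; hence \<open>s\<close> is added.\<close>
    define J where "J = insert s (\<rat> \<inter> {0..s})"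
    have J: "countable J" "J \<subseteq> {0..s}" "J \<noteq> {}" using s countable_rat by (auto simp: J_def)
    have "A n s = (\<Inter>r\<in>J. {\<omega> \<in> space (P x). X r \<omega> \<in> I n})"
    proof (intro set_eqI iffI)
      fix \<omega> assume "\<omega> \<in> A n s"
      then show "\<omega> \<in> (\<Inter>r\<in>J. {\<omega> \<in> space (P x). X r \<omega> \<in> I n})" using J by (auto simp: A_def)
    next
      fix \<omega> assume *: "\<omega> \<in> (\<Inter>r\<in>J. {\<omega> \<in> space (P x). X r \<omega> \<in> I n})"
      then have \<omega>: "\<omega> \<in> space (P x)" and XJ: "\<And>r. r \<in> J \<Longrightarrow> X r \<omega> \<in> I n" using J(3) by auto
      have "X r \<omega> \<in> I n" if r: "r \<in> {0..s}" for r
      proof (rule ccontr)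
        assume out: "X r \<omega> \<notin> I n"
        then have "r \<noteq> s" using XJ[of s] by (auto simp: J_def)
        then have rs: "0 \<le> r" "r < s" using r by auto
        have "continuous (at r within {0..}) (\<lambda>t. X t \<omega>)"
          using process(3)[OF x \<omega>] rs by (simp add: continuous_on_eq_continuous_within)
        then have "((\<lambda>t. X t \<omega>) \<longlongrightarrow> X r \<omega>) (at r within {0..})" by (simp add: continuous_within)
        then have "\<forall>\<^sub>F t in at r within {0..}. X t \<omega> \<in> - I n"
          by (rule topological_tendstoD) (use out in \<open>auto simp: I_def\<close>)
        then obtain d where d: "d > 0" "\<And>t. 0 \<le> t \<Longrightarrow> t \<noteq> r \<Longrightarrow> dist t r < d \<Longrightarrow> X t \<omega> \<notin> I n"
          by (auto simp: eventually_at)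
        obtain q where q: "q \<in> \<rat>" "r < q" "q < min s (r + d)"
          using Rats_dense_in_real[of r "min s (r + d)"] rs d(1) by auto
        have "X q \<omega> \<notin> I n" using q rs by (intro d(2)) (auto simp: dist_real_def)
        moreover have "q \<in> J" using q rs by (auto simp: J_def)
        ultimately show False using XJ by blast
      qed
      then show "\<omega> \<in> A n s" using \<omega> by (simp add: A_def)
    qed
    also have "\<dots> \<in> sets (natural_filtration (P x) X s)"
    proof (rule sets.countable_INT'[OF J(1,3)])
      show "(\<lambda>r. {\<omega> \<in> space (P x). X r \<omega> \<in> I n}) ` J \<subseteq> sets (natural_filtration (P x) X s)"
      proof (rule image_subsetI)
        fix r assume "r \<in> J"
        then show "{\<omega> \<in> space (P x). X r \<omega> \<in> I n} \<in> sets (natural_filtration (P x) X s)"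
          using J(2) by (intro natural_filtration_sets) (auto simp: I_def)
      qed
    qed
    finally show ?thesis .
  qed
  have A_sets: "A n s \<in> sets (P x)" if "0 \<le> s" for n s
  proof -
    have "subalgebra (P x) (natural_filtration (P x) X s)"
      by (rule natural_filtration_subalgebra) (rule process(2)[OF x])
    then have "sets (natural_filtration (P x) X s) \<subseteq> sets (P x)" by (simp add: subalgebra_def)
    then show ?thesis using A_F[OF that] by (rule subsetD)
  qed
  have A_bound: "measure (P x) (A n T) \<le> exp (- l * T) * (v x / \<delta>)" for n
  proof -
    have "\<exists>f\<in>C2_0. (\<forall>y. 0 \<le> f y) \<and> (\<forall>y\<in>I n. f y = v y) \<and> (\<forall>y\<in>I n. generator a b f y = - l * f y)"
      unfolding I_def by (rule cutoff_solution[OF sol v0 I(1)[of n] I(2)[of n]]) (assumption, blast)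
    then obtain f where f: "f \<in> C2_0" "\<And>y. 0 \<le> f y" "\<And>y. y \<in> I n \<Longrightarrow> f y = v y"
      "\<And>y. y \<in> I n \<Longrightarrow> generator a b f y = - l * f y" by auto
    obtain Cf CG where "Dynkin_path (P x) X f (generator a b f) Cf CG" by (rule Dynkin[OF x f(1)])
    then interpret D: Dynkin_path "P x" X f "generator a b f" Cf CG .
    have mono: "A n t \<subseteq> A n s" if "0 \<le> s" "s \<le> t" for s t using that by (auto simp: A_def)
    have gen: "generator a b f (X s \<omega>) \<le> - l * f (X s \<omega>)" if "0 \<le> s" "\<omega> \<in> A n s" for s \<omega>
      using f(4)[of "X s \<omega>"] that by (simp add: A_def)
    have decay: "(\<integral>\<omega>. indicator (A n T) \<omega> * f (X T \<omega>) \<partial>P x) \<le>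
        exp (- l * T) * (\<integral>\<omega>. indicator (A n 0) \<omega> * f (X 0 \<omega>) \<partial>P x)"
      by (rule D.killed_decay[OF f(2) A_F mono gen T])
    have int: "integrable (P x) (\<lambda>\<omega>. indicator (A n s) \<omega> * f (X s \<omega>))" if "0 \<le> s" for s
      using integrable_real_mult_indicator[OF A_sets[OF that] D.fX_int[OF that]] by (simp add: mult.commute)
    have "(\<integral>\<omega>. indicator (A n 0) \<omega> * f (X 0 \<omega>) \<partial>P x) \<le> (\<integral>\<omega>. v x \<partial>P x)"
    proof (rule integral_mono_AE[OF int])
      show "AE \<omega> in P x. indicator (A n 0) \<omega> * f (X 0 \<omega>) \<le> v x"
        using process(6)[OF x]
      proof eventually_elim
        case (elim \<omega>)
        then show ?case using f(3)[OF I(3)] v0[of x] x by (simp add: indicator_def)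
      qed
    qed simp_all
    then have init: "(\<integral>\<omega>. indicator (A n 0) \<omega> * f (X 0 \<omega>) \<partial>P x) \<le> v x" by (simp add: prob_space)
    have "\<delta> * measure (P x) (A n T) = (\<integral>\<omega>. \<delta> * indicator (A n T) \<omega> \<partial>P x)"
      using A_sets[OF T, of n] by simp
    also have "\<dots> \<le> (\<integral>\<omega>. indicator (A n T) \<omega> * f (X T \<omega>) \<partial>P x)"
    proof (rule integral_mono[OF _ int[OF T]])
      show "integrable (P x) (\<lambda>\<omega>. \<delta> * indicator (A n T) \<omega>)"
        using A_sets[OF T, of n] by (auto intro!: integrable_real_indicator simp: emeasure_eq_measure)
      fix \<omega>
      show "\<delta> * indicator (A n T) \<omega> \<le> indicator (A n T) \<omega> * f (X T \<omega>)"
      proof (cases "\<omega> \<in> A n T")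
        case True
        then have "X T \<omega> \<in> I n" using T by (simp add: A_def)
        moreover from this have "0 \<le> X T \<omega>" using I(1)[of n] by (auto simp: I_def)
        ultimately show ?thesis using True f(3) \<delta>(2) by simp
      qed simp
    qed
    also note decay
    also have "exp (- l * T) * (\<integral>\<omega>. indicator (A n 0) \<omega> * f (X 0 \<omega>) \<partial>P x) \<le> exp (- l * T) * v x"
      using init by simp
    finally show ?thesis using \<delta>(1) by (simp add: field_simps)
  qed
  have "incseq (\<lambda>n. A n T)"
  proof (rule incseq_SucI)
    fix n
    have "I n \<subseteq> I (Suc n)" using x by (auto simp: I_def frac_le intro: order_trans[rotated])
    then show "A n T \<subseteq> A (Suc n) T" by (auto simp: A_def)
  qed
  then have lim: "(\<lambda>n. measure (P x) (A n T)) \<longlonglongrightarrow> measure (P x) (\<Union>n. A n T)"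
    by (intro finite_Lim_measure_incseq) (use A_sets[OF T] in auto)
  have "{\<omega> \<in> space (P x). 0 < X T \<omega>} \<subseteq> (\<Union>n. A n T)"
  proof
    fix \<omega> assume "\<omega> \<in> {\<omega> \<in> space (P x). 0 < X T \<omega>}"
    then have \<omega>: "\<omega> \<in> space (P x)" and pos: "0 < X T \<omega>" by auto
    \<comment> \<open>Because 0 is absorbing, positivity at time \<open>T\<close> gives positivity
      on all of \<open>{0..T}\<close>, and compactness bounds the path away from 0 and
      \<infinity>.\<close>
    have Xpos: "0 < X r \<omega>" if "r \<in> {0..T}" for r
      using process(5)[OF x \<omega>, of r T] process(4)[OF x \<omega>, of r] that pos by (cases "X r \<omega> = 0") auto
    have cont: "continuous_on {0..T} (\<lambda>t. X t \<omega>)"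
      by (rule continuous_on_subset[OF process(3)[OF x \<omega>]]) auto
    obtain r1 where r1: "r1 \<in> {0..T}" "\<forall>r\<in>{0..T}. X r1 \<omega> \<le> X r \<omega>"
      using continuous_attains_inf[OF compact_Icc _ cont] T by auto
    obtain r2 where r2: "r2 \<in> {0..T}" "\<forall>r\<in>{0..T}. X r \<omega> \<le> X r2 \<omega>"
      using continuous_attains_sup[OF compact_Icc _ cont] T by auto
    obtain n where n: "max (x / X r1 \<omega>) (X r2 \<omega>) < real n" using reals_Archimedean2 by blast
    have "x / (real n + 1) \<le> X r1 \<omega>"
    proof -
      have "x < real n * X r1 \<omega>" using n Xpos[OF r1(1)] by (simp add: pos_divide_less_eq)
      also have "\<dots> \<le> (real n + 1) * X r1 \<omega>" using Xpos[OF r1(1)] by simp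
      finally show ?thesis by (simp add: pos_divide_le_eq mult.commute)
    qed
    moreover have "X r2 \<omega> \<le> x + real n" using n x by simp
    ultimately have "\<forall>r\<in>{0..T}. X r \<omega> \<in> I n" using r1 r2 by (force simp: I_def)
    then show "\<omega> \<in> (\<Union>n. A n T)" using \<omega> by (auto simp: A_def)
  qed
  then have "measure (P x) {\<omega> \<in> space (P x). 0 < X T \<omega>} \<le> measure (P x) (\<Union>n. A n T)"
    by (rule finite_measure_mono) (use A_sets[OF T] in auto)
  also have "\<dots> \<le> exp (- l * T) * (v x / \<delta>)"
    by (rule LIMSEQ_le_const2[OF lim]) (use A_bound in auto)
  finally show ?thesis .
qed

text \<open>A nonpositive value of \<open>u\<close> would yield a subsolution whose Rayleigh
  quotient is at most some \<open>l1\<close> below \<open>bottom\<close>.\<close>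

lemma positive_below_bottom:
  assumes l: "0 < l" "l < bottom" and sol: "is_sol l u w" "u 0 = 0" "w 0 = 1" and x: "0 < x"
  shows "0 < u x"
proof (rule ccontr)
  assume "\<not> 0 < u x"
  then have ux: "u x \<le> 0" by simp
  obtain \<gamma> where \<gamma>: "0 < \<gamma>" "u \<gamma> = 0" "\<And>x. 0 < x \<Longrightarrow> x < \<gamma> \<Longrightarrow> 0 < u x"
    by (rule Dirichlet_first_zero[OF sol x ux]) (rule that)
  obtain l1 where l1: "l < l1" "l1 < bottom" using dense[OF l(2)] by blast
  obtain f where f: "f \<in> C2_0" "\<And>y. 0 \<le> f y" "f (\<gamma>/2) > 0" "\<And>y. - l1 * f y \<le> generator a b f y"
    by (rule subsolution[OF sol(1) l(1) l1(1) sol(2,3) \<gamma>, of "\<gamma>/2"]) (use \<gamma>(1) that in auto)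
  note F = C2_0_form_bound[OF f(1,2,4)]
  have "0 < L2_norm \<mu> (\<lambda>x. complex_of_real (f x))"
    by (rule L2_norm_pos[OF F(1), of "\<gamma>/2"]) (use f(3) in simp)
  moreover have "bottom * (L2_norm \<mu> (\<lambda>x. complex_of_real (f x)))\<^sup>2 \<le> l1 * (L2_norm \<mu> (\<lambda>x. complex_of_real (f x)))\<^sup>2"
    using bottom_lower[OF F(1)] F(2) by linarith
  ultimately show False using l1(2) by simp
qed

text \<open>Three parameters \<open>l < l1 < l2 < bottom\<close> share the work: positivity of the
  Dirichlet solution at \<open>l2\<close> gives the supersolution at \<open>l1\<close>, whose decay
  rate beats the exponent \<open>l\<close>. The moment is then bounded by a geometric series of
  ratio \<open>exp (l - l1)\<close>.\<close>

lemma exp_moment_finite: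
  assumes x: "0 < x" and l: "0 \<le> l" "l < bottom"
  shows "(\<integral>\<^sup>+\<omega>. exp_ereal (ereal l * hitting_time_0 X \<omega>) \<partial>P x) < \<infinity>"
proof -
  interpret prob_space "P x" by (rule process(1)[OF x])
  obtain l1 where l1: "l < l1" "l1 < bottom" using dense[OF l(2)] by blast
  obtain l2 where l2: "l1 < l2" "l2 < bottom" using dense[OF l1(2)] by blast
  have pos: "0 < l1" "0 < l2" using l l1 l2 by auto
  obtain U V where UV: "is_sol l2 U V" "U 0 = 0" "V 0 = 1" by (rule sol_Dirichlet)
  obtain v z \<delta> where v: "is_sol l1 v z" "0 < \<delta>" "\<And>y. 0 \<le> y \<Longrightarrow> \<delta> \<le> v y"
    by (rule supersolution[OF UV positive_below_bottom[OF pos(2) l2(2) UV] pos(1) l2(1) scale]) (auto intro: that)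
  define C where "C = v x / \<delta>"
  have C: "0 \<le> C" using v(2) v(3)[of x] x by (simp add: C_def)
  define E where "E n = {\<omega> \<in> space (P x). 0 < X (real n) \<omega>}" for n
  have E: "E n \<in> sets (P x)" for n
  proof -
    have "X (real n) \<in> borel_measurable (P x)" using process(2)[OF x, of "real n"] by simp
    then show ?thesis unfolding E_def by measurable
  qed
  have PE: "measure (P x) (E n) \<le> exp (- l1 * real n) * C" for n
    unfolding E_def C_def by (rule survival_decay[OF x v(1,2)]) (use v(3) in auto)
  define q where "q = exp (l - l1)"
  have q: "0 \<le> q" "q < 1" using l1 by (auto simp: q_def)
  have "(\<integral>\<^sup>+\<omega>. exp_ereal (ereal l * hitting_time_0 X \<omega>) \<partial>P x) \<le>
      (\<integral>\<^sup>+\<omega>. 1 + (\<Sum>n. ennreal (exp (l * (real n + 1))) * indicator (E n) \<omega>) \<partial>P x)"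
    unfolding E_def by (intro nn_integral_mono exp_moment_upper[OF x l(1)])
  also have "\<dots> = (\<integral>\<^sup>+\<omega>. 1 \<partial>P x) + (\<integral>\<^sup>+\<omega>. (\<Sum>n. ennreal (exp (l * (real n + 1))) * indicator (E n) \<omega>) \<partial>P x)"
    by (rule nn_integral_add) (use E in \<open>auto intro!: borel_measurable_suminf_order borel_measurable_times_ennreal borel_measurable_indicator\<close>)
  also have "(\<integral>\<^sup>+\<omega>. 1 \<partial>P x) = 1" by (simp add: emeasure_space_1)
  also have "(\<integral>\<^sup>+\<omega>. (\<Sum>n. ennreal (exp (l * (real n + 1))) * indicator (E n) \<omega>) \<partial>P x) =
      (\<Sum>n. \<integral>\<^sup>+\<omega>. ennreal (exp (l * (real n + 1))) * indicator (E n) \<omega> \<partial>P x)"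
    by (rule nn_integral_suminf) (use E in auto)
  also have "\<dots> = (\<Sum>n. ennreal (exp (l * (real n + 1))) * emeasure (P x) (E n))"
    using E by (simp add: nn_integral_cmult_indicator)
  also have "1 + \<dots> \<le> 1 + (\<Sum>n. ennreal (exp l * C * q ^ n))"
  proof (intro add_left_mono suminf_le allI)
    fix n
    have "exp (l * (real n + 1)) * measure (P x) (E n) \<le> exp (l * (real n + 1)) * (exp (- l1 * real n) * C)"
      by (intro mult_left_mono PE) simp
    also have "\<dots> = exp l * C * q ^ n"
      by (simp add: q_def exp_of_nat_mult[symmetric] exp_add[symmetric] algebra_simps mult_exp_exp)
    finally show "ennreal (exp (l * (real n + 1))) * emeasure (P x) (E n) \<le> ennreal (exp l * C * q ^ n)"
      by (simp add: emeasure_eq_measure ennreal_leI flip: ennreal_mult)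
  qed auto
  also have "\<dots> < \<infinity>"
  proof -
    have "(\<Sum>n. ennreal (exp l * C * q ^ n)) = ennreal (\<Sum>n. exp l * C * q ^ n)"
      by (rule suminf_ennreal2) (use q C in \<open>auto intro!: summable_mult summable_geometric\<close>)
    then show ?thesis by (simp add: ennreal_add_less_top)
  qed
  finally show ?thesis .
qed

text \<open>The growth estimate keeps \<open>exp (l1 * n) * P(X n > 0)\<close> away from 0 for large
  \<open>n\<close>. A finite moment would give these variables an integrable majorant and the
  pointwise limit 0, so dominated convergence is contradicted.\<close>

lemma exp_moment_le_bottom:
  assumes x: "0 < x" and l1: "0 \<le> l1"
    and fin: "(\<integral>\<^sup>+\<omega>. exp_ereal (ereal l1 * hitting_time_0 X \<omega>) \<partial>P x) < \<infinity>"
  shows "l1 \<le> bottom"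
proof (rule ccontr)
  assume "\<not> l1 \<le> bottom"
  then obtain l where l: "bottom < l" "l < l1" using dense[of bottom l1] by auto
  have pos: "0 < l" "0 < l1" using bottom_nonneg l by auto
  interpret prob_space "P x" by (rule process(1)[OF x])
  obtain u w where sol: "is_sol l u w" "u 0 = 0" "w 0 = 1" by (rule sol_Dirichlet)
  have "\<exists>y>0. u y \<le> 0"
  proof (rule ccontr)
    assume "\<not> (\<exists>y>0. u y \<le> 0)"
    then have "0 < u y" if "0 < y" for y using that by (meson not_less)
    then have "l \<in> form_bounds" using positive_solution_bound[OF sol(1)] pos by (simp add: form_bounds_def)
    then show False using le_bottom[of l] l by simp
  qed
  then obtain y where y: "0 < y" "u y \<le> 0" by blast
  obtain \<gamma> where \<gamma>: "0 < \<gamma>" "u \<gamma> = 0" "\<And>x. 0 < x \<Longrightarrow> x < \<gamma> \<Longrightarrow> 0 < u x"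
    by (rule Dirichlet_first_zero[OF sol y]) (rule that)
  \<comment> \<open>Below \<open>x\<close>, so that every continuous path from \<open>x\<close> to 0
    crosses \<open>y0\<close>, even if \<open>x\<close> lies outside the support of
    \<open>f\<close>.\<close>
  define y0 where "y0 = min x \<gamma> / 2"
  have y0: "0 < y0" "y0 < \<gamma>" "y0 < x" using x \<gamma>(1) by (auto simp: y0_def)
  obtain f where f: "f \<in> C2_0" "\<And>y. 0 \<le> f y" "f y0 > 0" "\<And>y. - l1 * f y \<le> generator a b f y"
    by (rule subsolution[OF sol(1) pos(1) l(2) sol(2,3) \<gamma> y0(1,2)]) (use that in auto)
  obtain Cf CG where "Dynkin_path (P x) X f (generator a b f) Cf CG" by (rule Dynkin[OF x f(1)])
  then interpret D: Dynkin_path "P x" X f "generator a b f" Cf CG .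
  have Cf: "0 < Cf" using D.f_bound[of y0] f(3) by simp
  have f0: "f 0 = 0" using f(1) by (auto simp: C2_0_def compactly_supported_in_def)
  define E where "E n = {\<omega> \<in> space (P x). 0 < X (real n) \<omega>}" for n
  have Xm: "X (real n) \<in> borel_measurable (P x)" for n using process(2)[OF x, of "real n"] by simp
  have E: "E n \<in> sets (P x)" for n unfolding E_def using Xm[of n] by measurable
  define h where "h n \<omega> = ennreal (exp (l1 * real n)) * indicator (E n) \<omega>" for n \<omega>
  have h_meas: "h n \<in> borel_measurable (P x)" for n unfolding h_def[abs_def] using E[of n] by auto
  \<comment> \<open>The supremum serves as a measurable majorant below the moment variable; no
    measurability of the hitting time has to be established.\<close>
  define g where "g \<omega> = (SUP n. h n \<omega>)" for \<omega>
  have g_meas: "g \<in> borel_measurable (P x)" unfolding g_def[abs_def] using h_meas by measurable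
  have g_le: "g \<omega> \<le> exp_ereal (ereal l1 * hitting_time_0 X \<omega>)" if \<omega>: "\<omega> \<in> space (P x)" for \<omega>
    unfolding g_def
  proof (rule SUP_least)
    fix n
    show "h n \<omega> \<le> exp_ereal (ereal l1 * hitting_time_0 X \<omega>)"
    proof (cases "\<omega> \<in> E n")
      case True
      then have "ereal (real n) \<le> hitting_time_0 X \<omega>"
        by (intro hitting_time_lower[OF x \<omega>]) (auto simp: E_def)
      then have "ereal l1 * ereal (real n) \<le> ereal l1 * hitting_time_0 X \<omega>"
        by (rule ereal_mult_left_mono) (use l1 in simp)
      from exp_ereal_mono[OF this] show ?thesis using True by (simp add: h_def exp_ereal_def)
    qed (simp add: h_def)
  qed
  have g_fin: "(\<integral>\<^sup>+\<omega>. g \<omega> \<partial>P x) < \<infinity>"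
    using nn_integral_mono[of "P x" g, OF g_le] fin by (rule le_less_trans)
  have "AE \<omega> in P x. g \<omega> \<noteq> \<infinity>"
    by (rule nn_integral_noteq_infinite[OF g_meas]) (use g_fin in simp)
  then have AE_hit: "AE \<omega> in P x. \<exists>n. X (real n) \<omega> = 0"
  proof (rule AE_mp, intro AE_I2 impI)
    fix \<omega> assume \<omega>: "\<omega> \<in> space (P x)" and g: "g \<omega> \<noteq> \<infinity>"
    show "\<exists>n. X (real n) \<omega> = 0"
    proof (rule ccontr)
      assume "\<not> (\<exists>n. X (real n) \<omega> = 0)"
      then have inE: "\<omega> \<in> E n" for n using process(4)[OF x \<omega>, of "real n"] \<omega> by (auto simp: E_def less_le)
      have "of_nat N \<le> g \<omega>" for N
      proof -
        obtain n where n: "real N / l1 \<le> real n" using real_arch_simple by blast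
        then have "real N \<le> l1 * real n" using pos(2) by (simp add: pos_divide_le_eq mult.commute)
        also have "\<dots> \<le> exp (l1 * real n)" using exp_ge_add_one_self[of "l1 * real n"] by linarith
        finally have "ennreal (real N) \<le> h n \<omega>" using inE[of n] by (simp add: h_def ennreal_leI)
        also have "\<dots> \<le> g \<omega>" unfolding g_def by (rule SUP_upper) simp
        finally show ?thesis by (simp add: ennreal_of_nat_eq_real_of_nat)
      qed
      then have "g \<omega> = \<infinity>" by (rule ennreal_ge_of_nat_imp_top)
      then show False using g by simp
    qed
  qed
  \<comment> \<open>Almost every path reaches 0 and so crosses \<open>y0\<close>; by continuity
    \<open>f\<close> is positive along it at some rational time just after the crossing.\<close>
  have AE_visit: "AE \<omega> in P x. \<exists>q\<in>\<rat> \<inter> {0..}. f (X q \<omega>) \<noteq> 0"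
    using AE_hit process(6)[OF x] AE_space
  proof eventually_elim
    case (elim \<omega>)
    then have \<omega>: "\<omega> \<in> space (P x)" and X0: "X 0 \<omega> = x" by auto
    obtain N where N: "X (real N) \<omega> = 0" using elim by blast
    have "\<exists>t\<ge>0. t \<le> real N \<and> X t \<omega> = y0"
      by (rule IVT2') (use N X0 y0 process(3)[OF x \<omega>] in \<open>auto intro: continuous_on_subset\<close>)
    then obtain t where t: "0 \<le> t" "X t \<omega> = y0" by blast
    have "continuous_on {0..} (\<lambda>t. f (X t \<omega>))"
      by (rule continuous_on_compose2[OF D.f_cont process(3)[OF x \<omega>]]) simp
    then have "((\<lambda>t. f (X t \<omega>)) \<longlongrightarrow> f y0) (at t within {0..})"
      using t by (auto simp: continuous_on_def)
    then have "\<forall>\<^sub>F r in at t within {0..}. 0 < f (X r \<omega>)" by (rule order_tendstoD) (rule f(3))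
    then obtain d where d: "d > 0" "\<And>r. 0 \<le> r \<Longrightarrow> r \<noteq> t \<Longrightarrow> dist r t < d \<Longrightarrow> 0 < f (X r \<omega>)"
      by (auto simp: eventually_at)
    obtain q where q: "q \<in> \<rat>" "t < q" "q < t + d" using Rats_dense_in_real[of t "t + d"] d(1) by auto
    then have "0 < f (X q \<omega>)" using t by (intro d(2)) (auto simp: dist_real_def)
    then show ?case using q t by (intro bexI[of _ q]) auto
  qed
  \<comment> \<open>With countably many rational times, vanishing of all expectations would make
    \<open>f\<close> vanish along almost every path at all of them.\<close>
  have "\<exists>q\<in>\<rat> \<inter> {0..}. 0 < (\<integral>\<omega>. f (X q \<omega>) \<partial>P x)"
  proof (rule ccontr)
    assume no: "\<not> ?thesis"
    have "AE \<omega> in P x. f (X q \<omega>) = 0" if q: "q \<in> \<rat> \<inter> {0..}" for q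
    proof -
      have q0: "0 \<le> q" using q by simp
      have "0 \<le> (\<integral>\<omega>. f (X q \<omega>) \<partial>P x)"
        by (rule Bochner_Integration.integral_nonneg) (rule f(2))
      moreover have "\<not> 0 < (\<integral>\<omega>. f (X q \<omega>) \<partial>P x)" using no q by blast
      ultimately have "(\<integral>\<omega>. f (X q \<omega>) \<partial>P x) = 0" by linarith
      then show ?thesis
        using integral_nonneg_eq_0_iff_AE[OF D.fX_int[OF q0]] f(2) by simp
    qed
    then have "AE \<omega> in P x. \<forall>q\<in>\<rat> \<inter> {0..}. f (X q \<omega>) = 0"
      by (subst AE_ball_countable) (auto intro: countable_Int1 countable_rat)
    with AE_visit have "AE \<omega> in P x. False" by eventually_elim blast
    then show False by simp
  qed
  then obtain q where q: "0 \<le> q" "0 < (\<integral>\<omega>. f (X q \<omega>) \<partial>P x)" by auto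
  define e where "e = (\<integral>\<omega>. f (X q \<omega>) \<partial>P x)"
  have e: "0 < e" using q by (simp add: e_def)
  have lower: "exp (l1 * q) * e / Cf \<le> exp (l1 * real n) * measure (P x) (E n)" if n: "q \<le> real n" for n
  proof -
    have "exp (- l1 * (real n - q)) * e \<le> (\<integral>\<omega>. f (X (q + (real n - q)) \<omega>) \<partial>P x)"
      unfolding e_def by (rule D.growth[OF f(4) q(1)]) (use n in simp)
    also have "\<dots> = (\<integral>\<omega>. f (X (real n) \<omega>) \<partial>P x)" by simp
    also have "\<dots> \<le> (\<integral>\<omega>. Cf * indicator (E n) \<omega> \<partial>P x)"
    proof (rule integral_mono)
      show "integrable (P x) (\<lambda>\<omega>. f (X (real n) \<omega>))" by (rule D.fX_int) simp
      show "integrable (P x) (\<lambda>\<omega>. Cf * indicator (E n) \<omega>)"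
        using E[of n] by (auto intro!: integrable_real_indicator simp: emeasure_eq_measure)
      fix \<omega> assume \<omega>: "\<omega> \<in> space (P x)"
      show "f (X (real n) \<omega>) \<le> Cf * indicator (E n) \<omega>"
      proof (cases "\<omega> \<in> E n")
        case True
        then show ?thesis using D.f_bound[of "X (real n) \<omega>"] by simp
      next
        case False
        then have "X (real n) \<omega> = 0" using process(4)[OF x \<omega>, of "real n"] \<omega> by (auto simp: E_def)
        then show ?thesis using False f0 by simp
      qed
    qed
    also have "\<dots> = Cf * measure (P x) (E n)" using E[of n] by simp
    finally have "exp (l1 * real n) * (exp (- l1 * (real n - q)) * e) \<le> exp (l1 * real n) * (Cf * measure (P x) (E n))"
      by (intro mult_left_mono) auto
    moreover have "exp (l1 * real n) * exp (- l1 * (real n - q)) = exp (l1 * q)"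
      by (simp add: mult_exp_exp algebra_simps)
    ultimately have "exp (l1 * q) * e \<le> exp (l1 * real n) * (Cf * measure (P x) (E n))"
      by (simp only: mult.assoc[symmetric])
    then show ?thesis using Cf by (simp add: pos_divide_le_eq mult_ac)
  qed
  have "(\<lambda>n. \<integral>\<^sup>+\<omega>. h n \<omega> \<partial>P x) \<longlonglongrightarrow> (\<integral>\<^sup>+\<omega>. 0 \<partial>P x)"
  proof (rule nn_integral_dominated_convergence[OF h_meas _ g_meas _ g_fin])
    show "AE \<omega> in P x. h n \<omega> \<le> g \<omega>" for n unfolding g_def by (intro AE_I2 SUP_upper) simp
    show "AE \<omega> in P x. (\<lambda>n. h n \<omega>) \<longlonglongrightarrow> 0"
      using AE_hit
    proof (rule AE_mp, intro AE_I2 impI)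
      fix \<omega> assume \<omega>: "\<omega> \<in> space (P x)" and "\<exists>n. X (real n) \<omega> = 0"
      then obtain N where N: "X (real N) \<omega> = 0" by blast
      have "h n \<omega> = 0" if "n \<ge> N" for n
        using process(5)[OF x \<omega> _ _ N, of "real n"] that by (simp add: h_def E_def)
      then show "(\<lambda>n. h n \<omega>) \<longlonglongrightarrow> 0"
        by (intro tendsto_eventually) (auto simp: eventually_sequentially)
    qed
  qed simp
  then have lim: "(\<lambda>n. \<integral>\<^sup>+\<omega>. h n \<omega> \<partial>P x) \<longlonglongrightarrow> 0" by simp
  have h_int: "(\<integral>\<^sup>+\<omega>. h n \<omega> \<partial>P x) = ennreal (exp (l1 * real n) * measure (P x) (E n))" for n
    unfolding h_def using E[of n] by (simp add: nn_integral_cmult_indicator emeasure_eq_measure ennreal_mult)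
  define c where "c = exp (l1 * q) * e / Cf"
  have c: "0 < c" using e Cf by (simp add: c_def)
  have "ennreal c \<le> 0"
  proof (rule LIMSEQ_le_const[OF lim])
    obtain N where N: "q \<le> real N" using real_arch_simple by blast
    show "\<exists>N. \<forall>n\<ge>N. ennreal c \<le> (\<integral>\<^sup>+\<omega>. h n \<omega> \<partial>P x)"
      using lower N unfolding h_int c_def by (intro exI[of _ N] allI impI ennreal_leI) auto
  qed
  then show False using c by simp
qed

theorem Inf_spectrum_eq_Sup_exp_moments:
  assumes x: "0 < x"
  shows "Inf ((\<lambda>z. ereal (Re z)) ` operator_spectrum \<mu> (H_D a b)) =
    Sup (ereal ` {l. 0 \<le> l \<and> (\<integral>\<^sup>+\<omega>. exp_ereal (ereal l * hitting_time_0 X \<omega>) \<partial>P x) < \<infinity>})"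
    (is "_ = Sup (ereal ` ?L)")
proof -
  have "Sup (ereal ` ?L) = ereal bottom"
  proof (rule antisym)
    show "Sup (ereal ` ?L) \<le> ereal bottom"
      using exp_moment_le_bottom[OF x] by (intro Sup_least) auto
    show "ereal bottom \<le> Sup (ereal ` ?L)"
    proof (rule le_Sup_iff[THEN iffD2], intro allI impI)
      fix y assume y: "y < ereal bottom"
      show "\<exists>i\<in>ereal ` ?L. y < i"
      proof (cases "y < 0")
        case True
        \<comment> \<open>The exponent 0 always belongs to the set, since
          \<open>0 * \<infinity> = 0\<close> for extended reals. It keeps the set nonempty when
          \<open>bottom\<close> is 0.\<close>
        interpret prob_space "P x" by (rule process(1)[OF x])
        have "(\<integral>\<^sup>+\<omega>. exp_ereal (ereal 0 * hitting_time_0 X \<omega>) \<partial>P x) = (\<integral>\<^sup>+\<omega>. 1 \<partial>P x)"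
          by (intro nn_integral_cong) (simp add: exp_ereal_def zero_ereal_def[symmetric], simp add: zero_ereal_def)
        then have "0 \<in> ?L" by (simp add: emeasure_space_1)
        then show ?thesis using True by (intro bexI[of _ "ereal 0"]) (auto simp: zero_ereal_def)
      next
        case False
        obtain r where r: "y < ereal r" "ereal r < ereal bottom" using ereal_dense2[OF y] by blast
        have "ereal 0 \<le> y" using False by (simp add: zero_ereal_def[symmetric])
        then have "ereal 0 < ereal r" using r(1) by (rule le_less_trans)
        then have "0 \<le> r" by simp
        then have "r \<in> ?L" using exp_moment_finite[OF x, of r] r(2) by simp
        then show ?thesis using r(1) by blast
      qed
    qed
  qed
  then show ?thesis by (simp only: Inf_spectrum)
qed

end

theorem mainTheorem4:
  fixes a b :: "real \<Rightarrow> real"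
    and P :: "real \<Rightarrow> 'w measure"
    and X :: "real \<Rightarrow> 'w \<Rightarrow> real"
  assumes "\<exists>a'. (\<forall>x\<ge>0. (a has_real_derivative a' x) (at x within {0..})) \<and> continuous_on {0..} a'"
    and "\<forall>x\<ge>0. 0 < a x"
    and "continuous_on {0..} b"
    and "(\<integral>\<^sup>+x\<in>{0..}. ennreal (1 / a x * exp (- 2 * drift_potential a b x)) \<partial>lborel) = \<infinity>"
    and "killed_diffusion a b P X"
  shows "\<forall>x>0.
    Inf ((\<lambda>z. ereal (Re z)) ` operator_spectrum (speed_measure a b) (H_D a b)) =
    Sup (ereal ` {l. 0 \<le> l \<and>
      (\<integral>\<^sup>+\<omega>. exp_ereal (ereal l * hitting_time_0 X \<omega>) \<partial>P x) < \<infinity>})"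
proof -
  obtain a' where a': "\<forall>x\<ge>0. (a has_real_derivative a' x) (at x within {0..})" "continuous_on {0..} a'"
    using assms(1) by blast
  interpret diffusion_coeffs a b a'
    by unfold_locales (use a' assms(2,3) in auto)
  \<comment> \<open>The infinite Lebesgue integral is translated into an unbounded scale function:
    bounded partial integrals would bound the whole integral, by monotone convergence.\<close>
  have "\<exists>x\<ge>0. C < integral {0..x} (\<lambda>x. 1 / p x)" for C
  proof (rule ccontr)
    assume "\<not> ?thesis"
    then have C: "integral {0..x} (\<lambda>x. 1 / p x) \<le> C" if "0 \<le> x" for x using that by (meson not_less)
    define g where "g n x = indicator {0..real n} x *\<^sub>R (1 / p x)" for n x
    have g0: "0 \<le> g n x" for n x using p_pos[of x] by (simp add: g_def indicator_def less_imp_le)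
    have sub: "{0..real n} \<subseteq> {0..}" for n by auto
    have gm: "g n \<in> borel_measurable borel" for n
      unfolding g_def[abs_def]
      by (rule borel_measurable_continuous_on_indicator[OF _ continuous_on_subset[OF inverse_p_cont sub]]) simp
    have gi: "(\<integral>\<^sup>+x. ennreal (g n x) \<partial>lborel) \<le> ennreal C" for n
    proof -
      have "((\<lambda>x. 1 / p x) has_integral integral {0..real n} (\<lambda>x. 1 / p x)) {0..real n}"
        by (intro integrable_integral integrable_continuous_interval continuous_on_subset[OF inverse_p_cont sub])
      then have "((\<lambda>x. if x \<in> {0..real n} then 1 / p x else 0) has_integral integral {0..real n} (\<lambda>x. 1 / p x)) UNIV"
        by (subst has_integral_restrict_UNIV)
      moreover have "(\<lambda>x. if x \<in> {0..real n} then 1 / p x else 0) = g n" by (auto simp: g_def indicator_def)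
      ultimately have "(g n has_integral integral {0..real n} (\<lambda>x. 1 / p x)) UNIV" by simp
      then have "(\<integral>\<^sup>+x. ennreal (g n x) \<partial>lborel) = ennreal (integral {0..real n} (\<lambda>x. 1 / p x))"
        by (rule nn_integral_has_integral_lborel[OF gm g0])
      also have "\<dots> \<le> ennreal C" by (intro ennreal_leI C) simp
      finally show ?thesis .
    qed
    have "(\<integral>\<^sup>+x\<in>{0..}. ennreal (1 / a x * exp (- 2 * drift_potential a b x)) \<partial>lborel) =
        (\<integral>\<^sup>+x. (SUP n. ennreal (g n x)) \<partial>lborel)"
    proof (rule nn_integral_cong)
      fix x :: real
      show "ennreal (1 / a x * exp (- 2 * drift_potential a b x)) * indicator {0..} x = (SUP n. ennreal (g n x))"
      proof (cases "0 \<le> x")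
        case True
        obtain N where N: "x \<le> real N" using real_arch_simple by blast
        have eq: "1 / a x * exp (- 2 * drift_potential a b x) = 1 / p x"
          by (simp add: p_def m_def exp_minus divide_inverse)
        have "(SUP n. ennreal (g n x)) = ennreal (1 / p x)"
        proof (rule antisym)
          show "(SUP n. ennreal (g n x)) \<le> ennreal (1 / p x)"
            by (intro SUP_least ennreal_leI) (use p_pos[OF True] in \<open>simp add: g_def indicator_def less_imp_le\<close>)
          have "ennreal (1 / p x) = ennreal (g N x)" using N True by (simp add: g_def)
          also have "\<dots> \<le> (SUP n. ennreal (g n x))" by (rule SUP_upper) simp
          finally show "ennreal (1 / p x) \<le> (SUP n. ennreal (g n x))" .
        qed
        then show ?thesis using True by (simp only: eq) simp
      next
        case False
        then show ?thesis by (simp add: g_def)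
      qed
    qed
    also have "\<dots> = (SUP n. \<integral>\<^sup>+x. ennreal (g n x) \<partial>lborel)"
    proof (rule nn_integral_monotone_convergence_SUP)
      show "incseq (\<lambda>n x. ennreal (g n x))"
      proof (intro incseq_SucI le_funI ennreal_leI)
        fix n x
        show "g n x \<le> g (Suc n) x" using p_pos[of x] by (auto simp: g_def indicator_def less_imp_le)
      qed
      show "(\<lambda>x. ennreal (g n x)) \<in> borel_measurable lborel" for n using gm[of n] by simp
    qed
    also have "\<dots> \<le> ennreal C" by (intro SUP_least gi)
    finally show False using assms(4) by (simp add: top_unique)
  qed
  then interpret diffusion_process a b a' P X
    by unfold_locales (use assms(5) in auto)
  show ?thesis using Inf_spectrum_eq_Sup_exp_moments by blast
qed

end
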